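(* Let $X$ be a symmetrically regular complex Banach space such that $X^{**}$ has the metric approximation property. Let $f\in\mathcal HL_0(B_X)$ with $L(f)=1$. The following are equivalent: (i) $f$ has a unique norm preserving extension to $\mathcal HL_0(B_{X^{**}})$, i.e. there is exactly one $g\in\mathcal HL_0(B_{X^{**}})$ with $g|_{B_X}=f$ and $L(g)=L(f)$. (ii) The AB extension $h\mapsto\widetilde h$ from $(\overline B_{\mathcal HL_0(B_X)},w^* )$ to $(\overline B_{\mathcal HL_0(B_{X^{**}})},w^* )$ is continuous at $f$. (iii) If a net $(f_\alpha)\subset\overline B_{\mathcal HL_0(B_X)}$ converges pointwise to $f$ on $B_X$, then $(\widetilde f_\alpha)\subset\overline B_{\mathcal HL_0(B_{X^{**}})}$ converges pointwise to $\widetilde f$ on $B_{X^{**}}$.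
   Context: $X$ is symmetrically regular if every bounded symmetric linear operator $T:X\to X^*$ (i.e. $T(x)(y)=T(y)(x)$ for all $x,y\in X$) is weakly compact. A Banach space $E$ has the metric approximation property if the identity of $E$ is a pointwise limit of a net of finite-rank operators on $E$ of norm at most $1$. $B_X$ is the open unit ball of $X$; $X$ is regarded as a subspace of $X^{**}$. $\mathcal HL_0(B_X)$ is the Banach space of holomorphic Lipschitz functions $f:B_X\to\mathbb C$ with $f(0)=0$, normed by the Lipschitz constant $L(f)$, and $\overline B_{\mathcal HL_0(B_X)}=\{f:L(f)\le1\}$; similarly for $X^{**}$. The space $\mathcal HL_0(B_X)$ is isometrically the dual of $\mathcal G_0(B_X)=\{\varphi\in\mathcal HL_0(B_X)^*: \varphi|_{\overline B_{\mathcal HL_0(B_X)}}\text{ is continuous for the compact-open topology}\}$ via $\langle f,\varphi\rangle=\varphi(f)$, and $w^*$ denotes the corresponding weak-star topology; similarly for $X^{**}$. AB (Aron-Berner) extension: for a bounded symmetric $n$-linear form $A$ on $X$, put $\widetilde A(x_1^{**},\dots,x_n^{**})=\lim_{\alpha_1}\cdots\lim_{\alpha_n}A(x_{\alpha_1},\dots,x_{\alpha_n})$, where $(x_{\alpha_i})\subset X$ is a net weak-star convergent to $x_i^{**}$; for the $n$-homogeneous polynomial $P(x)=A(x,\dots,x)$ put $\widetilde P(x^{**})=\widetilde A(x^{**},\dots,x^{**})$. For a bounded holomorphic $f:B_X\to\mathbb C$ with Taylor series $\sum_k P_k$ at $0$, $\widetilde f=\sum_k\widetilde P_k$ on $B_{X^{**}}$.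 For $X$ symmetrically regular, $f\mapsto\widetilde f$ maps $\mathcal HL_0(B_X)$ isometrically into $\mathcal HL_0(B_{X^{**}})$. *)

theory Defs
  imports "HOL-Analysis.Analysis"
begin

section \<open>Complex normed spaces\<close>

class complex_normed_vector = real_normed_vector +
  fixes scaleC :: "complex \<Rightarrow> 'a \<Rightarrow> 'a" (infixr \<open>*\<^sub>C\<close> 75)
  assumes scaleC_add_right: "c *\<^sub>C (x + y) = c *\<^sub>C x + c *\<^sub>C y"
    and scaleC_add_left: "(c + d) *\<^sub>C x = c *\<^sub>C x + d *\<^sub>C x"
    and scaleC_scaleC: "c *\<^sub>C d *\<^sub>C x = (c * d) *\<^sub>C x"
    and scaleR_scaleC: "r *\<^sub>R x = complex_of_real r *\<^sub>C x"
    and norm_scaleC: "norm (c *\<^sub>C x) = cmod c * norm x"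

global_interpretation complex_vector:
  vector_space "scaleC :: complex \<Rightarrow> 'a \<Rightarrow> 'a::complex_normed_vector"
proof
  show "1 *\<^sub>C x = x" for x :: 'a
    using scaleR_scaleC[of 1 x] by simp
qed (simp_all add: scaleC_add_right scaleC_add_left scaleC_scaleC)

instantiation complex :: complex_normed_vector
begin

definition scaleC_complex :: "complex \<Rightarrow> complex \<Rightarrow> complex"
  where "scaleC_complex c x = c * x"

instance
  by standard (simp_all add: scaleC_complex_def algebra_simps norm_mult scaleR_conv_of_real)

end

definition clinear :: "('a::complex_normed_vector \<Rightarrow> 'b::complex_normed_vector) \<Rightarrow> bool"
  where "clinear T \<longleftrightarrow> (\<forall>x y. T (x + y) = T x + T y) \<and> (\<forall>c x. T (c *\<^sub>C x) = c *\<^sub>C T x)"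

definition bounded_clinear :: "('a::complex_normed_vector \<Rightarrow> 'b::complex_normed_vector) \<Rightarrow> bool"
  where "bounded_clinear T \<longleftrightarrow> clinear T \<and> (\<exists>K. \<forall>x. norm (T x) \<le> norm x * K)"

lemma bounded_clinear_iff:
  "bounded_clinear T \<longleftrightarrow> bounded_linear T \<and> (\<forall>c x. T (c *\<^sub>C x) = c *\<^sub>C T x)"
  unfolding bounded_clinear_def clinear_def bounded_linear_def bounded_linear_axioms_def
    linear_iff by (auto simp: scaleR_scaleC)


section \<open>The dual space\<close>

typedef (overloaded) 'a cdual =
  "{\<phi> :: 'a::complex_normed_vector \<Rightarrow> complex. bounded_clinear \<phi>}"
  morphisms cdual_apply Cdual
  by (rule exI[of _ "\<lambda>_. 0"])
    (auto simp: bounded_clinear_def clinear_def scaleC_complex_def intro!: exI[of _ 0])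

setup_lifting type_definition_cdual

lemma cdual_eqI: "(\<And>x. cdual_apply \<phi> x = cdual_apply \<psi> x) \<Longrightarrow> \<phi> = \<psi>"
  by transfer auto

instantiation cdual :: (complex_normed_vector) complex_normed_vector
begin

lift_definition norm_cdual :: "'a cdual \<Rightarrow> real" is onorm .

lift_definition minus_cdual :: "'a cdual \<Rightarrow> 'a cdual \<Rightarrow> 'a cdual" is "\<lambda>f g x. f x - g x"
  by (auto simp: bounded_clinear_iff scaleC_complex_def algebra_simps bounded_linear_sub)

lift_definition uminus_cdual :: "'a cdual \<Rightarrow> 'a cdual" is "\<lambda>f x. - f x"
  by (auto simp: bounded_clinear_iff scaleC_complex_def bounded_linear_minus)

lift_definition zero_cdual :: "'a cdual" is "\<lambda>x. 0"
  by (auto simp: bounded_clinear_iff scaleC_complex_def)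

lift_definition plus_cdual :: "'a cdual \<Rightarrow> 'a cdual \<Rightarrow> 'a cdual" is "\<lambda>f g x. f x + g x"
  by (auto simp: bounded_clinear_iff scaleC_complex_def algebra_simps bounded_linear_add)

lift_definition scaleC_cdual :: "complex \<Rightarrow> 'a cdual \<Rightarrow> 'a cdual" is "\<lambda>c f x. c * f x"
  by (auto simp: bounded_clinear_iff scaleC_complex_def bounded_linear_const_mult)

lift_definition scaleR_cdual :: "real \<Rightarrow> 'a cdual \<Rightarrow> 'a cdual" is "\<lambda>r f x. r *\<^sub>R f x"
  by (auto simp: bounded_clinear_iff scaleC_complex_def bounded_linear_const_scaleR)

definition dist_cdual :: "'a cdual \<Rightarrow> 'a cdual \<Rightarrow> real"
  where "dist_cdual a b = norm (a - b)"

definition uniformity_cdual :: "('a cdual \<times> 'a cdual) filter"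
  where [code del]: "uniformity_cdual = (INF e\<in>{0 <..}. principal {(x, y). dist x y < e})"

definition open_cdual :: "'a cdual set \<Rightarrow> bool"
  where [code del]: "open_cdual S = (\<forall>x\<in>S. \<forall>\<^sub>F (x', y) in uniformity. x' = x \<longrightarrow> y \<in> S)"

definition sgn_cdual :: "'a cdual \<Rightarrow> 'a cdual"
  where "sgn_cdual x = scaleR (inverse (norm x)) x"

lemma onorm_mult_left_complex:
  assumes "bounded_linear (f :: 'a \<Rightarrow> complex)"
  shows "onorm (\<lambda>x. c * f x) = cmod c * onorm f"
proof (cases "c = 0")
  case True
  then show ?thesis by (simp add: onorm_zero)
next
  case False
  have le: "onorm (\<lambda>x. d * g x) \<le> cmod d * onorm g"
    if "bounded_linear g" for d and g :: "'a \<Rightarrow> complex"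
  proof (rule onorm_bound)
    show "0 \<le> cmod d * onorm g" by (simp add: onorm_pos_le that)
    show "cmod (d * g x) \<le> cmod d * onorm g * norm x" for x
      using mult_left_mono[OF onorm[OF that, of x], of "cmod d"]
      by (simp add: norm_mult mult.assoc)
  qed
  have "onorm f = onorm (\<lambda>x. inverse c * (c * f x))"
    using False by (simp add: mult.assoc[symmetric])
  also have "\<dots> \<le> cmod (inverse c) * onorm (\<lambda>x. c * f x)"
    by (rule le) (simp add: assms bounded_linear_const_mult)
  finally have "cmod c * onorm f \<le> onorm (\<lambda>x. c * f x)"
    using False by (simp add: norm_divide inverse_eq_divide field_simps)
  with le[OF assms, of c] show ?thesis by simp
qed

instance
proof
  fix a b x y :: "'a cdual" and r s :: real and c d :: complex
  show "a + b + x = a + (b + x)" by transfer (simp add: algebra_simps)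
  show "a + b = b + a" by transfer (simp add: algebra_simps)
  show "0 + a = a" by transfer simp
  show "- a + a = 0" by transfer simp
  show "a - b = a + - b" by transfer simp
  show "r *\<^sub>R (x + y) = r *\<^sub>R x + r *\<^sub>R y" by transfer (simp add: algebra_simps)
  show "(r + s) *\<^sub>R x = r *\<^sub>R x + s *\<^sub>R x" by transfer (simp add: algebra_simps)
  show "r *\<^sub>R s *\<^sub>R x = (r * s) *\<^sub>R x" by transfer simp
  show "1 *\<^sub>R x = x" by transfer simp
  show "sgn x = inverse (norm x) *\<^sub>R x" by (rule sgn_cdual_def)
  show "dist x y = norm (x - y)" by (rule dist_cdual_def)
  show "(uniformity :: ('a cdual \<times> 'a cdual) filter) =
      (INF e\<in>{0 <..}. principal {(x, y). dist x y < e})" by (rule uniformity_cdual_def)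
  show "open S = (\<forall>x\<in>S. \<forall>\<^sub>F (x', y) in uniformity. x' = x \<longrightarrow> y \<in> S)" for S :: "'a cdual set"
    by (rule open_cdual_def)
  show "norm x = 0 \<longleftrightarrow> x = 0" by transfer (auto simp: bounded_clinear_iff onorm_eq_0)
  show "norm (x + y) \<le> norm x + norm y"
    by transfer (auto simp: bounded_clinear_iff onorm_triangle)
  show "norm (r *\<^sub>R x) = \<bar>r\<bar> * norm x"
    by transfer (auto simp: bounded_clinear_iff onorm_scaleR)
  show "c *\<^sub>C (x + y) = c *\<^sub>C x + c *\<^sub>C y" by transfer (simp add: algebra_simps)
  show "(c + d) *\<^sub>C x = c *\<^sub>C x + d *\<^sub>C x" by transfer (simp add: algebra_simps)
  show "c *\<^sub>C d *\<^sub>C x = (c * d) *\<^sub>C x" by transfer (simp add: mult.assoc)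
  show "r *\<^sub>R x = complex_of_real r *\<^sub>C x" by transfer (simp add: scaleR_conv_of_real)
  show "norm (c *\<^sub>C x) = cmod c * norm x"
    by transfer (auto simp: bounded_clinear_iff onorm_mult_left_complex)
qed

end

lemma cdual_apply_bound: "cmod (cdual_apply \<phi> x) \<le> norm \<phi> * norm x"
  by transfer (auto simp: bounded_clinear_iff onorm)

text \<open>The canonical embedding of a space into its bidual.\<close>

lift_definition bidual_embed :: "'a::complex_normed_vector \<Rightarrow> 'a cdual cdual"
  is "\<lambda>x \<phi>. cdual_apply \<phi> x"
proof -
  fix x :: 'a
  show "bounded_clinear (\<lambda>\<phi>. cdual_apply \<phi> x)"
    unfolding bounded_clinear_def clinear_def
    by (intro conjI allI exI[of _ "norm x"] cdual_apply_bound)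
      (simp_all add: plus_cdual.rep_eq scaleC_cdual.rep_eq scaleC_complex_def)
qed


section \<open>Weak topologies and the properties of Banach spaces\<close>

definition initial_topology :: "('a \<Rightarrow> complex) set \<Rightarrow> 'a topology"
  where "initial_topology \<Phi> =
    pullback_topology UNIV (\<lambda>x. \<lambda>\<phi>\<in>\<Phi>. \<phi> x) (product_topology (\<lambda>_. euclidean) \<Phi>)"

definition weak_topology :: "'a::complex_normed_vector topology"
  where "weak_topology = initial_topology (range cdual_apply)"

definition weak_star_topology :: "'a::complex_normed_vector cdual topology"
  where "weak_star_topology = initial_topology (range (\<lambda>x \<phi>. cdual_apply \<phi> x))"

definition weakly_compact_operator ::
    "('a::complex_normed_vector \<Rightarrow> 'b::complex_normed_vector) \<Rightarrow> bool"
  where "weakly_compact_operator T \<longleftrightarrow>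
    bounded_clinear T \<and> compactin weak_topology (weak_topology closure_of (T ` cball 0 1))"

definition symmetrically_regular :: "'a::complex_normed_vector itself \<Rightarrow> bool"
  where "symmetrically_regular _ \<longleftrightarrow>
    (\<forall>T :: 'a \<Rightarrow> 'a cdual. bounded_clinear T \<longrightarrow>
      (\<forall>x y. cdual_apply (T x) y = cdual_apply (T y) x) \<longrightarrow> weakly_compact_operator T)"

definition finite_rank :: "('a \<Rightarrow> 'b::complex_normed_vector) \<Rightarrow> bool"
  where "finite_rank T \<longleftrightarrow> (\<exists>B. finite B \<and> range T \<subseteq> complex_vector.span B)"

text \<open>
  Here and below a net is represented by a proper filter on the set in which the net takes its
  values (the filter generated by the tails of the net; conversely every proper filter arises
  in this way).
\<close>

definition metric_approximation_property :: "'a::complex_normed_vector itself \<Rightarrow> bool"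
  where "metric_approximation_property _ \<longleftrightarrow>
    (\<exists>F :: ('a \<Rightarrow> 'a) filter. F \<noteq> bot \<and>
      (\<forall>\<^sub>F T in F. bounded_clinear T \<and> finite_rank T \<and> onorm T \<le> 1) \<and>
      (\<forall>x. ((\<lambda>T. T x) \<longlongrightarrow> x) F))"


section \<open>Holomorphic Lipschitz functions on the unit ball\<close>

definition holomorphic_on_ball :: "('a::complex_normed_vector \<Rightarrow> complex) \<Rightarrow> bool"
  where "holomorphic_on_ball f \<longleftrightarrow>
    (\<forall>x\<in>ball 0 1. \<exists>D. bounded_clinear D \<and> (f has_derivative D) (at x))"

text \<open>The pairs with \<open>x = y\<close> contribute \<open>0\<close>, since \<open>0 / 0 = 0\<close>.\<close>

definition lipschitz_const :: "('a::complex_normed_vector \<Rightarrow> complex) \<Rightarrow> real"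
  where "lipschitz_const f =
    (SUP (x, y) \<in> ball 0 1 \<times> ball 0 1. cmod (f x - f y) / norm (x - y))"

text \<open>
  Functions on the open unit ball are represented by total functions vanishing off the ball, so
  that equality in the following type is equality on the ball.
\<close>

typedef (overloaded) 'a hl0 =
  "{f :: 'a::complex_normed_vector \<Rightarrow> complex.
     holomorphic_on_ball f \<and> (\<exists>C. C-lipschitz_on (ball 0 1) f) \<and> f 0 = 0 \<and>
     (\<forall>x. x \<notin> ball 0 1 \<longrightarrow> f x = 0)}"
  morphisms hl0_apply HL0
  by (rule exI[of _ "\<lambda>_. 0"])
    (auto simp: holomorphic_on_ball_def bounded_clinear_iff scaleC_complex_def
      intro!: exI[of _ 0] exI[of _ "\<lambda>_. 0"] lipschitz_onI)

setup_lifting type_definition_hl0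

lemma hl0_eqI:
  assumes "\<And>x. x \<in> ball 0 1 \<Longrightarrow> hl0_apply f x = hl0_apply g x"
  shows "f = g"
proof -
  have "hl0_apply f x = hl0_apply g x" for x
  proof (cases "x \<in> ball 0 1")
    case False
    with hl0_apply[of f] hl0_apply[of g] show ?thesis by (metis (mono_tags, lifting) mem_Collect_eq)
  qed (rule assms)
  then show ?thesis by (simp add: hl0_apply_inject[symmetric] fun_eq_iff)
qed

lemma lipschitz_const_le:
  assumes "C-lipschitz_on (ball 0 1) f"
  shows "lipschitz_const f \<le> C"
  unfolding lipschitz_const_def
proof (rule cSUP_least)
  show "(ball 0 1 \<times> ball 0 1 :: ('a \<times> 'a) set) \<noteq> {}" by auto
  fix p :: "'a \<times> 'a" assume "p \<in> ball 0 1 \<times> ball 0 1"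
  then obtain x y where p: "p = (x, y)" "x \<in> ball 0 1" "y \<in> ball 0 1" by auto
  show "(case p of (x, y) \<Rightarrow> cmod (f x - f y) / norm (x - y)) \<le> C"
    using lipschitz_onD[OF assms p(2,3)] lipschitz_on_nonneg[OF assms]
    by (cases "x = y") (auto simp: p(1) dist_norm divide_simps mult.commute)
qed

lemma lipschitz_const_bound:
  assumes "C-lipschitz_on (ball 0 1) f" "x \<in> ball 0 1" "y \<in> ball 0 1"
  shows "cmod (f x - f y) \<le> lipschitz_const f * norm (x - y)"
proof (cases "x = y")
  case False
  have "(case (x, y) of (x, y) \<Rightarrow> cmod (f x - f y) / norm (x - y)) \<le> lipschitz_const f"
    unfolding lipschitz_const_def
  proof (rule cSUP_upper)
    show "bdd_above ((\<lambda>(x, y). cmod (f x - f y) / norm (x - y)) ` (ball 0 1 \<times> ball 0 1))"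
    proof (rule bdd_aboveI2)
      fix p :: "'a \<times> 'a" assume "p \<in> ball 0 1 \<times> ball 0 1"
      then obtain x y where p: "p = (x, y)" "x \<in> ball 0 1" "y \<in> ball 0 1" by auto
      show "(case p of (x, y) \<Rightarrow> cmod (f x - f y) / norm (x - y)) \<le> C"
        using lipschitz_onD[OF assms(1) p(2,3)] lipschitz_on_nonneg[OF assms(1)]
        by (cases "x = y") (auto simp: p(1) dist_norm divide_simps mult.commute)
    qed
  qed (use assms in auto)
  with False show ?thesis by (simp add: divide_simps mult.commute)
qed simp

lemma lipschitz_const_nonneg:
  assumes "C-lipschitz_on (ball 0 1) (f :: 'a::complex_normed_vector \<Rightarrow> complex)"
  shows "0 \<le> lipschitz_const f"
proof (cases "\<exists>x::'a. x \<in> ball 0 1 \<and> x \<noteq> 0")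
  case True
  then obtain x :: 'a where x: "x \<in> ball 0 1" "x \<noteq> 0" by blast
  have "0 \<le> lipschitz_const f * norm (x - 0)"
    using lipschitz_const_bound[OF assms x(1), of 0] by (meson centre_in_ball norm_ge_zero order_trans zero_less_one)
  with x show ?thesis by (simp add: zero_le_mult_iff)
next
  case False
  then have "ball 0 1 = {0::'a}" by auto
  then show ?thesis by (simp add: lipschitz_const_def)
qed

lemma lipschitz_on_lipschitz_const:
  "C-lipschitz_on (ball 0 1) f \<Longrightarrow> (lipschitz_const f)-lipschitz_on (ball 0 1) f"
  by (rule lipschitz_onI) (auto simp: dist_norm lipschitz_const_bound lipschitz_const_nonneg)

lemma lipschitz_const_add:
  assumes "C-lipschitz_on (ball 0 1) f" "D-lipschitz_on (ball 0 1) g"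
  shows "lipschitz_const (\<lambda>x. f x + g x) \<le> lipschitz_const f + lipschitz_const g"
  by (intro lipschitz_const_le lipschitz_on_add lipschitz_on_lipschitz_const[OF assms(1)]
      lipschitz_on_lipschitz_const[OF assms(2)])

lemma lipschitz_on_cmult_complex:
  fixes f :: "'a::metric_space \<Rightarrow> complex"
  assumes "C-lipschitz_on S f"
  shows "(cmod c * C)-lipschitz_on S (\<lambda>x. c * f x)"
proof (rule lipschitz_onI)
  show "0 \<le> cmod c * C" using lipschitz_on_nonneg[OF assms] by simp
  fix x y assume "x \<in> S" "y \<in> S"
  then show "dist (c * f x) (c * f y) \<le> cmod c * C * dist x y"
    using mult_left_mono[OF lipschitz_onD[OF assms, of x y], of "cmod c"]
    by (simp add: dist_norm right_diff_distrib[symmetric] norm_mult mult.assoc)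
qed

lemma lipschitz_const_cmult:
  assumes "C-lipschitz_on (ball 0 1) f"
  shows "lipschitz_const (\<lambda>x. c * f x) = cmod c * lipschitz_const f"
proof (cases "c = 0")
  case True
  have "lipschitz_const (\<lambda>x::'a. 0) = 0"
    by (intro antisym lipschitz_const_le lipschitz_const_nonneg[of 0]) (auto intro: lipschitz_onI)
  with True show ?thesis by simp
next
  case False
  have le: "lipschitz_const (\<lambda>x. d * g x) \<le> cmod d * lipschitz_const g"
    if "D-lipschitz_on (ball 0 1) g" for d D and g :: "'a \<Rightarrow> complex"
    by (intro lipschitz_const_le lipschitz_on_cmult_complex lipschitz_on_lipschitz_const[OF that])
  have "lipschitz_const f = lipschitz_const (\<lambda>x. inverse c * (c * f x))"
    using False by (simp add: mult.assoc[symmetric])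
  also have "\<dots> \<le> cmod (inverse c) * lipschitz_const (\<lambda>x. c * f x)"
    by (rule le[OF lipschitz_on_cmult_complex[OF assms]])
  finally have "cmod c * lipschitz_const f \<le> lipschitz_const (\<lambda>x. c * f x)"
    using False by (simp add: norm_divide inverse_eq_divide field_simps)
  with le[OF assms, of c] show ?thesis by simp
qed

lemma holomorphic_on_ball_add:
  assumes "holomorphic_on_ball f" "holomorphic_on_ball g"
  shows "holomorphic_on_ball (\<lambda>x. f x + g x)"
  unfolding holomorphic_on_ball_def
proof
  fix x :: 'a assume x: "x \<in> ball 0 1"
  obtain D E where "bounded_clinear D" "(f has_derivative D) (at x)"
    "bounded_clinear E" "(g has_derivative E) (at x)"
    using assms x unfolding holomorphic_on_ball_def by meson
  then show "\<exists>D. bounded_clinear D \<and> ((\<lambda>x. f x + g x) has_derivative D) (at x)"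
    by (intro exI[of _ "\<lambda>x. D x + E x"])
      (auto intro: has_derivative_add bounded_linear_add
        simp: bounded_clinear_iff scaleC_complex_def algebra_simps)
qed

lemma holomorphic_on_ball_cmult:
  assumes "holomorphic_on_ball f"
  shows "holomorphic_on_ball (\<lambda>x. c * f x)"
  unfolding holomorphic_on_ball_def
proof
  fix x :: 'a assume x: "x \<in> ball 0 1"
  obtain D where "bounded_clinear D" "(f has_derivative D) (at x)"
    using assms x unfolding holomorphic_on_ball_def by meson
  then show "\<exists>D. bounded_clinear D \<and> ((\<lambda>x. c * f x) has_derivative D) (at x)"
    by (intro exI[of _ "\<lambda>x. c * D x"])
      (auto intro: has_derivative_mult_right bounded_linear_const_mult
        simp: bounded_clinear_iff scaleC_complex_def algebra_simps)
qed

instantiation hl0 :: (complex_normed_vector) complex_normed_vector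
begin

lift_definition norm_hl0 :: "'a hl0 \<Rightarrow> real" is lipschitz_const .

lift_definition zero_hl0 :: "'a hl0" is "\<lambda>x. 0"
  by (auto simp: holomorphic_on_ball_def bounded_clinear_iff scaleC_complex_def
      intro!: exI[of _ 0] exI[of _ "\<lambda>_. 0"] lipschitz_onI)

lift_definition plus_hl0 :: "'a hl0 \<Rightarrow> 'a hl0 \<Rightarrow> 'a hl0" is "\<lambda>f g x. f x + g x"
  by (elim conjE exE, intro conjI exI holomorphic_on_ball_add)
    (assumption | rule lipschitz_on_add | simp)+

lift_definition scaleC_hl0 :: "complex \<Rightarrow> 'a hl0 \<Rightarrow> 'a hl0" is "\<lambda>c f x. c * f x"
  by (elim conjE exE, intro conjI exI holomorphic_on_ball_cmult)
    (assumption | rule lipschitz_on_cmult_complex | simp)+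

definition uminus_hl0 :: "'a hl0 \<Rightarrow> 'a hl0" where "uminus_hl0 f = (- 1) *\<^sub>C f"

definition minus_hl0 :: "'a hl0 \<Rightarrow> 'a hl0 \<Rightarrow> 'a hl0" where "minus_hl0 f g = f + - g"

definition scaleR_hl0 :: "real \<Rightarrow> 'a hl0 \<Rightarrow> 'a hl0"
  where "scaleR_hl0 r f = complex_of_real r *\<^sub>C f"

definition dist_hl0 :: "'a hl0 \<Rightarrow> 'a hl0 \<Rightarrow> real"
  where "dist_hl0 a b = norm (a - b)"

definition uniformity_hl0 :: "('a hl0 \<times> 'a hl0) filter"
  where [code del]: "uniformity_hl0 = (INF e\<in>{0 <..}. principal {(x, y). dist x y < e})"

definition open_hl0 :: "'a hl0 set \<Rightarrow> bool"
  where [code del]: "open_hl0 S = (\<forall>x\<in>S. \<forall>\<^sub>F (x', y) in uniformity. x' = x \<longrightarrow> y \<in> S)"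

definition sgn_hl0 :: "'a hl0 \<Rightarrow> 'a hl0"
  where "sgn_hl0 x = scaleR (inverse (norm x)) x"

instance
proof
  fix a b x y :: "'a hl0" and r s :: real and c d :: complex
  show "a + b + x = a + (b + x)" by transfer (simp add: algebra_simps)
  show "a + b = b + a" by transfer (simp add: algebra_simps)
  show "0 + a = a" by transfer simp
  show "- a + a = 0" unfolding uminus_hl0_def by transfer simp
  show "a - b = a + - b" by (rule minus_hl0_def)
  show "r *\<^sub>R (x + y) = r *\<^sub>R x + r *\<^sub>R y"
    unfolding scaleR_hl0_def by transfer (simp add: algebra_simps)
  show "(r + s) *\<^sub>R x = r *\<^sub>R x + s *\<^sub>R x"
    unfolding scaleR_hl0_def by transfer (simp add: algebra_simps)
  show "r *\<^sub>R s *\<^sub>R x = (r * s) *\<^sub>R x"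
    unfolding scaleR_hl0_def by transfer (simp add: algebra_simps)
  show "1 *\<^sub>R x = x" unfolding scaleR_hl0_def by transfer simp
  show "sgn x = inverse (norm x) *\<^sub>R x" by (rule sgn_hl0_def)
  show "dist x y = norm (x - y)" by (rule dist_hl0_def)
  show "(uniformity :: ('a hl0 \<times> 'a hl0) filter) =
      (INF e\<in>{0 <..}. principal {(x, y). dist x y < e})" by (rule uniformity_hl0_def)
  show "open S = (\<forall>x\<in>S. \<forall>\<^sub>F (x', y) in uniformity. x' = x \<longrightarrow> y \<in> S)" for S :: "'a hl0 set"
    by (rule open_hl0_def)
  have "norm (c *\<^sub>C x) = cmod c * norm x" for c and x :: "'a hl0"
    by transfer (auto simp: lipschitz_const_cmult)
  then show "norm (c *\<^sub>C x) = cmod c * norm x"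
    and "norm (r *\<^sub>R x) = \<bar>r\<bar> * norm x" by (simp_all add: scaleR_hl0_def)
  have "norm (0 *\<^sub>C x) = cmod 0 * norm x" by fact
  moreover have "0 *\<^sub>C x = 0" by transfer simp
  ultimately have norm0: "norm (0 :: 'a hl0) = 0" by simp
  have "x = 0" if "norm x = 0"
  proof (rule hl0_eqI)
    fix z :: 'a assume "z \<in> ball 0 1"
    with that show "hl0_apply x z = hl0_apply 0 z"
    proof transfer
      fix f :: "'a \<Rightarrow> complex" and z :: 'a
      assume f: "holomorphic_on_ball f \<and> (\<exists>C. C-lipschitz_on (ball 0 1) f) \<and> f 0 = 0 \<and>
        (\<forall>x. x \<notin> ball 0 1 \<longrightarrow> f x = 0)" and "lipschitz_const f = 0" "z \<in> ball 0 1"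
      then show "f z = 0" using lipschitz_const_bound[of _ f z 0] by auto
    qed
  qed
  with norm0 show "norm x = 0 \<longleftrightarrow> x = 0" by auto
  show "norm (x + y) \<le> norm x + norm y"
    by transfer (auto intro: lipschitz_const_add)
  show "c *\<^sub>C (x + y) = c *\<^sub>C x + c *\<^sub>C y" by transfer (simp add: algebra_simps)
  show "(c + d) *\<^sub>C x = c *\<^sub>C x + d *\<^sub>C x" by transfer (simp add: algebra_simps)
  show "c *\<^sub>C d *\<^sub>C x = (c * d) *\<^sub>C x" by transfer (simp add: mult.assoc)
  show "r *\<^sub>R x = complex_of_real r *\<^sub>C x" by (rule scaleR_hl0_def)
qed

end


section \<open>The predual and its weak-star topology\<close>

definition compact_open_topology :: "'a::complex_normed_vector hl0 topology"
  where "compact_open_topology = topology_generated_by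
    {{f. hl0_apply f ` K \<subseteq> U} | K U. compact K \<and> K \<subseteq> ball 0 1 \<and> open U}"

definition G0 :: "'a::complex_normed_vector hl0 cdual set"
  where "G0 = {\<phi>. continuous_map (subtopology compact_open_topology (cball 0 1)) euclidean
                   (cdual_apply \<phi>)}"

definition hl0_weak_star :: "'a::complex_normed_vector hl0 topology"
  where "hl0_weak_star = initial_topology (cdual_apply ` G0)"


section \<open>The Aron-Berner extension\<close>

text \<open>An \<open>n\<close>-linear form is represented by a function on lists, which is relevant only for
  lists of length \<open>n\<close> and normalised to \<open>0\<close> on the others.\<close>

definition bounded_symmetric_form :: "nat \<Rightarrow> ('a::complex_normed_vector list \<Rightarrow> complex) \<Rightarrow> bool"
  where "bounded_symmetric_form n A \<longleftrightarrow>
    (\<forall>xs ys. length xs + length ys + 1 = n \<longrightarrow> clinear (\<lambda>x. A (xs @ x # ys))) \<and>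
    (\<exists>M. \<forall>xs. length xs = n \<longrightarrow> cmod (A xs) \<le> M * (\<Prod>x\<leftarrow>xs. norm x)) \<and>
    (\<forall>xs ys. length xs = n \<longrightarrow> mset xs = mset ys \<longrightarrow> A xs = A ys) \<and>
    (\<forall>xs. length xs \<noteq> n \<longrightarrow> A xs = 0)"

definition symmetric_form_of :: "nat \<Rightarrow> ('a::complex_normed_vector \<Rightarrow> complex) \<Rightarrow> 'a list \<Rightarrow> complex"
  where "symmetric_form_of n P =
    (THE A. bounded_symmetric_form n A \<and> (\<forall>x. P x = A (replicate n x)))"

text \<open>
  The filter of the points of \<open>X\<close> that are weak-star close to \<open>z\<close> in the bidual; the nets in
  \<open>X\<close> which converge weak-star to \<open>z\<close> are those whose filter of tails is finer than this one.
\<close>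

definition weak_star_approx :: "'a::complex_normed_vector cdual cdual \<Rightarrow> 'a filter"
  where "weak_star_approx z = filtercomap bidual_embed (nhdsin weak_star_topology z)"

text \<open>The iterated limit; the limit in the first variable is the outermost one.\<close>

primrec AB_form ::
    "'a::complex_normed_vector cdual cdual list \<Rightarrow> ('a list \<Rightarrow> complex) \<Rightarrow> complex"
  where
    "AB_form [] A = A []"
  | "AB_form (z # zs) A = Lim (weak_star_approx z) (\<lambda>x. AB_form zs (\<lambda>xs. A (x # xs)))"

definition AB_poly ::
    "nat \<Rightarrow> ('a::complex_normed_vector \<Rightarrow> complex) \<Rightarrow> 'a cdual cdual \<Rightarrow> complex"
  where "AB_poly n P z = AB_form (replicate n z) (symmetric_form_of n P)"

definition taylor_poly :: "nat \<Rightarrow> ('a::complex_normed_vector \<Rightarrow> complex) \<Rightarrow> 'a \<Rightarrow> complex"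
  where "taylor_poly k f x = (deriv ^^ k) (\<lambda>t. f (t *\<^sub>C x)) 0 / fact k"

definition AB_fun :: "('a::complex_normed_vector \<Rightarrow> complex) \<Rightarrow> 'a cdual cdual \<Rightarrow> complex"
  where "AB_fun f z = (if z \<in> ball 0 1 then \<Sum>k. AB_poly k (taylor_poly k f) z else 0)"

text \<open>
  This is the Aron-Berner extension only when \<open>AB_fun (hl0_apply f)\<close> is again holomorphic and
  Lipschitz, which is the case on symmetrically regular Banach spaces.
\<close>

definition AB_ext :: "'a::complex_normed_vector hl0 \<Rightarrow> 'a cdual cdual hl0"
  where "AB_ext f = HL0 (AB_fun (hl0_apply f))"

end

theory Submission
  imports Defs "HOL-Complex_Analysis.Complex_Analysis" "HOL-Library.Function_Algebras"
begin

text \<open>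
  On the unit ball of \<open>hl0\<close> the weak-star topology is the topology of pointwise convergence: the
  functions there are \<open>1\<close>-Lipschitz, so that pointwise convergence on the ball is already uniform on
  compact sets. Hence continuity of the extension map at \<open>f\<close> is the statement about pointwise
  convergent nets (\<open>topcontinuous_at_iff_pointwise\<close>). The link with uniqueness rests on two facts.

  The first is that \<open>AB_ext f\<close> is a norm preserving extension of \<open>f\<close> (\<open>norm_AB_ext\<close>,
  \<open>AB_ext_embed\<close>). Here one has to bound \<open>AB_fun f z - AB_fun f w\<close> by \<open>norm (z - w)\<close>. By
  \<open>davie_gamelin\<close>, points \<open>z\<close>, \<open>w\<close> of the open unit ball of the bidual can be replaced by points \<open>x\<close>,
  \<open>y\<close> of the space, with norms and distance larger by arbitrarily little at most, at which finitely
  many Taylor polynomials of \<open>f\<close> nearly take the values that their extensions take at \<open>z\<close>, \<open>w\<close>;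
  then the Lipschitz estimate for \<open>f\<close> carries over. Goldstine's theorem alone gives such \<open>x\<close>, \<open>y\<close> for finitely many linear functionals;
  for polynomials it is applied repeatedly, each time moving \<open>x\<close> a little towards a Goldstine
  approximation of \<open>z\<close> that is adapted to the current \<open>x\<close>.

  The second is that the extensions \<open>AB_ext h\<close> with \<open>norm h \<le> 1\<close> are pointwise dense in the unit
  ball of \<open>hl0\<close> over the bidual (\<open>AB_ext_pointwise_dense\<close>). By the metric approximation property,
  \<open>g\<close> is a pointwise limit of functions \<open>g \<circ> T\<close> with \<open>T\<close> of finite rank and norm at most \<open>1\<close>.
  Duality replaces \<open>T\<close> by a weak-star continuous \<open>S\<close> of norm at most \<open>1\<close> that is close to \<open>T\<close> at
  finitely many points (\<open>weak_star_continuous_approximation\<close>), and \<open>g \<circ> S\<close> is the extension of its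
  restriction to the space (\<open>AB_ext_finite_rank\<close>).

  If \<open>g\<close> is a norm preserving extension of \<open>f\<close>, density gives a net \<open>h\<close> with \<open>AB_ext h \<longlongrightarrow> g\<close>, and in
  particular \<open>h \<longlongrightarrow> f\<close>; continuity then forces \<open>g = AB_ext f\<close>. Conversely, if \<open>h \<longlongrightarrow> f\<close> pointwise
  within the unit ball, then by compactness the functions \<open>AB_ext h\<close> have pointwise cluster points,
  each of which is a holomorphic Lipschitz function of norm at most \<open>1\<close> that extends \<open>f\<close>; uniqueness
  leaves \<open>AB_ext f\<close> as the only one.
\<close>

section \<open>The Hahn-Banach theorem\<close>

text \<open>
  The tuples to which the Hahn-Banach theorem is applied in \<open>goldstine_helly\<close>.
\<close>

instantiation "fun" :: (type, real_vector) real_vector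
begin
definition scaleR_fun :: "real \<Rightarrow> ('a \<Rightarrow> 'b) \<Rightarrow> 'a \<Rightarrow> 'b"
  where "scaleR_fun r f = (\<lambda>x. r *\<^sub>R f x)"
instance
  by standard (auto simp: scaleR_fun_def fun_eq_iff algebra_simps)
end

lemma scaleR_fun_apply: "(r *\<^sub>R f) x = r *\<^sub>R f x"
  by (simp add: scaleR_fun_def)

definition sublinear :: "('a::real_vector \<Rightarrow> real) \<Rightarrow> bool"
  where "sublinear p \<longleftrightarrow> (\<forall>x y. p (x + y) \<le> p x + p y) \<and> (\<forall>r x. 0 < r \<longrightarrow> p (r *\<^sub>R x) = r * p x)"

lemma sublinearD:
  assumes "sublinear p"
  shows sublinear_add: "p (x + y) \<le> p x + p y"
    and sublinear_scale: "0 \<le> r \<Longrightarrow> p (r *\<^sub>R x) = r * p x"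
    and sublinear_zero: "p 0 = 0"
    and sublinear_lower: "- p (- x) \<le> p x"
proof -
  show add: "p (x + y) \<le> p x + p y" for x y using assms by (simp add: sublinear_def)
  have "p (2 *\<^sub>R 0) = 2 * p 0" using assms unfolding sublinear_def by (meson zero_less_numeral)
  then show z: "p 0 = 0" by simp
  show "0 \<le> r \<Longrightarrow> p (r *\<^sub>R x) = r * p x"
    using assms z by (cases "r = 0") (auto simp: sublinear_def)
  show "- p (- x) \<le> p x" using add[of x "- x"] z by simp
qed

text \<open>
  Lowers \<open>p\<close> as far as possible in the direction \<open>- y\<close>: for \<open>t = 1\<close> the value at \<open>- y\<close> is at most
  \<open>- p y\<close>, the value of any linear functional below \<open>p\<close> that agrees with \<open>p\<close> at \<open>y\<close>.
\<close>

definition sublinear_slope :: "('a::real_vector \<Rightarrow> real) \<Rightarrow> 'a \<Rightarrow> 'a \<Rightarrow> real"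
  where "sublinear_slope p y x = (INF t\<in>{0..}. p (x + t *\<^sub>R y) - t * p y)"

lemma sublinear_slope:
  assumes p: "sublinear p"
  shows sublinear_slope_le: "0 \<le> t \<Longrightarrow> sublinear_slope p y x \<le> p (x + t *\<^sub>R y) - t * p y"
    and sublinear_sublinear_slope: "sublinear (sublinear_slope p y)"
proof -
  have lower: "- p (- x) \<le> p (x + t *\<^sub>R y) - t * p y" if "0 \<le> t" for x t
  proof -
    have "p (t *\<^sub>R y) \<le> p (x + t *\<^sub>R y) + p (- x)"
      using sublinear_add[OF p, of "x + t *\<^sub>R y" "- x"] by (simp add: algebra_simps)
    then show ?thesis using sublinear_scale[OF p that, of y] by simp
  qed
  have bdd: "bdd_below ((\<lambda>t. p (x + t *\<^sub>R y) - t * p y) ` {0..})" for x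
    using lower by (intro bdd_belowI2[where m = "- p (- x)"]) auto
  show le: "sublinear_slope p y x \<le> p (x + t *\<^sub>R y) - t * p y" if "0 \<le> t" for t x
    unfolding sublinear_slope_def by (rule cINF_lower[OF bdd]) (use that in auto)
  have ge: "m \<le> sublinear_slope p y x" if "\<And>t. 0 \<le> t \<Longrightarrow> m \<le> p (x + t *\<^sub>R y) - t * p y" for m x
    unfolding sublinear_slope_def by (rule cINF_greatest) (use that in auto)
  have "sublinear_slope p y (u + v) \<le> sublinear_slope p y u + sublinear_slope p y v" for u v
  proof -
    have *: "sublinear_slope p y (u + v) \<le> (p (u + s *\<^sub>R y) - s * p y) + (p (v + t *\<^sub>R y) - t * p y)"
      if "0 \<le> s" "0 \<le> t" for s t
      using le[of "s + t" "u + v"] that sublinear_add[OF p, of "u + s *\<^sub>R y" "v + t *\<^sub>R y"]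
      by (simp add: algebra_simps)
    have "sublinear_slope p y (u + v) - (p (v + t *\<^sub>R y) - t * p y) \<le> sublinear_slope p y u"
      if "0 \<le> t" for t
      by (rule ge) (use *[OF _ that] in \<open>simp add: algebra_simps\<close>)
    then have "sublinear_slope p y (u + v) - sublinear_slope p y u \<le> sublinear_slope p y v"
      by (intro ge) (simp add: algebra_simps)
    then show ?thesis by simp
  qed
  moreover have "sublinear_slope p y (r *\<^sub>R u) = r * sublinear_slope p y u" if r: "0 < r" for r u
  proof -
    have *: "s * sublinear_slope p y w \<le> sublinear_slope p y (s *\<^sub>R w)" if s: "0 < s" for s w
    proof (rule ge)
      fix t :: real assume t: "0 \<le> t"
      have "s * sublinear_slope p y w \<le> s * (p (w + (t / s) *\<^sub>R y) - t / s * p y)"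
        using le[of "t / s" w] s t by (intro mult_left_mono) auto
      also have "\<dots> = p (s *\<^sub>R (w + (t / s) *\<^sub>R y)) - t * p y"
        using s sublinear_scale[OF p, of s "w + (t / s) *\<^sub>R y"] by (simp add: algebra_simps)
      also have "s *\<^sub>R (w + (t / s) *\<^sub>R y) = s *\<^sub>R w + t *\<^sub>R y"
        using s by (simp add: scaleR_add_right)
      finally show "s * sublinear_slope p y w \<le> p (s *\<^sub>R w + t *\<^sub>R y) - t * p y" .
    qed
    have "inverse r * sublinear_slope p y (r *\<^sub>R u) \<le> sublinear_slope p y u"
      using *[of "inverse r" "r *\<^sub>R u"] r by simp
    then have "sublinear_slope p y (r *\<^sub>R u) \<le> r * sublinear_slope p y u"
      using r by (simp add: field_simps)
    with *[OF r, of u] show ?thesis by simp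
  qed
  ultimately show "sublinear (sublinear_slope p y)" by (simp add: sublinear_def)
qed

text \<open>
  Minimality forces \<open>sublinear_slope p y = p\<close>, and \<open>t = 1\<close> in the infimum then reads
  \<open>p x \<le> p (x + y) - p y\<close>, the missing half of additivity.
\<close>

lemma minimal_sublinear_is_linear:
  assumes p: "sublinear p" and min: "\<And>q. sublinear q \<Longrightarrow> (\<And>x. q x \<le> p x) \<Longrightarrow> q = p"
  shows "linear p"
proof (rule linearI)
  have add: "p (x + y) = p x + p y" for x y
  proof -
    have "sublinear_slope p y u \<le> p u" for u
      using sublinear_slope_le[OF p, of 0 y u] by simp
    then have "sublinear_slope p y = p"
      by (intro min sublinear_sublinear_slope p)
    then have "p x \<le> p (x + 1 *\<^sub>R y) - 1 * p y"
      using sublinear_slope_le[OF p, of 1 y x] by simp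
    with sublinear_add[OF p, of x y] show ?thesis by simp
  qed
  then show "p (x + y) = p x + p y" for x y .
  have neg: "p (- x) = - p x" for x
    using add[of x "- x"] sublinear_zero[OF p] by simp
  show "p (r *\<^sub>R x) = r *\<^sub>R p x" for r x
  proof (cases "0 \<le> r")
    case False
    then have "p ((- r) *\<^sub>R x) = - r * p x" by (intro sublinear_scale p) simp
    then show ?thesis using neg[of "r *\<^sub>R x"] by simp
  qed (simp add: sublinear_scale[OF p])
qed

text \<open>
  By Zorn's lemma there is a minimal sublinear functional below \<open>p\<close>. The infimum of a chain is
  finite because every member satisfies \<open>- p (- x) \<le> q x\<close>.
\<close>

lemma linear_below_sublinear:
  assumes p: "sublinear (p :: 'a::real_vector \<Rightarrow> real)"
  obtains l where "linear l" "\<And>x. l x \<le> p x"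
proof -
  define S where "S = {q. sublinear q \<and> (\<forall>x. q x \<le> p x)}"
  define r :: "(('a \<Rightarrow> real) \<times> ('a \<Rightarrow> real)) set"
    where "r = {(q, q'). q \<in> S \<and> q' \<in> S \<and> (\<forall>x. q' x \<le> q x)}"
  have field: "Field r = S" by (auto simp: r_def Field_def)
  have "Partial_order r"
    unfolding partial_order_on_def preorder_on_def field refl_on_def trans_def antisym_def
    by (auto simp: r_def fun_eq_iff intro: order_trans order_antisym)
  moreover have "\<exists>u\<in>Field r. \<forall>a\<in>C. (a, u) \<in> r" if C: "C \<in> Chains r" for C
  proof (cases "C = {}")
    case True
    then show ?thesis using p by (auto simp: field S_def)
  next
    case False
    have CS: "q \<in> S" if "q \<in> C" for q using C that by (auto simp: Chains_def r_def)
    then have sub: "sublinear q" and qp: "q x \<le> p x" if "q \<in> C" for q x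
      using that by (auto simp: S_def)
    define u where "u x = (INF q\<in>C. q x)" for x
    have bdd: "bdd_below ((\<lambda>q. q x) ` C)" for x
    proof (rule bdd_belowI2[where m = "- p (- x)"])
      fix q assume "q \<in> C"
      then show "- p (- x) \<le> q x"
        using sublinear_lower[OF sub, of q x] qp[of q "- x"] by linarith
    qed
    have le: "u x \<le> q x" if "q \<in> C" for q x
      unfolding u_def by (rule cINF_lower[OF bdd that])
    have ge: "m \<le> u x" if "\<And>q. q \<in> C \<Longrightarrow> m \<le> q x" for m x
      unfolding u_def by (rule cINF_greatest) (use False that in auto)
    have "u (x + y) \<le> u x + u y" for x y
    proof -
      have *: "u (x + y) \<le> a x + b y" if ab: "a \<in> C" "b \<in> C" for a b
      proof -
        have "(a, b) \<in> r \<or> (b, a) \<in> r" using C ab by (auto simp: Chains_def)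
        then consider "\<forall>x. b x \<le> a x" | "\<forall>x. a x \<le> b x" by (auto simp: r_def)
        then show ?thesis
        proof cases
          case 1
          then show ?thesis
            using le[OF ab(2), of "x + y"] sublinear_add[OF sub[OF ab(2)], of x y] 
            by (meson add_right_mono order_trans)
        next
          case 2
          then show ?thesis
            using le[OF ab(1), of "x + y"] sublinear_add[OF sub[OF ab(1)], of x y] 
            by (meson add_left_mono order_trans)
        qed
      qed
      have "u (x + y) - b y \<le> u x" if "b \<in> C" for b
        by (rule ge) (use *[OF _ that] in \<open>simp add: algebra_simps\<close>)
      then have "u (x + y) - u x \<le> u y"
        by (intro ge) (simp add: algebra_simps)
      then show ?thesis by simp
    qed
    moreover have "u (s *\<^sub>R x) = s * u x" if s: "0 < s" for s x
    proof -
      have *: "t * u w \<le> u (t *\<^sub>R w)" if t: "0 < t" for t w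
        by (rule ge) (use t le in \<open>simp add: sublinear_scale[OF sub]\<close>)
      have "inverse s * u (s *\<^sub>R x) \<le> u x" using *[of "inverse s" "s *\<^sub>R x"] s by simp
      then have "u (s *\<^sub>R x) \<le> s * u x" using s by (simp add: field_simps)
      with *[OF s, of x] show ?thesis by simp
    qed
    moreover have "u x \<le> p x" for x
      using False le qp by (meson ex_in_conv order_trans)
    ultimately have "u \<in> S" by (simp add: S_def sublinear_def)
    then show ?thesis
      using CS le unfolding field by (intro bexI[of _ u]) (auto simp: r_def)
  qed
  ultimately obtain l where l: "l \<in> Field r" "\<forall>a\<in>Field r. (l, a) \<in> r \<longrightarrow> a = l"
    using Zorns_po_lemma[of r] by blast
  then have "l \<in> S" by (simp add: field)
  then have "sublinear l" "\<And>x. l x \<le> p x" by (auto simp: S_def)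
  moreover have "linear l"
  proof (rule minimal_sublinear_is_linear[OF \<open>sublinear l\<close>])
    fix q assume "sublinear q" "\<And>x. q x \<le> l x"
    then have "q \<in> S" "(l, q) \<in> r"
      using \<open>l \<in> S\<close> by (auto simp: S_def r_def intro: order_trans)
    then show "q = l" using l(2) by (simp add: field)
  qed
  ultimately show ?thesis using that by blast
qed

text \<open>
  A linear functional below \<open>sublinear_slope p y\<close> is at most \<open>- p y\<close> at \<open>- y\<close>, hence at least \<open>p y\<close>
  at \<open>y\<close>.
\<close>

theorem hahn_banach_sublinear:
  assumes p: "sublinear (p :: 'a::real_vector \<Rightarrow> real)"
  obtains l where "linear l" "\<And>x. l x \<le> p x" "l y = p y"
proof -
  obtain l where l: "linear l" "\<And>x. l x \<le> sublinear_slope p y x"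
    using linear_below_sublinear[OF sublinear_sublinear_slope[OF p]] by blast
  have "l x \<le> p x" for x
    using l(2)[of x] sublinear_slope_le[OF p, of 0 y x] by simp
  moreover have "p y \<le> l y"
    using l(2)[of "- y"] sublinear_slope_le[OF p, of 1 y "- y"] linear_neg[OF l(1), of y]
      sublinear_zero[OF p] by simp
  ultimately show ?thesis using that l(1) by (meson order_antisym)
qed

text \<open>
  The distance to \<open>W\<close> measured by \<open>p\<close> is itself sublinear; it vanishes on \<open>W\<close> and is at least \<open>1\<close>
  at \<open>y\<close>, so a linear functional below it that attains it at \<open>y\<close> is as required.
\<close>

corollary hahn_banach_subspace:
  assumes p: "sublinear (p :: 'a::real_vector \<Rightarrow> real)" and nonneg: "\<And>x. 0 \<le> p x"
    and W: "subspace W" and far: "\<And>w. w \<in> W \<Longrightarrow> 1 \<le> p (y - w)"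
  obtains l where "linear l" "\<And>x. l x \<le> p x" "\<And>w. w \<in> W \<Longrightarrow> l w = 0" "1 \<le> l y"
proof -
  define q where "q x = (INF w\<in>W. p (x - w))" for x
  have ne: "W \<noteq> {}" using subspace_0[OF W] by auto
  have le: "q x \<le> p (x - w)" if "w \<in> W" for x w
    unfolding q_def by (rule cINF_lower[OF bdd_belowI2[where m = 0]]) (use that nonneg in auto)
  have ge: "m \<le> q x" if "\<And>w. w \<in> W \<Longrightarrow> m \<le> p (x - w)" for m x
    unfolding q_def by (rule cINF_greatest) (use ne that in auto)
  have "q (x + z) \<le> q x + q z" for x z
  proof -
    have *: "q (x + z) \<le> p (x - a) + p (z - b)" if "a \<in> W" "b \<in> W" for a b
      using le[OF subspace_add[OF W that], of "x + z"] sublinear_add[OF p, of "x - a" "z - b"]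
      by (simp add: algebra_simps)
    have "q (x + z) - p (z - b) \<le> q x" if "b \<in> W" for b
      by (rule ge) (use *[OF _ that] in \<open>simp add: algebra_simps\<close>)
    then have "q (x + z) - q x \<le> q z"
      by (intro ge) (simp add: algebra_simps)
    then show ?thesis by simp
  qed
  moreover have "q (s *\<^sub>R x) = s * q x" if s: "0 < s" for s x
  proof -
    have *: "t * q v \<le> q (t *\<^sub>R v)" if t: "0 < t" for t v
    proof (rule ge)
      fix w assume w: "w \<in> W"
      have "t * q v \<le> t * p (v - inverse t *\<^sub>R w)"
        using le[OF subspace_scale[OF W w], of v "inverse t"] t by simp
      also have "\<dots> = p (t *\<^sub>R (v - inverse t *\<^sub>R w))" using t by (simp add: sublinear_scale[OF p])
      also have "t *\<^sub>R (v - inverse t *\<^sub>R w) = t *\<^sub>R v - w" using t by (simp add: scaleR_diff_right)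
      finally show "t * q v \<le> p (t *\<^sub>R v - w)" .
    qed
    have "inverse s * q (s *\<^sub>R x) \<le> q x" using *[of "inverse s" "s *\<^sub>R x"] s by simp
    then have "q (s *\<^sub>R x) \<le> s * q x" using s by (simp add: field_simps)
    with *[OF s, of x] show ?thesis by simp
  qed
  ultimately have "sublinear q" by (simp add: sublinear_def)
  then obtain l where l: "linear l" "\<And>x. l x \<le> q x" "l y = q y"
    using hahn_banach_sublinear by blast
  have "l w \<le> 0" if "w \<in> W" for w
    using l(2)[of w] le[OF that, of w] sublinear_zero[OF p] by simp
  moreover have "l (- w) \<le> 0" if "w \<in> W" for w
    using calculation subspace_neg[OF W that] by blast
  ultimately have "l w = 0" if "w \<in> W" for w
    using that linear_neg[OF l(1), of w] by (metis neg_le_0_iff_le order_antisym)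
  moreover have "l x \<le> p x" for x
    using l(2)[of x] le[OF subspace_0[OF W], of x] by simp
  moreover have "1 \<le> l y" using far ge l(3) by simp
  ultimately show ?thesis using that l(1) by blast
qed

section \<open>Functionals and Goldstine's theorem\<close>

lemma cdual_apply_add: "cdual_apply \<phi> (x + y) = cdual_apply \<phi> x + cdual_apply \<phi> y"
  and cdual_apply_scaleC: "cdual_apply \<phi> (c *\<^sub>C x) = c * cdual_apply \<phi> x"
  using cdual_apply[of \<phi>] by (auto simp: bounded_clinear_def clinear_def scaleC_complex_def)

lemma bounded_linear_cdual_apply: "bounded_linear (cdual_apply \<phi>)"
  using cdual_apply[of \<phi>] by (simp add: bounded_clinear_iff)

lemmas cdual_apply_zero = linear_0[OF bounded_linear.linear[OF bounded_linear_cdual_apply]]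
  and cdual_apply_diff = linear_diff[OF bounded_linear.linear[OF bounded_linear_cdual_apply]]
  and cdual_apply_sum = linear_sum[OF bounded_linear.linear[OF bounded_linear_cdual_apply]]
  and cdual_apply_scaleR = linear_scale[OF bounded_linear.linear[OF bounded_linear_cdual_apply]]

lemma cdual_add_apply: "cdual_apply (\<phi> + \<psi>) x = cdual_apply \<phi> x + cdual_apply \<psi> x"
  and cdual_diff_apply: "cdual_apply (\<phi> - \<psi>) x = cdual_apply \<phi> x - cdual_apply \<psi> x"
  and cdual_scaleC_apply: "cdual_apply (c *\<^sub>C \<phi>) x = c * cdual_apply \<phi> x"
  and cdual_zero_apply: "cdual_apply 0 x = 0"
  by (simp_all add: plus_cdual.rep_eq minus_cdual.rep_eq scaleC_cdual.rep_eq zero_cdual.rep_eq)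

lemma cdual_sum_apply: "cdual_apply (\<Sum>k\<in>K. \<phi> k) x = (\<Sum>k\<in>K. cdual_apply (\<phi> k) x)"
  by (induction K rule: infinite_finite_induct) (simp_all add: cdual_add_apply cdual_zero_apply)

lemma norm_cdual_le:
  assumes "0 \<le> C" "\<And>x. cmod (cdual_apply \<phi> x) \<le> C * norm x"
  shows "norm \<phi> \<le> C"
  unfolding norm_cdual.rep_eq by (rule onorm_bound) (use assms in auto)

text \<open>
  Multiplying a nearly norming vector by a unimodular scalar makes the value of \<open>\<phi>\<close> real.
\<close>

lemma norm_cdual_less_obtain:
  assumes "m < norm \<phi>"
  obtains x where "norm x \<le> 1" "m < Re (cdual_apply \<phi> x)"
proof (cases "0 \<le> m")
  case False
  then show ?thesis using that[of 0] by (simp add: cdual_apply_zero)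
next
  case True
  obtain x where x: "m * norm x < cmod (cdual_apply \<phi> x)"
    using norm_cdual_le[OF True, of \<phi>] assms by (meson leD not_le_imp_less)
  define a where "a = cdual_apply \<phi> x"
  have "0 \<le> m * norm x" using True by simp
  then have a: "a \<noteq> 0" "x \<noteq> 0" using x by (auto simp: a_def cdual_apply_zero)
  define v where "v = (cnj (sgn a) * of_real (inverse (norm x))) *\<^sub>C x"
  have nv: "norm v = 1" using a by (simp add: v_def norm_scaleC norm_mult norm_sgn norm_inverse)
  have "cnj (sgn a) * a = of_real (cmod a)"
    using a by (simp add: sgn_div_norm scaleR_conv_of_real mult.assoc mult.commute[of "cnj a"]
        complex_norm_square[symmetric] power2_eq_square)
  then have "cdual_apply \<phi> v = of_real (cmod a / norm x)"
    by (simp add: v_def cdual_apply_scaleC a_def[symmetric] field_simps)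
  then have "Re (cdual_apply \<phi> v) = cmod a / norm x" by simp
  also have "m < \<dots>" using x a by (simp add: a_def field_simps)
  finally show ?thesis using that[of v] nv by simp
qed

text \<open>
  Induction on \<open>\<Phi>\<close>: if the new functional does not vanish at some \<open>u\<close> in the common kernel of the
  old ones, a multiple of it can be subtracted from \<open>\<xi>\<close> so that the difference vanishes at \<open>u\<close>, and
  with it on the whole old kernel.
\<close>

lemma linear_dependence_of_functionals:
  fixes \<xi> :: "'a::complex_normed_vector cdual"
  assumes "finite \<Phi>" "\<And>x. (\<forall>\<phi>\<in>\<Phi>. cdual_apply \<phi> x = 0) \<Longrightarrow> cdual_apply \<xi> x = 0"
  shows "\<xi> \<in> complex_vector.span \<Phi>"
  using assms
proof (induction \<Phi> arbitrary: \<xi> rule: finite_induct)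
  case empty
  then have "\<xi> = 0" by (intro cdual_eqI) (simp add: cdual_zero_apply)
  then show ?case by (simp add: complex_vector.span_zero)
next
  case (insert \<phi> \<Phi>)
  show ?case
  proof (cases "\<exists>u. (\<forall>\<phi>\<in>\<Phi>. cdual_apply \<phi> u = 0) \<and> cdual_apply \<phi> u \<noteq> 0")
    case False
    then have "\<xi> \<in> complex_vector.span \<Phi>"
      using insert.prems by (intro insert.IH) auto
    then show ?thesis
      using complex_vector.span_mono[of \<Phi> "insert \<phi> \<Phi>"] by blast
  next
    case True
    then obtain u where u: "\<forall>\<phi>\<in>\<Phi>. cdual_apply \<phi> u = 0" "cdual_apply \<phi> u \<noteq> 0" by blast
    define c where "c = cdual_apply \<xi> u / cdual_apply \<phi> u"
    have "\<xi> - c *\<^sub>C \<phi> \<in> complex_vector.span \<Phi>"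
    proof (rule insert.IH)
      fix x assume x: "\<forall>\<phi>\<in>\<Phi>. cdual_apply \<phi> x = 0"
      define y where "y = x - (cdual_apply \<phi> x / cdual_apply \<phi> u) *\<^sub>C u"
      have "cdual_apply \<xi> y = 0"
        using x u by (intro insert.prems) (auto simp: y_def cdual_apply_diff cdual_apply_scaleC)
      then show "cdual_apply (\<xi> - c *\<^sub>C \<phi>) x = 0"
        by (simp add: y_def c_def cdual_apply_diff cdual_apply_scaleC cdual_diff_apply
            cdual_scaleC_apply)
    qed
    then have "\<xi> - c *\<^sub>C \<phi> \<in> complex_vector.span (insert \<phi> \<Phi>)"
      using complex_vector.span_mono[of \<Phi> "insert \<phi> \<Phi>"] by blast
    then have "\<xi> - c *\<^sub>C \<phi> + c *\<^sub>C \<phi> \<in> complex_vector.span (insert \<phi> \<Phi>)"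
      by (intro complex_vector.span_add complex_vector.span_scale)
        (auto intro: complex_vector.span_base)
    then show ?thesis by simp
  qed
qed

lemma span_functionals_agree:
  assumes "\<xi> \<in> complex_vector.span \<Phi>" "\<And>\<phi>. \<phi> \<in> \<Phi> \<Longrightarrow> cdual_apply \<phi> x = cdual_apply z \<phi>"
  shows "cdual_apply \<xi> x = cdual_apply z \<xi>"
  using assms(1)
proof (induction rule: complex_vector.span_induct_alt)
  case base
  show ?case by (simp add: cdual_zero_apply cdual_apply_zero)
next
  case (step c \<phi> y)
  then show ?case
    by (simp add: cdual_add_apply cdual_apply_add cdual_scaleC_apply cdual_apply_scaleC assms(2))
qed

text \<open>
  The algebraic part of Helly's theorem; the norm of \<open>x\<close> is not controlled.
\<close>

lemma bidual_interpolation: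
  fixes z :: "'a::complex_normed_vector cdual cdual"
  assumes "finite \<Phi>"
  obtains x where "\<And>\<phi>. \<phi> \<in> \<Phi> \<Longrightarrow> cdual_apply \<phi> x = cdual_apply z \<phi>"
  using assms
proof (induction \<Phi> arbitrary: thesis rule: finite_induct)
  case (insert \<phi> \<Phi>)
  obtain x where x: "\<And>\<phi>. \<phi> \<in> \<Phi> \<Longrightarrow> cdual_apply \<phi> x = cdual_apply z \<phi>"
    using insert.IH by blast
  show ?case
  proof (cases "\<exists>u. (\<forall>\<phi>\<in>\<Phi>. cdual_apply \<phi> u = 0) \<and> cdual_apply \<phi> u \<noteq> 0")
    case False
    then have "\<phi> \<in> complex_vector.span \<Phi>"
      using insert.hyps by (intro linear_dependence_of_functionals) auto
    then have "cdual_apply \<phi> x = cdual_apply z \<phi>" using x by (rule span_functionals_agree)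
    then show ?thesis using x by (intro insert.prems[of x]) auto
  next
    case True
    then obtain u where u: "\<forall>\<phi>\<in>\<Phi>. cdual_apply \<phi> u = 0" "cdual_apply \<phi> u \<noteq> 0" by blast
    show ?thesis
      by (rule insert.prems[of "x + ((cdual_apply z \<phi> - cdual_apply \<phi> x) / cdual_apply \<phi> u) *\<^sub>C u"])
        (use u x in \<open>auto simp: cdual_apply_add cdual_apply_scaleC\<close>)
  qed
qed auto

text \<open>
  A real-linear functional \<open>l\<close> is the real part of \<open>l v - \<i> l (\<i> v)\<close>.
\<close>

lemma complexify_functional:
  assumes l: "linear (l :: 'a::complex_normed_vector \<Rightarrow> real)" and le: "\<And>v. l v \<le> C * norm v"
  obtains \<psi> where "\<And>v. Re (cdual_apply \<psi> v) = l v"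
proof -
  define F where "F v = Complex (l v) (- l (\<i> *\<^sub>C v))" for v
  have add: "F (v + w) = F v + F w" for v w
    by (simp add: F_def scaleC_add_right linear_add[OF l] complex_eq_iff)
  have "F (c *\<^sub>C v) = c * F v" for c v
  proof -
    have "c *\<^sub>C v = (of_real (Re c) + of_real (Im c) * \<i>) *\<^sub>C v"
      by (rule arg_cong[where f = "\<lambda>d. d *\<^sub>C v"]) (simp add: complex_eq_iff)
    also have "\<dots> = Re c *\<^sub>R v + Im c *\<^sub>R \<i> *\<^sub>C v"
      by (simp add: scaleC_add_left scaleR_scaleC scaleC_scaleC)
    finally have "c *\<^sub>C v = Re c *\<^sub>R v + Im c *\<^sub>R \<i> *\<^sub>C v" .
    moreover have "\<i> * c = of_real (Re c) * \<i> - of_real (Im c)"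
      by (simp add: complex_eq_iff)
    then have "\<i> *\<^sub>C c *\<^sub>C v = Re c *\<^sub>R \<i> *\<^sub>C v - Im c *\<^sub>R v"
      by (simp add: scaleC_scaleC scaleR_scaleC complex_vector.scale_left_diff_distrib)
    ultimately show ?thesis
      by (simp add: F_def linear_add[OF l] linear_diff[OF l] linear_scale[OF l] complex_eq_iff)
  qed
  moreover have "cmod (F v) \<le> norm v * (2 * C)" for v
  proof -
    have "\<bar>l w\<bar> \<le> C * norm w" for w
      using le[of w] le[of "- w"] by (simp add: linear_neg[OF l] abs_le_iff)
    from this[of v] this[of "\<i> *\<^sub>C v"] have "\<bar>l v\<bar> + \<bar>l (\<i> *\<^sub>C v)\<bar> \<le> norm v * (2 * C)"
      by (simp add: norm_scaleC algebra_simps)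
    then show ?thesis
      using cmod_le[of "F v"] by (simp add: F_def)
  qed
  ultimately have "bounded_clinear F"
    using add by (auto simp: bounded_clinear_def clinear_def scaleC_complex_def)
  then have "cdual_apply (Cdual F) = F" by (simp add: Cdual_inverse)
  then show ?thesis by (intro that[of "Cdual F"]) (simp add: F_def)
qed

text \<open>
  Goldstine's theorem for finitely many unknowns \<open>x k\<close>, with norm bounds on finitely many linear
  combinations of them and with exact values of finitely many functionals. With the unknowns
  \<open>x\<close>, \<open>y\<close> and bounds on \<open>x\<close>, \<open>y\<close> and \<open>x - y\<close> it approximates pairs of points of the bidual; with
  the rows \<open>c\<close> taken from a norming set of a finite-dimensional space it approximates operators into
  that space.

  Vectors \<open>a k\<close> with the right values exist; they may be changed by vectors in the common kernel of
  \<open>\<Phi>\<close>. If no such change satisfied the norm bounds, the Hahn-Banach theorem, applied to the tuple of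
  combinations with the norm \<open>max\<^sub>j norm (v j) / r j\<close>, would give functionals \<open>\<psi> j\<close> with
  \<open>\<Sum>j. r j * norm (\<psi> j) \<le> 1\<close> whose sum is at least \<open>1\<close> at that tuple. As the \<open>\<psi> j\<close> do not see
  the kernel, their value at the tuple depends only on the values of functionals in the span of \<open>\<Phi>\<close>,
  where \<open>a k\<close> may be replaced by \<open>z k\<close>; but for the \<open>z k\<close> the bounds hold, a contradiction.
\<close>

theorem goldstine_helly:
  fixes z :: "'k \<Rightarrow> 'a::complex_normed_vector cdual cdual" and c :: "'j \<Rightarrow> 'k \<Rightarrow> complex"
  assumes J: "finite J" and K: "finite K" and \<Phi>: "finite \<Phi>"
    and r: "\<And>j. j \<in> J \<Longrightarrow> norm (\<Sum>k\<in>K. c j k *\<^sub>C z k) < r j"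
  obtains x :: "'k \<Rightarrow> 'a" where "\<And>j. j \<in> J \<Longrightarrow> norm (\<Sum>k\<in>K. c j k *\<^sub>C x k) < r j"
    and "\<And>k \<phi>. k \<in> K \<Longrightarrow> \<phi> \<in> \<Phi> \<Longrightarrow> cdual_apply \<phi> (x k) = cdual_apply (z k) \<phi>"
proof -
  have rpos: "0 < r j" if "j \<in> J" for j using le_less_trans[OF norm_ge_zero r[OF that]] .
  have "\<exists>x. \<forall>\<phi>\<in>\<Phi>. cdual_apply \<phi> x = cdual_apply (z k) \<phi>" for k
    by (rule bidual_interpolation[OF \<Phi>, of "z k"]) blast
  then obtain a where a: "\<And>k \<phi>. \<phi> \<in> \<Phi> \<Longrightarrow> cdual_apply \<phi> (a k) = cdual_apply (z k) \<phi>"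
    by (metis (no_types))
  define y where "y j = (\<Sum>k\<in>K. c j k *\<^sub>C a k)" for j
  define p where "p v = Max (insert 0 ((\<lambda>j. norm (v j :: 'a) / r j) ` J))" for v
  have p_ge: "norm (v j) / r j \<le> p v" if "j \<in> J" for v j
    unfolding p_def using J that by (intro Max_ge) auto
  have p_nonneg: "0 \<le> p v" for v
    unfolding p_def using J by (intro Max_ge) auto
  have p_le: "p v \<le> m" if "0 \<le> m" "\<And>j. j \<in> J \<Longrightarrow> norm (v j) / r j \<le> m" for v m
    unfolding p_def using J that by (intro Max.boundedI) auto
  have "sublinear p"
    unfolding sublinear_def
  proof (intro conjI allI impI)
    fix u v
    show "p (u + v) \<le> p u + p v"
    proof (rule p_le)
      fix j assume j: "j \<in> J"
      have "norm ((u + v) j) / r j \<le> norm (u j) / r j + norm (v j) / r j"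
        using norm_triangle_ineq[of "u j" "v j"] rpos[OF j]
        by (simp add: add_divide_distrib[symmetric] divide_right_mono)
      then show "norm ((u + v) j) / r j \<le> p u + p v"
        using p_ge[OF j, of u] p_ge[OF j, of v] by linarith
    qed (simp add: p_nonneg)
  next
    fix t v assume t: "0 < (t :: real)"
    have *: "p (s *\<^sub>R v) \<le> s * p v" if "0 < s" for s v
    proof (rule p_le)
      fix j assume "j \<in> J"
      then show "norm ((s *\<^sub>R v) j) / r j \<le> s * p v"
        using mult_left_mono[OF p_ge[of j v], of s] that by (simp add: scaleR_fun_apply)
    qed (use that p_nonneg in simp)
    have "p (inverse t *\<^sub>R t *\<^sub>R v) \<le> inverse t * p (t *\<^sub>R v)"
      using t by (intro *) simp
    then show "p (t *\<^sub>R v) = t * p v"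
      using *[OF t, of v] t by (simp add: field_simps)
  qed
  \<comment> \<open>The tuples of combinations that vectors in the common kernel of \<open>\<Phi>\<close> can produce.\<close>
  define W where "W = {v. \<exists>u. (\<forall>k. \<forall>\<phi>\<in>\<Phi>. cdual_apply \<phi> (u k) = 0) \<and>
    (\<forall>j\<in>J. v j = (\<Sum>k\<in>K. c j k *\<^sub>C u k))}"
  have "subspace W"
  proof (rule subspaceI)
    show "0 \<in> W"
      by (auto simp: W_def cdual_apply_zero intro!: exI[of _ "\<lambda>_. 0"])
  next
    fix v v' assume "v \<in> W" "v' \<in> W"
    then obtain u u' where *: "\<forall>k. \<forall>\<phi>\<in>\<Phi>. cdual_apply \<phi> (u k) = 0"
      "\<forall>k. \<forall>\<phi>\<in>\<Phi>. cdual_apply \<phi> (u' k) = 0"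
      "\<forall>j\<in>J. v j = (\<Sum>k\<in>K. c j k *\<^sub>C u k)" "\<forall>j\<in>J. v' j = (\<Sum>k\<in>K. c j k *\<^sub>C u' k)"
      unfolding W_def by blast
    then show "v + v' \<in> W"
      unfolding W_def
      by (auto intro!: exI[of _ "\<lambda>k. u k + u' k"]
          simp: cdual_apply_add scaleC_add_right sum.distrib)
  next
    fix t :: real and v assume "v \<in> W"
    then obtain u where *: "\<forall>k. \<forall>\<phi>\<in>\<Phi>. cdual_apply \<phi> (u k) = 0"
      "\<forall>j\<in>J. v j = (\<Sum>k\<in>K. c j k *\<^sub>C u k)"
      unfolding W_def by blast
    then show "t *\<^sub>R v \<in> W"
      unfolding W_def
      by (auto intro!: exI[of _ "\<lambda>k. t *\<^sub>R u k"] sum.cong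
          simp: cdual_apply_scaleC scaleR_fun_apply scaleR_scaleC scaleC_scaleC mult.commute
            complex_vector.scale_sum_right)
  qed
  have "\<exists>w\<in>W. p (y - w) < 1"
  proof (rule ccontr)
    assume "\<not> (\<exists>w\<in>W. p (y - w) < 1)"
    then have "1 \<le> p (y - w)" if "w \<in> W" for w using that by force
    then obtain l where l: "linear l" "\<And>v. l v \<le> p v" "\<And>w. w \<in> W \<Longrightarrow> l w = 0" "1 \<le> l y"
      using hahn_banach_subspace[OF \<open>sublinear p\<close> p_nonneg \<open>subspace W\<close>] by blast
    define single where "single j v = (\<lambda>i. if i = j then v else 0 :: 'a)" for j :: 'j and v
    \<comment> \<open>Coordinates outside \<open>J\<close> are invisible to \<open>p\<close>, hence to \<open>l\<close>.\<close>
    have split: "l v = (\<Sum>j\<in>J. l (single j (v j)))" for v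
    proof -
      define rest where "rest = v - (\<Sum>j\<in>J. single j (v j))"
      have "(\<Sum>j\<in>J. single j (v j)) i = (if i \<in> J then v i else 0)" for i
      proof -
        have "(\<Sum>j\<in>J. single j (v j)) i = (\<Sum>j\<in>J. single j (v j) i)"
          by (induction J rule: infinite_finite_induct) auto
        then show ?thesis using J by (simp add: single_def)
      qed
      then have zero: "rest j = 0" if "j \<in> J" for j using that by (simp add: rest_def)
      have "p rest \<le> 0" "p (- rest) \<le> 0" by (rule p_le; simp add: zero)+
      then have "l rest = 0"
        using l(2)[of rest] l(2)[of "- rest"] by (simp add: linear_neg[OF l(1)])
      then show ?thesis by (simp add: rest_def linear_diff[OF l(1)] linear_sum[OF l(1)])
    qed
    have "\<exists>\<psi>. \<forall>v. Re (cdual_apply \<psi> v) = l (single j v)" if j: "j \<in> J" for j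
    proof -
      have "linear (\<lambda>v. l (single j v))"
      proof (rule linearI)
        fix v w :: 'a and t :: real
        have "single j (v + w) = single j v + single j w" "single j (t *\<^sub>R v) = t *\<^sub>R single j v"
          by (auto simp: single_def fun_eq_iff scaleR_fun_apply)
        then show "l (single j (v + w)) = l (single j v) + l (single j w)"
          "l (single j (t *\<^sub>R v)) = t *\<^sub>R l (single j v)"
          by (simp_all add: linear_add[OF l(1)] linear_scale[OF l(1)])
      qed
      moreover have "l (single j v) \<le> (1 / r j) * norm v" for v
      proof -
        have "p (single j v) \<le> norm v / r j"
          using rpos[OF j] by (intro p_le) (auto simp: single_def)
        with l(2)[of "single j v"] show ?thesis by simp
      qed
      ultimately obtain \<psi> where "\<And>v. Re (cdual_apply \<psi> v) = l (single j v)"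
        using complexify_functional by blast
      then show ?thesis by blast
    qed
    then obtain \<psi> where \<psi>: "\<And>j v. j \<in> J \<Longrightarrow> Re (cdual_apply (\<psi> j) v) = l (single j v)" by metis
    have l\<psi>: "l v = Re (\<Sum>j\<in>J. cdual_apply (\<psi> j) (v j))" for v
      unfolding split[of v] by (simp add: \<psi>)
    \<comment> \<open>This is the functional through which \<open>l\<close> depends on the \<open>k\<close>-th unknown; it vanishes on the kernel of \<open>\<Phi>\<close>.\<close>
    have "(\<Sum>j\<in>J. c j k *\<^sub>C \<psi> j) \<in> complex_vector.span \<Phi>" if k: "k \<in> K" for k
    proof (rule linear_dependence_of_functionals[OF \<Phi>])
      have *: "Re (\<Sum>j\<in>J. cdual_apply (\<psi> j) (c j k *\<^sub>C x)) = 0"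
        if x: "\<forall>\<phi>\<in>\<Phi>. cdual_apply \<phi> x = 0" for x
      proof -
        have "(\<lambda>j. c j k *\<^sub>C x) \<in> W"
          unfolding W_def using x K k
          by (auto intro!: exI[of _ "\<lambda>i. if i = k then x else 0"]
              simp: cdual_apply_zero if_distrib[of "\<lambda>x. _ *\<^sub>C x"] cong: if_cong)
        from l(3)[OF this] show ?thesis unfolding l\<psi> .
      qed
      fix x assume x: "\<forall>\<phi>\<in>\<Phi>. cdual_apply \<phi> x = 0"
      then have ix: "\<forall>\<phi>\<in>\<Phi>. cdual_apply \<phi> (\<i> *\<^sub>C x) = 0" by (simp add: cdual_apply_scaleC)
      define s where "s = (\<Sum>j\<in>J. cdual_apply (\<psi> j) (c j k *\<^sub>C x))"
      have "(\<Sum>j\<in>J. cdual_apply (\<psi> j) (c j k *\<^sub>C \<i> *\<^sub>C x)) = \<i> * s"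
        by (simp add: s_def cdual_apply_scaleC sum_distrib_left mult_ac)
      then have "Re s = 0" "Re (\<i> * s) = 0" using *[OF x] *[OF ix] by (simp_all add: s_def)
      then have "s = 0" by (simp add: complex_eq_iff)
      then show "cdual_apply (\<Sum>j\<in>J. c j k *\<^sub>C \<psi> j) x = 0"
        by (simp add: s_def cdual_sum_apply cdual_scaleC_apply cdual_apply_scaleC)
    qed
    then have agree: "cdual_apply (\<Sum>j\<in>J. c j k *\<^sub>C \<psi> j) (a k) = cdual_apply (z k) (\<Sum>j\<in>J. c j k *\<^sub>C \<psi> j)"
      if "k \<in> K" for k by (rule span_functionals_agree[OF _ a]) (use that in auto)
    define Z where "Z j = (\<Sum>k\<in>K. c j k *\<^sub>C z k)" for j
    have "(\<Sum>j\<in>J. cdual_apply (\<psi> j) (y j)) = (\<Sum>k\<in>K. cdual_apply (\<Sum>j\<in>J. c j k *\<^sub>C \<psi> j) (a k))"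
      unfolding y_def
      by (simp add: cdual_apply_sum cdual_sum_apply cdual_scaleC_apply cdual_apply_scaleC)
        (rule sum.swap)
    also have "\<dots> = (\<Sum>k\<in>K. cdual_apply (z k) (\<Sum>j\<in>J. c j k *\<^sub>C \<psi> j))"
      by (rule sum.cong) (simp_all add: agree)
    also have "\<dots> = (\<Sum>j\<in>J. cdual_apply (Z j) (\<psi> j))"
      unfolding Z_def
      by (simp add: cdual_apply_sum cdual_sum_apply cdual_scaleC_apply cdual_apply_scaleC)
        (rule sum.swap)
    finally have "1 \<le> Re (\<Sum>j\<in>J. cdual_apply (Z j) (\<psi> j))"
      using l(4) l\<psi>[of y] by simp
    also have "\<dots> \<le> cmod (\<Sum>j\<in>J. cdual_apply (Z j) (\<psi> j))" by (rule complex_Re_le_cmod)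
    also have "\<dots> \<le> (\<Sum>j\<in>J. norm (Z j) * norm (\<psi> j))"
      by (intro order_trans[OF norm_sum] sum_mono cdual_apply_bound)
    finally have ge1: "1 \<le> (\<Sum>j\<in>J. norm (Z j) * norm (\<psi> j))" .
    have le1: "(\<Sum>j\<in>J. r j * norm (\<psi> j)) \<le> 1"
    proof (rule field_le_epsilon)
      fix e :: real assume e: "0 < e"
      define d where "d = e / (\<Sum>j\<in>J. r j)"
      have Jne: "J \<noteq> {}" using ge1 by auto
      have rsum: "0 < (\<Sum>j\<in>J. r j)" using J Jne rpos by (intro sum_pos) auto
      then have d: "0 < d" using e by (simp add: d_def)
      have "\<exists>v. norm v \<le> 1 \<and> norm (\<psi> j) - d < Re (cdual_apply (\<psi> j) v)" for j
      proof -
        have "norm (\<psi> j) - d < norm (\<psi> j)" using d by simp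
        then show ?thesis using norm_cdual_less_obtain by blast
      qed
      then obtain v where v: "\<And>j. norm (v j) \<le> 1"
        "\<And>j. norm (\<psi> j) - d < Re (cdual_apply (\<psi> j) (v j))" by metis
      have "(\<Sum>j\<in>J. r j * (norm (\<psi> j) - d)) \<le> (\<Sum>j\<in>J. r j * Re (cdual_apply (\<psi> j) (v j)))"
        using v(2) rpos by (intro sum_mono mult_left_mono) (auto simp: less_imp_le)
      also have "\<dots> = l (\<lambda>j. r j *\<^sub>R v j)"
        by (simp add: l\<psi> cdual_apply_scaleR)
      also have "\<dots> \<le> p (\<lambda>j. r j *\<^sub>R v j)" by (rule l(2))
      also have "\<dots> \<le> 1" using rpos v(1) by (intro p_le) (auto simp: less_imp_le field_simps)
      finally have "(\<Sum>j\<in>J. r j * norm (\<psi> j)) \<le> 1 + d * (\<Sum>j\<in>J. r j)"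
        by (simp add: right_diff_distrib sum_subtractf sum_distrib_left mult.commute)
      then show "(\<Sum>j\<in>J. r j * norm (\<psi> j)) \<le> 1 + e" using rsum by (simp add: d_def)
    qed
    have "\<exists>j\<in>J. \<psi> j \<noteq> 0"
    proof (rule ccontr)
      assume "\<not> ?thesis"
      then have "(\<Sum>j\<in>J. norm (Z j) * norm (\<psi> j)) = 0" by (intro sum.neutral) auto
      with ge1 show False by simp
    qed
    then obtain i where i: "i \<in> J" "\<psi> i \<noteq> 0" by blast
    have "(\<Sum>j\<in>J. norm (Z j) * norm (\<psi> j)) < (\<Sum>j\<in>J. r j * norm (\<psi> j))"
    proof (rule sum_strict_mono_ex1[OF J])
      show "\<forall>j\<in>J. norm (Z j) * norm (\<psi> j) \<le> r j * norm (\<psi> j)"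
        unfolding Z_def by (intro ballI mult_right_mono less_imp_le[OF r] norm_ge_zero)
      show "\<exists>j\<in>J. norm (Z j) * norm (\<psi> j) < r j * norm (\<psi> j)"
        using r[OF i(1)] i by (intro bexI[of _ i] mult_strict_right_mono) (auto simp: Z_def)
    qed
    with ge1 le1 show False by simp
  qed
  then obtain w where w: "w \<in> W" "p (y - w) < 1" by blast
  then obtain u where u: "\<forall>k. \<forall>\<phi>\<in>\<Phi>. cdual_apply \<phi> (u k) = 0"
    "\<forall>j\<in>J. w j = (\<Sum>k\<in>K. c j k *\<^sub>C u k)"
    unfolding W_def by blast
  show ?thesis
  proof (rule that[of "\<lambda>k. a k - u k"])
    fix j assume j: "j \<in> J"
    have "norm ((y - w) j) / r j < 1" using p_ge[OF j, of "y - w"] w(2) by simp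
    then have "norm (y j - w j) < r j" using rpos[OF j] by simp
    also have "y j - w j = (\<Sum>k\<in>K. c j k *\<^sub>C (a k - u k))"
      using u j by (simp add: y_def complex_vector.scale_right_diff_distrib sum_subtractf)
    finally show "norm (\<Sum>k\<in>K. c j k *\<^sub>C (a k - u k)) < r j" .
  next
    fix k \<phi> assume "k \<in> K" "\<phi> \<in> \<Phi>"
    then show "cdual_apply \<phi> (a k - u k) = cdual_apply (z k) \<phi>"
      using a u by (simp add: cdual_apply_diff)
  qed
qed

section \<open>Bounded multilinear forms\<close>

text \<open>
  Symmetry is not included because the extension of a symmetric form to the bidual need not be
  symmetric. The bound is explicit because in \<open>energy_step\<close> forms with varying fixed arguments need a
  common constant.
\<close>

definition mform :: "nat \<Rightarrow> real \<Rightarrow> ('a::complex_normed_vector list \<Rightarrow> complex) \<Rightarrow> bool"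
  where "mform n M A \<longleftrightarrow> 0 \<le> M \<and>
    (\<forall>xs ys. length xs + length ys + 1 = n \<longrightarrow> clinear (\<lambda>x. A (xs @ x # ys))) \<and>
    (\<forall>xs. length xs = n \<longrightarrow> cmod (A xs) \<le> M * (\<Prod>x\<leftarrow>xs. norm x))"

definition symmetric_list_fun :: "nat \<Rightarrow> ('a list \<Rightarrow> complex) \<Rightarrow> bool"
  where "symmetric_list_fun n A \<longleftrightarrow> (\<forall>xs ys. length xs = n \<longrightarrow> mset xs = mset ys \<longrightarrow> A xs = A ys)"

lemma prod_list_norm_nonneg: "0 \<le> (\<Prod>x\<leftarrow>xs. norm x)"
  by (induction xs) auto

lemma prod_list_replicate_norm: "(\<Prod>x\<leftarrow>replicate n x. norm x) = norm x ^ n"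
  by (induction n) auto

lemma bounded_symmetric_formD:
  assumes "bounded_symmetric_form n A"
  obtains M where "mform n M A" "symmetric_list_fun n A"
proof -
  obtain M where M: "\<And>xs. length xs = n \<Longrightarrow> cmod (A xs) \<le> M * (\<Prod>x\<leftarrow>xs. norm x)"
    using assms unfolding bounded_symmetric_form_def by blast
  have "cmod (A xs) \<le> \<bar>M\<bar> * (\<Prod>x\<leftarrow>xs. norm x)" if "length xs = n" for xs
    using M[OF that] mult_right_mono[OF abs_ge_self prod_list_norm_nonneg, of M xs] by linarith
  then have "mform n \<bar>M\<bar> A" using assms unfolding mform_def bounded_symmetric_form_def by (blast intro: abs_ge_zero)
  moreover have "symmetric_list_fun n A"
    using assms unfolding symmetric_list_fun_def bounded_symmetric_form_def by blast
  ultimately show ?thesis by (rule that)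
qed

lemma mform_nonneg: "mform n M A \<Longrightarrow> 0 \<le> M"
  and mform_clinear: "mform n M A \<Longrightarrow> length xs + length ys + 1 = n \<Longrightarrow> clinear (\<lambda>x. A (xs @ x # ys))"
  and mform_bound: "mform n M A \<Longrightarrow> length xs = n \<Longrightarrow> cmod (A xs) \<le> M * (\<Prod>x\<leftarrow>xs. norm x)"
  by (simp_all add: mform_def)

lemma mform_diag_bound: "mform n M A \<Longrightarrow> cmod (A (replicate n x)) \<le> M * norm x ^ n"
  using mform_bound[of n M A "replicate n x"] by (simp add: prod_list_replicate_norm)

lemma mform_Cons:
  assumes "mform (Suc n) M A"
  shows "mform n (M * norm x) (\<lambda>xs. A (x # xs))"
proof -
  have "clinear (\<lambda>v. A (x # us @ v # ws))" if "length us + length ws + 1 = n" for us ws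
    using mform_clinear[OF assms, of "x # us" ws] that by simp
  moreover have "cmod (A (x # xs)) \<le> M * norm x * (\<Prod>x\<leftarrow>xs. norm x)" if "length xs = n" for xs
    using mform_bound[OF assms, of "x # xs"] that by (simp add: mult_ac)
  ultimately show ?thesis using mform_nonneg[OF assms] by (auto simp: mform_def)
qed

lemma mform_append:
  "mform (length us + n) M A \<Longrightarrow> mform n (M * (\<Prod>u\<leftarrow>us. norm u)) (\<lambda>ys. A (us @ ys))"
proof (induction us arbitrary: M A)
  case (Cons u us)
  then have "mform n (M * norm u * (\<Prod>u\<leftarrow>us. norm u)) (\<lambda>ys. A (u # us @ ys))"
    by (intro Cons.IH mform_Cons) simp
  then show ?case by (simp add: mult_ac)
qed simp

lemma symmetric_list_funD:
  "symmetric_list_fun n A \<Longrightarrow> length xs = n \<Longrightarrow> mset xs = mset ys \<Longrightarrow> A xs = A ys"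
  unfolding symmetric_list_fun_def by blast

lemma symmetric_Cons:
  "symmetric_list_fun (Suc n) A \<Longrightarrow> symmetric_list_fun n (\<lambda>xs. A (x # xs))"
  by (simp add: symmetric_list_fun_def)

lemma mform_head_clinear: "mform (Suc n) M A \<Longrightarrow> length ys = n \<Longrightarrow> clinear (\<lambda>x. A (x # ys))"
  using mform_clinear[of "Suc n" M A "[]" ys] by simp

lemma clinear_complexD:
  assumes "clinear (f :: 'a::complex_normed_vector \<Rightarrow> complex)"
  shows clinear_add: "f (x + y) = f x + f y"
    and clinear_scale: "f (c *\<^sub>C x) = c * f x"
    and clinear_scaleR: "f (r *\<^sub>R x) = r *\<^sub>R f x"
    and clinear_zero: "f 0 = 0"
proof -
  show add: "f (x + y) = f x + f y" for x y
    using assms by (simp add: clinear_def scaleC_complex_def)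
  show scale: "f (c *\<^sub>C x) = c * f x" for c x
    using assms by (simp add: clinear_def scaleC_complex_def)
  have "f (r *\<^sub>R x) = of_real r * f x" by (simp add: scaleR_scaleC scale)
  then show "f (r *\<^sub>R x) = r *\<^sub>R f x" by (simp add: scaleR_conv_of_real)
  show "f 0 = 0" using scale[of 0 0] by simp
qed

lemma clinear_complexI:
  "(\<And>x y. f (x + y) = f x + f y) \<Longrightarrow> (\<And>c x. f (c *\<^sub>C x) = c * f x) \<Longrightarrow>
    clinear (f :: 'a::complex_normed_vector \<Rightarrow> complex)"
  by (simp add: clinear_def scaleC_complex_def)

lemma cdual_apply_Cdual: "clinear f \<Longrightarrow> (\<And>x. cmod (f x) \<le> C * norm x) \<Longrightarrow> cdual_apply (Cdual f) x = f x"
  by (subst Cdual_inverse) (auto simp: bounded_clinear_def mult.commute intro: exI[of _ C])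

section \<open>The iterated limit\<close>

lemma topspace_initial_topology [simp]: "topspace (initial_topology \<Phi>) = UNIV"
  by (auto simp: initial_topology_def topspace_pullback_topology)

lemma openin_initial_topology_preimage:
  assumes "\<phi> \<in> \<Phi>" "open U"
  shows "openin (initial_topology \<Phi>) {x. \<phi> x \<in> U}"
  unfolding initial_topology_def openin_pullback_topology
proof (intro exI conjI)
  show "openin (product_topology (\<lambda>_. euclidean) \<Phi>)
      {f \<in> topspace (product_topology (\<lambda>_. euclidean) \<Phi>). f \<phi> \<in> U}"
    using continuous_map_product_projection[OF assms(1), of "\<lambda>_. euclidean"] assms(2)
    unfolding continuous_map_def by auto
  show "{x. \<phi> x \<in> U} = (\<lambda>x. \<lambda>\<phi>\<in>\<Phi>. \<phi> x) -`
      {f \<in> topspace (product_topology (\<lambda>_. euclidean) \<Phi>). f \<phi> \<in> U} \<inter> UNIV"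
    using assms(1) by auto
qed

text \<open>
  A basic neighbourhood in the product topology restricts only finitely many coordinates.
\<close>

lemma openin_initial_topologyE:
  assumes "openin (initial_topology \<Phi>) V" "z \<in> V"
  obtains \<Psi> U where "finite \<Psi>" "\<Psi> \<subseteq> \<Phi>" "\<And>\<phi>. \<phi> \<in> \<Psi> \<Longrightarrow> open (U \<phi>)" "\<And>\<phi>. \<phi> \<in> \<Psi> \<Longrightarrow> \<phi> z \<in> U \<phi>"
    "\<And>x. (\<And>\<phi>. \<phi> \<in> \<Psi> \<Longrightarrow> \<phi> x \<in> U \<phi>) \<Longrightarrow> x \<in> V"
proof -
  obtain W where W: "openin (product_topology (\<lambda>_. euclidean) \<Phi>) W"
    and V: "V = (\<lambda>x. \<lambda>\<phi>\<in>\<Phi>. \<phi> x) -` W"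
    using assms(1) by (auto simp: initial_topology_def openin_pullback_topology)
  have "(\<lambda>\<phi>\<in>\<Phi>. \<phi> z) \<in> W" using assms(2) V by simp
  with W have "\<exists>U. finite {\<phi> \<in> \<Phi>. U \<phi> \<noteq> topspace euclidean} \<and> (\<forall>\<phi>\<in>\<Phi>. openin euclidean (U \<phi>)) \<and>
      (\<lambda>\<phi>\<in>\<Phi>. \<phi> z) \<in> Pi\<^sub>E \<Phi> U \<and> Pi\<^sub>E \<Phi> U \<subseteq> W"
    unfolding openin_product_topology_alt by (rule bspec)
  then obtain U where U: "finite {\<phi> \<in> \<Phi>. U \<phi> \<noteq> UNIV}" "\<And>\<phi>. \<phi> \<in> \<Phi> \<Longrightarrow> open (U \<phi>)"
    "(\<lambda>\<phi>\<in>\<Phi>. \<phi> z) \<in> Pi\<^sub>E \<Phi> U" "Pi\<^sub>E \<Phi> U \<subseteq> W"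
    unfolding topspace_euclidean open_openin[symmetric] by blast
  show ?thesis
  proof (rule that[of "{\<phi> \<in> \<Phi>. U \<phi> \<noteq> UNIV}" U])
    fix x assume x: "\<And>\<phi>. \<phi> \<in> {\<phi> \<in> \<Phi>. U \<phi> \<noteq> UNIV} \<Longrightarrow> \<phi> x \<in> U \<phi>"
    have "(\<lambda>\<phi>\<in>\<Phi>. \<phi> x) \<in> Pi\<^sub>E \<Phi> U"
    proof (rule PiE_I)
      fix \<phi> assume "\<phi> \<in> \<Phi>"
      then show "(\<lambda>\<phi>\<in>\<Phi>. \<phi> x) \<phi> \<in> U \<phi>" using x[of \<phi>] by (cases "U \<phi> = UNIV") auto
    qed auto
    with U(4) have "(\<lambda>\<phi>\<in>\<Phi>. \<phi> x) \<in> W" by (rule subsetD)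
    then show "x \<in> V" by (simp add: V)
  qed (use U in \<open>auto simp: PiE_iff\<close>)
qed

lemma bidual_embed_apply: "cdual_apply (bidual_embed x) \<phi> = cdual_apply \<phi> x"
  by (simp add: bidual_embed.rep_eq)

lemma bidual_embed_add: "bidual_embed (x + y) = bidual_embed x + bidual_embed y"
  and bidual_embed_scaleC: "bidual_embed (c *\<^sub>C x) = c *\<^sub>C bidual_embed x"
  and bidual_embed_diff: "bidual_embed (x - y) = bidual_embed x - bidual_embed y"
  and bidual_embed_zero: "bidual_embed 0 = 0"
  by (auto intro!: cdual_eqI simp: bidual_embed_apply cdual_add_apply cdual_scaleC_apply
      cdual_diff_apply cdual_apply_add cdual_apply_scaleC cdual_apply_diff cdual_zero_apply
      cdual_apply_zero)

lemma norm_bidual_embed_le: "norm (bidual_embed x) \<le> norm x"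
  by (rule norm_cdual_le) (auto simp: bidual_embed_apply mult.commute[of "norm x"] cdual_apply_bound)

text \<open>
  A weak-star neighbourhood restricts finitely many functionals only, and their values at \<open>z\<close> are
  taken at a point of the space. In infinite dimensions the members of this filter are unbounded sets,
  so that limits along it are at hand for linear functions, but not for polynomials.
\<close>

lemma weak_star_approx_neq_bot: "weak_star_approx z \<noteq> bot"
  unfolding weak_star_approx_def
proof (rule filtercomap_neq_bot)
  fix P assume "eventually P (nhdsin weak_star_topology z)"
  then obtain V where V: "openin weak_star_topology V" "z \<in> V" "\<And>w. w \<in> V \<Longrightarrow> P w"
    by (auto simp: eventually_nhdsin weak_star_topology_def)
  obtain \<Psi> U where \<Psi>: "finite \<Psi>" "\<Psi> \<subseteq> range (\<lambda>x \<phi>. cdual_apply \<phi> x)"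
    "\<And>\<phi>. \<phi> \<in> \<Psi> \<Longrightarrow> \<phi> z \<in> U \<phi>" "\<And>x. (\<And>\<phi>. \<phi> \<in> \<Psi> \<Longrightarrow> \<phi> x \<in> U \<phi>) \<Longrightarrow> x \<in> V"
    using openin_initial_topologyE[OF V(1)[unfolded weak_star_topology_def] V(2)] by metis
  obtain \<Xi> where \<Xi>: "finite \<Xi>" "\<Psi> = (\<lambda>x \<phi>. cdual_apply \<phi> x) ` \<Xi>"
    using finite_subset_image[OF \<Psi>(1,2)] by auto
  obtain x where "\<And>\<phi>. \<phi> \<in> \<Xi> \<Longrightarrow> cdual_apply \<phi> x = cdual_apply z \<phi>"
    using bidual_interpolation[OF \<Xi>(1), of z] by metis
  then have "bidual_embed x \<in> V"
    using \<Psi>(3) by (intro \<Psi>(4)) (fastforce simp: \<Xi>(2) bidual_embed_apply)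
  then show "\<exists>x. P (bidual_embed x)" using V(3) by blast
qed

lemma weak_star_approx_tendsto:
  "((\<lambda>x. cdual_apply \<phi> x) \<longlongrightarrow> cdual_apply z \<phi>) (weak_star_approx z)"
proof (rule topological_tendstoI)
  fix U :: "complex set" assume U: "open U" "cdual_apply z \<phi> \<in> U"
  have "openin weak_star_topology {w. cdual_apply w \<phi> \<in> U}"
    unfolding weak_star_topology_def using U(1) by (intro openin_initial_topology_preimage) auto
  then have "eventually (\<lambda>w. cdual_apply w \<phi> \<in> U) (nhdsin weak_star_topology z)"
    using U(2) by (auto simp: eventually_nhdsin weak_star_topology_def)
  then show "eventually (\<lambda>x. cdual_apply \<phi> x \<in> U) (weak_star_approx z)"
    by (auto simp: weak_star_approx_def eventually_filtercomap bidual_embed_apply)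
qed

lemma Lim_weak_star_approx:
  assumes "bounded_clinear \<phi>"
  shows "Lim (weak_star_approx z) \<phi> = cdual_apply z (Cdual \<phi>)"
  using weak_star_approx_tendsto[of "Cdual \<phi>" z] assms
  by (intro tendsto_Lim weak_star_approx_neq_bot) (simp add: Cdual_inverse)

text \<open>
  With all arguments but the last fixed, a form is a bounded functional of the last one. The limit in
  that argument along \<open>weak_star_approx z\<close> is therefore evaluation of \<open>z\<close>, and linearity and bounds in
  the other arguments survive.
\<close>

lemma mform_last_bounded:
  assumes B: "mform (Suc j) M B" and xs: "length xs = j"
  shows "bounded_clinear (\<lambda>x. B (xs @ [x]))"
    and "norm (Cdual (\<lambda>x. B (xs @ [x]))) \<le> M * (\<Prod>x\<leftarrow>xs. norm x)"
proof -
  have le: "cmod (B (xs @ [x])) \<le> M * (\<Prod>x\<leftarrow>xs. norm x) * norm x" for x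
    using mform_bound[OF B, of "xs @ [x]"] xs by (simp add: mult_ac)
  show bc: "bounded_clinear (\<lambda>x. B (xs @ [x]))"
    using mform_clinear[OF B, of xs "[]"] xs le by (auto simp: bounded_clinear_def mult.commute[of "norm _"])
  show "norm (Cdual (\<lambda>x. B (xs @ [x]))) \<le> M * (\<Prod>x\<leftarrow>xs. norm x)"
    using le mform_nonneg[OF B] prod_list_norm_nonneg[of xs]
    by (intro norm_cdual_le) (auto simp: Cdual_inverse bc)
qed

lemma mform_iterated_limit:
  assumes B: "mform (Suc j) M B"
  shows "mform j (M * norm z) (\<lambda>xs. Lim (weak_star_approx z) (\<lambda>x. B (xs @ [x])))"
proof -
  define f where "f xs = Cdual (\<lambda>x. B (xs @ [x]))" for xs
  have eq: "Lim (weak_star_approx z) (\<lambda>x. B (xs @ [x])) = cdual_apply z (f xs)"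
    if "length xs = j" for xs
    unfolding f_def using that by (intro Lim_weak_star_approx mform_last_bounded[OF B])
  have app: "cdual_apply (f xs) x = B (xs @ [x])" if "length xs = j" for xs x
    unfolding f_def using mform_last_bounded(1)[OF B that] by (simp add: Cdual_inverse)
  have "clinear (\<lambda>v. Lim (weak_star_approx z) (\<lambda>x. B ((us @ v # ws) @ [x])))"
    if len: "length us + length ws + 1 = j" for us ws
  proof -
    have cl: "clinear (\<lambda>v. B (us @ v # ws @ [x]))" for x
      using mform_clinear[OF B, of us "ws @ [x]"] len by simp
    have "f (us @ (v + w) # ws) = f (us @ v # ws) + f (us @ w # ws)"
      "f (us @ (c *\<^sub>C v) # ws) = c *\<^sub>C f (us @ v # ws)" for v w c
      using len clinear_add[OF cl] clinear_scale[OF cl]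
      by (auto intro!: cdual_eqI simp: app cdual_add_apply cdual_scaleC_apply)
    then show ?thesis
      using len eq[of "us @ _ # ws"]
      by (intro clinear_complexI) (simp_all add: cdual_apply_add cdual_apply_scaleC)
  qed
  moreover have "cmod (Lim (weak_star_approx z) (\<lambda>x. B (xs @ [x]))) \<le> M * norm z * (\<Prod>x\<leftarrow>xs. norm x)"
    if len: "length xs = j" for xs
  proof -
    have "cmod (cdual_apply z (f xs)) \<le> norm z * norm (f xs)" by (rule cdual_apply_bound)
    also have "\<dots> \<le> norm z * (M * (\<Prod>x\<leftarrow>xs. norm x))"
      unfolding f_def by (intro mult_left_mono mform_last_bounded(2)[OF B len]) simp
    finally show ?thesis by (simp add: eq[OF len] mult_ac)
  qed
  ultimately show ?thesis using mform_nonneg[OF B] by (simp add: mform_def)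
qed

lemma AB_form_partial_mform:
  "mform (j + length zs) M A \<Longrightarrow>
    mform j (M * (\<Prod>z\<leftarrow>zs. norm z)) (\<lambda>xs. AB_form zs (\<lambda>ys. A (xs @ ys)))"
proof (induction zs arbitrary: j)
  case (Cons z zs)
  then have "mform (Suc j) (M * (\<Prod>z\<leftarrow>zs. norm z)) (\<lambda>xs. AB_form zs (\<lambda>ys. A (xs @ ys)))"
    by simp
  from mform_iterated_limit[OF this, of z] show ?case by (simp add: mult_ac)
qed simp

text \<open>
  The inner limits depend linearly and boundedly on the outermost variable, so each limit in
  \<open>AB_form\<close> exists and can be computed by applying an element of the bidual.
\<close>

lemma AB_form_Cons:
  assumes "mform (Suc (length zs)) M A"
  shows "bounded_clinear (\<lambda>x. AB_form zs (\<lambda>xs. A (x # xs)))"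
    and "AB_form (z # zs) A = cdual_apply z (Cdual (\<lambda>x. AB_form zs (\<lambda>xs. A (x # xs))))"
proof -
  have "mform (Suc 0) (M * (\<Prod>z\<leftarrow>zs. norm z)) (\<lambda>xs. AB_form zs (\<lambda>ys. A (xs @ ys)))"
    by (rule AB_form_partial_mform) (use assms in simp)
  from mform_last_bounded(1)[OF this, of "[]"]
  show "bounded_clinear (\<lambda>x. AB_form zs (\<lambda>xs. A (x # xs)))" by simp
  then show "AB_form (z # zs) A = cdual_apply z (Cdual (\<lambda>x. AB_form zs (\<lambda>xs. A (x # xs))))"
    by (simp add: Lim_weak_star_approx)
qed

lemma AB_form_mform: "mform n M A \<Longrightarrow> mform n M (\<lambda>zs. AB_form zs A)"
proof (induction n arbitrary: A M)
  case 0
  then show ?case by (simp add: mform_def)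
next
  case (Suc n)
  note IH = Suc.IH[OF mform_Cons[OF Suc.prems]]
  define f where "f zs = Cdual (\<lambda>x. AB_form zs (\<lambda>xs. A (x # xs)))" for zs
  have bc: "bounded_clinear (\<lambda>x. AB_form zs (\<lambda>xs. A (x # xs)))"
    and eq: "AB_form (z # zs) A = cdual_apply z (f zs)" if "length zs = n" for z zs
    unfolding f_def using AB_form_Cons[of zs M A] Suc.prems that by auto
  have app: "cdual_apply (f zs) x = AB_form zs (\<lambda>xs. A (x # xs))" if "length zs = n" for zs x
    unfolding f_def using bc[OF that] by (simp add: Cdual_inverse)
  have "clinear (\<lambda>v. AB_form (us @ v # ws) A)" if len: "length us + length ws + 1 = Suc n" for us ws
  proof (cases us)
    case Nil
    then show ?thesis
      using len by (intro clinear_complexI) (simp_all del: AB_form.simps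
          add: eq cdual_add_apply cdual_scaleC_apply)
  next
    case (Cons z us')
    have cl: "clinear (\<lambda>v. AB_form (us' @ v # ws) (\<lambda>xs. A (x # xs)))" for x
      by (rule mform_clinear[OF IH]) (use len Cons in simp)
    have "f (us' @ (v + w) # ws) = f (us' @ v # ws) + f (us' @ w # ws)"
      "f (us' @ (c *\<^sub>C v) # ws) = c *\<^sub>C f (us' @ v # ws)" for v w c
      using len Cons clinear_add[OF cl] clinear_scale[OF cl]
      by (auto intro!: cdual_eqI simp: app cdual_add_apply cdual_scaleC_apply)
    then show ?thesis
      using len Cons by (intro clinear_complexI)
        (simp_all del: AB_form.simps add: eq cdual_apply_add cdual_apply_scaleC)
  qed
  moreover have "cmod (AB_form zs A) \<le> M * (\<Prod>z\<leftarrow>zs. norm z)" if len: "length zs = Suc n" for zs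
  proof -
    obtain z zs' where zs: "zs = z # zs'" "length zs' = n" using len by (cases zs) auto
    have "norm (f zs') \<le> M * (\<Prod>z\<leftarrow>zs'. norm z)"
    proof (rule norm_cdual_le)
      show "0 \<le> M * (\<Prod>z\<leftarrow>zs'. norm z)"
        using mform_nonneg[OF Suc.prems] prod_list_norm_nonneg[of zs'] by simp
      show "cmod (cdual_apply (f zs') x) \<le> M * (\<Prod>z\<leftarrow>zs'. norm z) * norm x" for x
        using mform_bound[OF IH, of zs' x] zs(2) by (simp add: app mult_ac)
    qed
    then have "norm z * norm (f zs') \<le> norm z * (M * (\<Prod>z\<leftarrow>zs'. norm z))"
      by (rule mult_left_mono) simp
    with cdual_apply_bound[of z "f zs'"]
    show ?thesis unfolding zs(1) eq[OF zs(2)] by (simp add: mult_ac)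
  qed
  ultimately show ?case using mform_nonneg[OF Suc.prems] by (simp add: mform_def)
qed

lemma AB_form_cong:
  assumes "\<And>xs. length xs = length zs \<Longrightarrow> A xs = B xs"
  shows "AB_form zs A = AB_form zs B"
  using assms
proof (induction zs arbitrary: A B)
  case (Cons z zs)
  then have "AB_form zs (\<lambda>xs. A (x # xs)) = AB_form zs (\<lambda>xs. B (x # xs))" for x
    by (intro Cons.IH) simp
  then show ?case by simp
qed simp

section \<open>Cauchy estimates\<close>

text \<open>
  Cauchy's inequality on the circles of radius \<open>r < R\<close>, followed by \<open>r \<longlongrightarrow> R\<close>; no continuity up to the
  boundary is assumed.
\<close>

lemma cauchy_estimate_open_disc:
  assumes f: "f holomorphic_on ball 0 R" and M: "\<And>t. t \<in> ball 0 R \<Longrightarrow> cmod (f t) \<le> M" and R: "0 < R"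
  shows "cmod ((deriv ^^ n) f 0) * R ^ n \<le> fact n * M"
proof (rule tendsto_upperbound)
  show "((\<lambda>r. cmod ((deriv ^^ n) f 0) * r ^ n) \<longlongrightarrow> cmod ((deriv ^^ n) f 0) * R ^ n) (at_left R)"
    by (intro tendsto_intros)
  have "cmod ((deriv ^^ n) f 0) * r ^ n \<le> fact n * M" if r: "0 < r" "r < R" for r
  proof -
    have "cmod ((deriv ^^ n) f 0) \<le> fact n * M / r ^ n"
      using r M by (intro Cauchy_inequality holomorphic_on_imp_continuous_on holomorphic_on_subset[OF f])
        (auto simp: dist_norm)
    with r show ?thesis by (simp add: field_simps)
  qed
  then show "\<forall>\<^sub>F r in at_left R. cmod ((deriv ^^ n) f 0) * r ^ n \<le> fact n * M"
    using R by (auto simp: eventually_at_left_field intro: exI[of _ 0])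
qed simp

lemma second_order_remainder_disc:
  assumes f: "f holomorphic_on ball 0 R" and M: "\<And>t. t \<in> ball 0 R \<Longrightarrow> cmod (f t) \<le> M" and R: "4 \<le> R"
  shows "cmod (f 1 - f 0 - deriv f 0) \<le> 8 * M / R\<^sup>2"
proof -
  have bound: "cmod ((deriv ^^ 2) f x) \<le> 8 * M / R\<^sup>2" if x: "x \<in> cball 0 1" for x
  proof -
    have sub: "y \<in> ball 0 R" if "dist x y \<le> R / 2" for y
      using x R that norm_triangle_ineq[of x "y - x"] by (simp add: dist_norm norm_minus_commute)
    have "cmod ((deriv ^^ 2) f x) \<le> fact 2 * M / (R / 2) ^ 2"
      using R sub M by (intro Cauchy_inequality holomorphic_on_imp_continuous_on holomorphic_on_subset[OF f])
        (auto simp: dist_norm)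
    then show ?thesis by (simp add: field_simps)
  qed
  have "cmod ((deriv ^^ 0) f 1 - (\<Sum>i\<le>1. (deriv ^^ i) f 0 * (1 - 0) ^ i / fact i))
      \<le> (8 * M / R\<^sup>2) * cmod (1 - 0) ^ Suc 1 / fact 1"
  proof (rule complex_Taylor[where S = "cball 0 1"])
    fix i x assume "x \<in> cball (0::complex) 1"
    then have "x \<in> ball 0 R" using R by simp
    then have "(deriv ^^ i) f field_differentiable at x"
      using holomorphic_higher_deriv[OF f] by (metis centre_in_ball holomorphic_on_imp_differentiable_at open_ball)
    then show "((deriv ^^ i) f has_field_derivative (deriv ^^ Suc i) f x) (at x within cball 0 1)"
      by (simp add: field_differentiable_derivI has_field_derivative_at_within)
  next
    fix x assume "x \<in> cball (0::complex) 1"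
    then show "cmod ((deriv ^^ Suc 1) f x) \<le> 8 * M / R\<^sup>2"
      using bound[of x] by (simp add: numeral_2_eq_2)
  qed auto
  then show ?thesis by (simp add: diff_diff_eq)
qed

section \<open>Directional derivatives and Taylor forms\<close>

definition directional :: "'a::complex_normed_vector \<Rightarrow> ('a \<Rightarrow> complex) \<Rightarrow> 'a \<Rightarrow> complex"
  where "directional v g x = deriv (\<lambda>t. g (x + t *\<^sub>C v)) 0"

lemma bounded_linear_scaleC_left: "bounded_linear (\<lambda>t. t *\<^sub>C v)"
  by (rule bounded_linear_intro[where K = "norm v"])
    (simp_all add: scaleC_add_left scaleR_scaleC scaleC_scaleC norm_scaleC scaleC_complex_def)

lemma continuous_on_scaleC_line: "continuous_on S (\<lambda>t. x + t *\<^sub>C v)"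
  by (intro continuous_intros bounded_linear.continuous_on[OF bounded_linear_scaleC_left])

lemma holomorphic_on_line_derivative:
  assumes g: "holomorphic_on_ball g" and x: "x + t *\<^sub>C v \<in> ball 0 1"
  shows "((\<lambda>t. g (x + t *\<^sub>C v)) has_field_derivative directional v g (x + t *\<^sub>C v)) (at t)"
    and directional_derivative: "bounded_clinear (\<lambda>w. directional w g (x + t *\<^sub>C v))"
      "(g has_derivative (\<lambda>w. directional w g (x + t *\<^sub>C v))) (at (x + t *\<^sub>C v))"
proof -
  obtain D where D: "bounded_clinear D" "(g has_derivative D) (at (x + t *\<^sub>C v))"
    using g x unfolding holomorphic_on_ball_def by blast
  have *: "((\<lambda>s. g (y + s *\<^sub>C w)) has_field_derivative D w) (at s)"
    if "y + s *\<^sub>C w = x + t *\<^sub>C v" for y w s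
  proof -
    have "((\<lambda>s. y + s *\<^sub>C w) has_derivative (\<lambda>s. s *\<^sub>C w)) (at s)"
      by (auto intro!: derivative_eq_intros bounded_linear_imp_has_derivative bounded_linear_scaleC_left)
    from has_derivative_compose[OF this, of g D] D(2) that
    have "((\<lambda>s. g (y + s *\<^sub>C w)) has_derivative (\<lambda>s. D (s *\<^sub>C w))) (at s)" by simp
    moreover have "D (s *\<^sub>C w) = D w * s" for s
      using D(1) by (simp add: bounded_clinear_iff scaleC_complex_def mult.commute)
    ultimately show ?thesis by (simp add: has_field_derivative_def)
  qed
  have D_eq: "directional w g (x + t *\<^sub>C v) = D w" for w
    unfolding directional_def by (rule DERIV_imp_deriv, rule *) simp
  show "((\<lambda>t. g (x + t *\<^sub>C v)) has_field_derivative directional v g (x + t *\<^sub>C v)) (at t)"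
    unfolding D_eq by (rule *) simp
  show "bounded_clinear (\<lambda>w. directional w g (x + t *\<^sub>C v))"
    unfolding D_eq by (rule D(1))
  show "(g has_derivative (\<lambda>w. directional w g (x + t *\<^sub>C v))) (at (x + t *\<^sub>C v))"
    unfolding D_eq by (rule D(2))
qed

lemma
  assumes "holomorphic_on_ball g" "x \<in> ball 0 1"
  shows bounded_clinear_directional: "bounded_clinear (\<lambda>v. directional v g x)"
    and has_derivative_directional: "(g has_derivative (\<lambda>v. directional v g x)) (at x)"
  using directional_derivative[of g x 0 0] assms by simp_all

lemma holomorphic_on_line:
  assumes "holomorphic_on_ball g" "\<And>t. t \<in> S \<Longrightarrow> x + t *\<^sub>C v \<in> ball 0 1"
  shows "(\<lambda>t. g (x + t *\<^sub>C v)) holomorphic_on S"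
  using holomorphic_on_line_derivative(1)[OF assms(1) assms(2)]
  by (auto simp: holomorphic_on_def field_differentiable_def intro: has_field_derivative_at_within)

text \<open>
  Cauchy's inequality on the disc \<open>cmod t < \<delta> / norm v\<close> of the line through \<open>y\<close> in the direction \<open>v\<close>.
\<close>

lemma directional_bound:
  assumes g: "holomorphic_on_ball g" and sub: "ball y \<delta> \<subseteq> ball 0 1" and \<delta>: "0 < \<delta>"
    and M: "\<And>x. x \<in> ball y \<delta> \<Longrightarrow> cmod (g x) \<le> M"
  shows "cmod (directional v g y) \<le> M / \<delta> * norm v"
proof (cases "v = 0")
  case True
  have "directional 0 g y = 0" by (simp add: directional_def)
  with True show ?thesis by simp
next
  case False
  have line: "y + t *\<^sub>C v \<in> ball y \<delta>" if "t \<in> ball 0 (\<delta> / norm v)" for t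
    using that False by (simp add: dist_norm norm_scaleC field_simps)
  have "cmod ((deriv ^^ 1) (\<lambda>t. g (y + t *\<^sub>C v)) 0) * (\<delta> / norm v) ^ 1 \<le> fact 1 * M"
    by (rule cauchy_estimate_open_disc)
      (use line sub M False \<delta> in \<open>auto intro!: holomorphic_on_line g simp del: mem_ball\<close>)
  then show ?thesis using False \<delta> by (simp add: directional_def field_simps)
qed

text \<open>
  The constant depends on a bound for \<open>g\<close> only and not on its derivatives. This is what makes
  differentiability survive pointwise limits and what makes derivatives differentiable again.
\<close>

lemma second_order_remainder:
  assumes g: "holomorphic_on_ball g" and sub: "ball y \<delta> \<subseteq> ball 0 1" and \<delta>: "0 < \<delta>"
    and M: "\<And>x. x \<in> ball y \<delta> \<Longrightarrow> cmod (g x) \<le> M" and h: "norm h \<le> \<delta> / 4"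
  shows "cmod (g (y + h) - g y - directional h g y) \<le> 8 * M / \<delta>\<^sup>2 * (norm h)\<^sup>2"
proof (cases "h = 0")
  case True
  have "directional 0 g y = 0" by (simp add: directional_def)
  with True show ?thesis by simp
next
  case False
  have line: "y + t *\<^sub>C h \<in> ball y \<delta>" if "t \<in> ball 0 (\<delta> / norm h)" for t
    using that False by (simp add: dist_norm norm_scaleC field_simps)
  have "cmod ((\<lambda>t. g (y + t *\<^sub>C h)) 1 - (\<lambda>t. g (y + t *\<^sub>C h)) 0 - deriv (\<lambda>t. g (y + t *\<^sub>C h)) 0)
      \<le> 8 * M / (\<delta> / norm h)\<^sup>2"
    by (rule second_order_remainder_disc)
      (use line sub M False \<delta> h in \<open>auto intro!: holomorphic_on_line g simp: field_simps simp del: mem_ball\<close>)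
  then show ?thesis
    by (simp add: directional_def power_divide complex_vector.scale_one scaleC_scaleC)
qed

lemma locally_bounded_on_ball:
  assumes g: "holomorphic_on_ball g" and x: "x \<in> ball 0 1"
  obtains \<delta> M where "0 < \<delta>" "ball x \<delta> \<subseteq> ball 0 1" "\<And>y. y \<in> ball x \<delta> \<Longrightarrow> cmod (g y) \<le> M"
proof -
  have "isCont g x"
    using has_derivative_directional[OF g x] has_derivative_continuous by blast
  then obtain d where d: "0 < d" "\<And>y. dist y x < d \<Longrightarrow> dist (g y) (g x) < 1"
    unfolding continuous_at_eps_delta by (metis zero_less_one)
  have "cmod (g y) \<le> cmod (g x) + 1" if "y \<in> ball x d" for y
    using d(2)[of y] that norm_triangle_ineq[of "g x" "g y - g x"] by (simp add: dist_norm norm_minus_commute)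
  moreover obtain e where "0 < e" "ball x e \<subseteq> ball 0 1"
    using x open_ball open_contains_ball by blast
  ultimately show ?thesis
    using d(1) by (intro that[of "min d e" "cmod (g x) + 1"]) auto
qed

lemma has_derivative_of_quadratic_remainder:
  fixes f :: "'a::real_normed_vector \<Rightarrow> 'b::real_normed_vector"
  assumes D: "bounded_linear D" and \<epsilon>: "0 < \<epsilon>"
    and est: "\<And>h. norm h \<le> \<epsilon> \<Longrightarrow> norm (f (x + h) - f x - D h) \<le> C * (norm h)\<^sup>2"
  shows "(f has_derivative D) (at x)"
  unfolding has_derivative_at
proof (intro conjI D)
  have lim: "((\<lambda>h. C * norm h) \<longlongrightarrow> C * norm (0::'a)) (at (0::'a))"
    by (rule tendsto_mult[OF tendsto_const tendsto_norm[OF tendsto_ident_at]])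
  show "(\<lambda>h. norm (f (x + h) - f x - D h) / norm h) \<midarrow>0\<rightarrow> 0"
  proof (rule tendsto_sandwich[OF _ _ tendsto_const])
    show "\<forall>\<^sub>F h in at 0. norm (f (x + h) - f x - D h) / norm h \<le> C * norm h"
      unfolding eventually_at
    proof (intro exI conjI ballI impI)
      fix h :: 'a assume "h \<noteq> 0 \<and> dist h 0 < \<epsilon>"
      with est[of h] show "norm (f (x + h) - f x - D h) / norm h \<le> C * norm h"
        by (simp add: power2_eq_square divide_le_eq mult.assoc)
    qed (rule \<epsilon>)
    show "((\<lambda>h. C * norm h) \<longlongrightarrow> 0) (at (0::'a))" using lim by simp
  qed simp
qed

text \<open>
  The second-order remainder of \<open>g\<close> at \<open>x + t v\<close> is holomorphic in \<open>t\<close> and of size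
  \<open>O((norm h)\<^sup>2)\<close> uniformly for small \<open>t\<close>. By Cauchy's inequality so is its derivative at \<open>t = 0\<close>,
  which is the remainder in differentiating \<open>directional v g\<close> at \<open>x\<close>. The linear part that appears is
  \<open>h \<mapsto> directional v (directional h g) x\<close>, so the proof gives the symmetry of the second
  derivative as well.
\<close>

lemma directional_has_derivative:
  assumes g: "holomorphic_on_ball g" and x: "x \<in> ball 0 1"
  shows "bounded_clinear (\<lambda>h. directional v (directional h g) x)"
    and "(directional v g has_derivative (\<lambda>h. directional v (directional h g) x)) (at x)"
proof -
  obtain \<delta>' M where "0 < \<delta>'" "ball x \<delta>' \<subseteq> ball 0 1" and M: "\<And>y. y \<in> ball x \<delta>' \<Longrightarrow> cmod (g y) \<le> M"
    using locally_bounded_on_ball[OF g x] by blast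
  define \<delta> where "\<delta> = \<delta>' / 2"
  have \<delta>: "0 < \<delta>" and sub: "ball x (2 * \<delta>) \<subseteq> ball 0 1"
    and M: "\<And>y. y \<in> ball x (2 * \<delta>) \<Longrightarrow> cmod (g y) \<le> M"
    using \<open>0 < \<delta>'\<close> \<open>ball x \<delta>' \<subseteq> ball 0 1\<close> M by (simp_all add: \<delta>_def)
  have near: "ball y \<delta> \<subseteq> ball x (2 * \<delta>)" if "y \<in> ball x \<delta>" for y
  proof
    fix w assume "w \<in> ball y \<delta>"
    with that show "w \<in> ball x (2 * \<delta>)" using dist_triangle[of x w y] by simp
  qed
  define C where "C = 8 * M / \<delta>\<^sup>2"
  have rem: "cmod (g (y + h) - g y - directional h g y) \<le> C * (norm h)\<^sup>2"
    if "y \<in> ball x \<delta>" "norm h \<le> \<delta> / 4" for y h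
    unfolding C_def using near[OF that(1)] sub M that(2) \<delta> by (intro second_order_remainder g) auto
  have dbound: "cmod (directional h g y) \<le> M / \<delta> * norm h" if "y \<in> ball x \<delta>" for y h
    using near[OF that(1)] sub M \<delta> by (intro directional_bound g) auto
  have scale: "directional (c *\<^sub>C h) g y = c * directional h g y"
    and add: "directional (h + h') g y = directional h g y + directional h' g y"
    if "y \<in> ball 0 1" for y h h' c
    using bounded_clinear_directional[OF g that]
    by (simp_all add: bounded_clinear_def clinear_def scaleC_complex_def)
  define \<rho> where "\<rho> = \<delta> / (norm v + 1)"
  have \<rho>: "0 < \<rho>" using \<delta> by (simp add: \<rho>_def add_nonneg_pos)
  have line: "x + t *\<^sub>C v \<in> ball x \<delta>" if "t \<in> ball 0 \<rho>" for t
  proof -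
    have "cmod t * norm v \<le> cmod t * (norm v + 1)" by (intro mult_left_mono) auto
    also have "\<dots> < \<delta>" using that by (simp add: \<rho>_def pos_less_divide_eq add_nonneg_pos)
    finally show ?thesis by (simp add: dist_norm norm_scaleC)
  qed
  have "ball x \<delta> \<subseteq> ball x (2 * \<delta>)" using \<delta> by (intro subset_ball) simp
  with sub have sub1: "ball x \<delta> \<subseteq> ball 0 1" by blast
  have hol: "(\<lambda>t. directional h g (x + t *\<^sub>C v)) holomorphic_on ball 0 \<rho>" for h
  proof -
    \<comment> \<open>Difference quotients with step \<open>1 / k n\<close>; the shift by \<open>N\<close> makes all the steps small enough for \<open>rem\<close>.\<close>
    obtain N where N: "norm h / (\<delta> / 4) < of_nat N" using reals_Archimedean2 by blast
    define k :: "nat \<Rightarrow> complex" where "k n = of_nat (Suc (n + N))" for n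
    define f where "f n t = k n * (g ((x + inverse (k n) *\<^sub>C h) + t *\<^sub>C v) - g (x + t *\<^sub>C v))" for n t
    have k: "k n \<noteq> 0" "cmod (k n) = real (Suc (n + N))" for n
      by (simp_all add: k_def del: of_nat_Suc)
    have nk: "norm (inverse (k n) *\<^sub>C h) = norm h / real (Suc (n + N))" for n
      unfolding norm_scaleC norm_inverse k(2) by (simp add: divide_inverse mult.commute del: of_nat_Suc)
    have small: "norm (inverse (k n) *\<^sub>C h) \<le> \<delta> / 4" for n
    proof -
      have "norm h / (\<delta> / 4) < real (Suc (n + N))" using N by linarith
      then show ?thesis using \<delta> unfolding nk by (simp add: divide_simps mult_ac del: of_nat_Suc)
    qed
    have conv: "cmod (f n t - directional h g (x + t *\<^sub>C v)) \<le> C * (norm h)\<^sup>2 / real (Suc (n + N))"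
      if t: "t \<in> ball 0 \<rho>" for n t
    proof -
      let ?y = "x + t *\<^sub>C v"
      have "f n t - directional h g ?y
          = k n * (g (?y + inverse (k n) *\<^sub>C h) - g ?y - directional (inverse (k n) *\<^sub>C h) g ?y)"
        using line[OF t] sub1 k(1)[of n]
        by (subst scale) (auto simp: f_def algebra_simps simp del: mem_ball)
      also have "cmod \<dots> \<le> real (Suc (n + N)) * (C * (norm (inverse (k n) *\<^sub>C h))\<^sup>2)"
        unfolding norm_mult k(2)
        by (intro mult_left_mono rem line t small) simp
      also have "\<dots> = C * (norm h)\<^sup>2 / real (Suc (n + N))"
        unfolding nk by (simp add: power2_eq_square field_simps del: of_nat_Suc)
      finally show ?thesis .
    qed
    have lim: "uniform_limit (ball 0 \<rho>) f (\<lambda>t. directional h g (x + t *\<^sub>C v)) sequentially"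
    proof (rule uniform_limitI)
      fix e :: real assume e: "0 < e"
      have "(\<lambda>n. C * (norm h)\<^sup>2 / real (Suc (n + N))) \<longlonglongrightarrow> 0"
        using LIMSEQ_ignore_initial_segment[OF lim_const_over_n, of "C * (norm h)\<^sup>2" "Suc N"] by simp
      then have "\<forall>\<^sub>F n in sequentially. C * (norm h)\<^sup>2 / real (Suc (n + N)) < e"
        using e by (rule order_tendstoD)
      then show "\<forall>\<^sub>F n in sequentially. \<forall>t\<in>ball 0 \<rho>. dist (f n t) (directional h g (x + t *\<^sub>C v)) < e"
        by eventually_elim (auto simp: dist_norm simp del: mem_ball intro: le_less_trans[OF conv])
    qed
    show ?thesis
    proof (rule holomorphic_uniform_sequence[where f = f])
      fix n
      have "x + inverse (k n) *\<^sub>C h + t *\<^sub>C v \<in> ball x (2 * \<delta>)" if t: "t \<in> ball 0 \<rho>" for t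
      proof -
        have "norm (inverse (k n) *\<^sub>C h + t *\<^sub>C v) \<le> norm (inverse (k n) *\<^sub>C h) + norm (t *\<^sub>C v)"
          by (rule norm_triangle_ineq)
        also have "\<dots> < \<delta> + \<delta>"
          using line[OF t] small[of n] \<delta> by (intro add_strict_mono) (simp_all add: dist_norm)
        finally have "norm (inverse (k n) *\<^sub>C h + t *\<^sub>C v) < 2 * \<delta>" by simp
        moreover have "x - (x + inverse (k n) *\<^sub>C h + t *\<^sub>C v) = - (inverse (k n) *\<^sub>C h + t *\<^sub>C v)"
          by simp
        ultimately show ?thesis by (simp only: mem_ball dist_norm norm_minus_cancel)
      qed
      then show "f n holomorphic_on ball 0 \<rho>"
        unfolding f_def using line sub1 sub
        by (intro holomorphic_intros holomorphic_on_line g) blast+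
    next
      fix t :: complex assume "t \<in> ball 0 \<rho>"
      then obtain d where "0 < d" "cball t d \<subseteq> ball 0 \<rho>"
        using open_contains_cball open_ball by metis
      then show "\<exists>d>0. cball t d \<subseteq> ball 0 \<rho> \<and>
          uniform_limit (cball t d) f (\<lambda>t. directional h g (x + t *\<^sub>C v)) sequentially"
        using uniform_limit_on_subset[OF lim] by blast
    qed simp
  qed
  have diff0: "(\<lambda>t. directional h g (x + t *\<^sub>C v)) field_differentiable at 0" for h
    using hol[of h] \<rho> by (intro holomorphic_on_imp_differentiable_at[OF _ open_ball]) auto
  have line1: "x + t *\<^sub>C v \<in> ball 0 1" if "t \<in> ball 0 \<rho>" for t
    using line[OF that] sub1 by blast
  have ev: "eventually (\<lambda>t. t \<in> ball 0 \<rho>) (nhds (0::complex))"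
    using \<rho> by (intro eventually_nhds_in_open) auto
  let ?L = "\<lambda>h. directional v (directional h g) x"
  show bc: "bounded_clinear ?L"
    unfolding bounded_clinear_def
  proof (intro conjI clinear_complexI exI allI)
    fix h h' :: 'a and c :: complex
    have "?L (h + h') = deriv (\<lambda>t. directional h g (x + t *\<^sub>C v) + directional h' g (x + t *\<^sub>C v)) 0"
      unfolding directional_def[of v]
      by (intro deriv_cong_ev eventually_mono[OF ev]) (auto intro!: add line1)
    then show "?L (h + h') = ?L h + ?L h'"
      by (simp add: directional_def[of v] deriv_add[OF diff0 diff0])
    have "?L (c *\<^sub>C h) = deriv (\<lambda>t. c * directional h g (x + t *\<^sub>C v)) 0"
      unfolding directional_def[of v]
      by (intro deriv_cong_ev eventually_mono[OF ev]) (auto intro!: scale line1)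
    then show "?L (c *\<^sub>C h) = c * ?L h"
      by (simp add: directional_def[of v] deriv_cmult[OF diff0])
    have "cmod ((deriv ^^ 1) (\<lambda>t. directional h g (x + t *\<^sub>C v)) 0) * \<rho> ^ 1 \<le> fact 1 * (M / \<delta> * norm h)"
      by (rule cauchy_estimate_open_disc[OF hol]) (use dbound line \<rho> in auto)
    then have "cmod (?L h) * \<rho> \<le> M / \<delta> * norm h" by (simp add: directional_def[of v])
    then have "cmod (?L h) \<le> M / \<delta> * norm h / \<rho>" using \<rho> by (simp only: pos_le_divide_eq)
    then show "cmod (?L h) \<le> norm h * (M / \<delta> / \<rho>)" by (simp add: mult_ac)
  qed
  have est: "cmod (directional v g (x + h) - directional v g x - ?L h) \<le> C / \<rho> * (norm h)\<^sup>2"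
    if h: "norm h \<le> \<delta> / 4" for h
  proof -
    define K where "K t = g ((x + h) + t *\<^sub>C v) - g (x + t *\<^sub>C v) - directional h g (x + t *\<^sub>C v)" for t
    have xh: "x + h + t *\<^sub>C v \<in> ball 0 1" if t: "t \<in> ball 0 \<rho>" for t
    proof -
      have "x + h + t *\<^sub>C v \<in> ball (x + t *\<^sub>C v) \<delta>" using h \<delta> by (simp add: dist_norm)
      then show ?thesis using near[OF line[OF t]] sub by blast
    qed
    have h1: "(\<lambda>t. g ((x + h) + t *\<^sub>C v)) holomorphic_on ball 0 \<rho>"
      "(\<lambda>t. g (x + t *\<^sub>C v)) holomorphic_on ball 0 \<rho>"
      using xh line1 by (auto intro!: holomorphic_on_line g simp del: mem_ball)
    have "cmod ((deriv ^^ 1) K 0) * \<rho> ^ 1 \<le> fact 1 * (C * (norm h)\<^sup>2)"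
    proof (rule cauchy_estimate_open_disc)
      show "K holomorphic_on ball 0 \<rho>" unfolding K_def by (intro holomorphic_intros h1 hol)
      show "cmod (K t) \<le> C * (norm h)\<^sup>2" if "t \<in> ball 0 \<rho>" for t
        using rem[OF line[OF that] h] by (simp add: K_def algebra_simps)
    qed (rule \<rho>)
    moreover have "deriv K 0 = directional v g (x + h) - directional v g x - ?L h"
    proof -
      have d: "(\<lambda>t. g ((x + h) + t *\<^sub>C v)) field_differentiable at 0"
        "(\<lambda>t. g (x + t *\<^sub>C v)) field_differentiable at 0"
        using h1 \<rho> by (auto intro!: holomorphic_on_imp_differentiable_at[OF _ open_ball])
      then show ?thesis
        unfolding K_def directional_def[of v]
        by (subst deriv_diff, (intro field_differentiable_diff d diff0)+)
          (subst deriv_diff, (intro d diff0)+, simp)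
    qed
    ultimately have "cmod (directional v g (x + h) - directional v g x - ?L h) * \<rho> \<le> C * (norm h)\<^sup>2"
      by simp
    then have "cmod (directional v g (x + h) - directional v g x - ?L h) \<le> C * (norm h)\<^sup>2 / \<rho>"
      using \<rho> by (simp only: pos_le_divide_eq)
    then show ?thesis by simp
  qed
  show "(directional v g has_derivative ?L) (at x)"
    using bc \<delta> est
    by (intro has_derivative_of_quadratic_remainder[of _ "\<delta> / 4" _ _ "C / \<rho>"]) (auto simp: bounded_clinear_iff)
qed

lemma holomorphic_on_ball_directional:
  assumes "holomorphic_on_ball g"
  shows "holomorphic_on_ball (directional v g)"
  unfolding holomorphic_on_ball_def
  using directional_has_derivative[OF assms] by blast

lemma directional_commute:
  assumes g: "holomorphic_on_ball g" and x: "x \<in> ball 0 1"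
  shows "directional w (directional v g) x = directional v (directional w g) x"
  using has_derivative_unique[OF has_derivative_directional[OF holomorphic_on_ball_directional[OF g] x]
      directional_has_derivative(2)[OF g x]]
  by metis

lemma directional_cong:
  assumes eq: "\<And>y. y \<in> ball 0 1 \<Longrightarrow> g y = g' y" and x: "x \<in> ball 0 1"
  shows "directional v g x = directional v g' x"
  unfolding directional_def
proof (rule deriv_cong_ev[OF _ refl])
  have "open ((\<lambda>t. x + t *\<^sub>C v) -` ball 0 1)"
    using open_vimage[OF open_ball continuous_on_scaleC_line[of UNIV x v]] by simp
  then have "eventually (\<lambda>t. t \<in> (\<lambda>t. x + t *\<^sub>C v) -` ball 0 1) (nhds 0)"
    using x by (intro eventually_nhds_in_open) auto
  then show "\<forall>\<^sub>F t in nhds 0. g (x + t *\<^sub>C v) = g' (x + t *\<^sub>C v)"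
    by eventually_elim (auto intro: eq)
qed

lemma holomorphic_on_ball_foldr:
  "holomorphic_on_ball g \<Longrightarrow> holomorphic_on_ball (foldr directional vs g)"
  by (induction vs) (auto intro: holomorphic_on_ball_directional)

text \<open>
  Directional derivatives commute, so one of them can be carried out last.
\<close>

lemma foldr_directional_shift:
  assumes g: "holomorphic_on_ball g"
  shows "x \<in> ball 0 1 \<Longrightarrow> foldr directional (us @ v # ws) g x = directional v (foldr directional (us @ ws) g) x"
proof (induction us arbitrary: x)
  case (Cons u us)
  have "foldr directional ((u # us) @ v # ws) g x
      = directional u (directional v (foldr directional (us @ ws) g)) x"
    using Cons by (simp only: append_Cons foldr.simps comp_apply) (rule directional_cong)
  also have "\<dots> = directional v (directional u (foldr directional (us @ ws) g)) x"
    by (intro directional_commute holomorphic_on_ball_foldr g Cons.prems)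
  finally show ?case by simp
qed simp

lemma foldr_directional_mset:
  assumes g: "holomorphic_on_ball g"
  shows "mset us = mset vs \<Longrightarrow> x \<in> ball 0 1 \<Longrightarrow> foldr directional us g x = foldr directional vs g x"
proof (induction us arbitrary: vs x)
  case (Cons u us)
  then have "u \<in> set vs" by (metis list.set_intros(1) mset_eq_setD)
  then obtain as bs where vs: "vs = as @ u # bs" by (meson split_list)
  have "foldr directional vs g x = directional u (foldr directional (as @ bs) g) x"
    unfolding vs by (intro foldr_directional_shift g Cons.prems)
  also have "\<dots> = directional u (foldr directional us g) x"
    using Cons.prems(1) by (intro directional_cong Cons.prems(2) Cons.IH[symmetric]) (simp_all add: vs)
  finally show ?case by simp
qed simp

lemma foldr_directional_diag:
  assumes g: "holomorphic_on_ball g"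
  shows "s *\<^sub>C x \<in> ball 0 1 \<Longrightarrow>
    foldr directional (replicate k x) g (s *\<^sub>C x) = (deriv ^^ k) (\<lambda>t. g (t *\<^sub>C x)) s"
proof (induction k arbitrary: s)
  case (Suc k)
  let ?G = "foldr directional (replicate k x) g"
  have "foldr directional (replicate (Suc k) x) g (s *\<^sub>C x) = deriv (\<lambda>t. ?G (t *\<^sub>C x)) s"
    using DERIV_imp_deriv[OF holomorphic_on_line_derivative(1)[OF holomorphic_on_ball_foldr[OF g],
          where x = 0 and t = s and v = x]] Suc.prems
    by (simp del: foldr_replicate)
  also have "\<dots> = deriv ((deriv ^^ k) (\<lambda>t. g (t *\<^sub>C x))) s"
  proof (rule deriv_cong_ev[OF _ refl])
    have "open ((\<lambda>t. t *\<^sub>C x) -` ball 0 1)"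
      using open_vimage[OF open_ball continuous_on_scaleC_line[of UNIV 0 x]] by simp
    then have "eventually (\<lambda>t. t \<in> (\<lambda>t. t *\<^sub>C x) -` ball 0 1) (nhds s)"
      using Suc.prems by (intro eventually_nhds_in_open) auto
    then show "\<forall>\<^sub>F t in nhds s. ?G (t *\<^sub>C x) = (deriv ^^ k) (\<lambda>t. g (t *\<^sub>C x)) t"
      by eventually_elim (rule Suc.IH, simp)
  qed
  finally show ?case by simp
qed simp

text \<open>
  Each differentiation costs \<open>\<delta>\<close> of the radius and a factor \<open>1 / \<delta>\<close>.
\<close>

lemma foldr_directional_bound:
  fixes g :: "'a::complex_normed_vector \<Rightarrow> complex" and \<delta> :: real
  assumes g: "holomorphic_on_ball g" and M: "\<And>x. x \<in> ball 0 1 \<Longrightarrow> cmod (g x) \<le> M" and \<delta>: "0 < \<delta>"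
  shows "x \<in> ball 0 (1 - length vs * \<delta>) \<Longrightarrow>
    cmod (foldr directional vs g x) \<le> M / \<delta> ^ length vs * (\<Prod>v\<leftarrow>vs. norm v)"
proof (induction vs arbitrary: x)
  case (Cons v vs)
  have sub: "ball x \<delta> \<subseteq> ball 0 (1 - length vs * \<delta>)"
  proof
    fix y assume "y \<in> ball x \<delta>"
    then show "y \<in> ball 0 (1 - length vs * \<delta>)"
      using Cons.prems dist_triangle[of 0 y x] by (simp add: algebra_simps)
  qed
  moreover have "ball (0::'a) (1 - length vs * \<delta>) \<subseteq> ball 0 1" using \<delta> by (intro subset_ball) simp
  ultimately have "cmod (directional v (foldr directional vs g) x)
      \<le> (M / \<delta> ^ length vs * (\<Prod>v\<leftarrow>vs. norm v)) / \<delta> * norm v"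
    using Cons.IH by (intro directional_bound holomorphic_on_ball_foldr g \<delta>) blast+
  also have "\<dots> = M / \<delta> ^ length (v # vs) * (\<Prod>v\<leftarrow>v # vs. norm v)"
    by (simp add: mult_ac)
  finally show ?case by simp
qed (use M in simp)

text \<open>
  The symmetric form of the \<open>k\<close>-th Taylor polynomial at \<open>0\<close>: the \<open>k\<close>-th derivative divided by \<open>k!\<close>.
\<close>

definition taylor_form :: "nat \<Rightarrow> ('a::complex_normed_vector \<Rightarrow> complex) \<Rightarrow> 'a list \<Rightarrow> complex"
  where "taylor_form k f xs = (if length xs = k then foldr directional xs f 0 / fact k else 0)"

lemma taylor_form:
  assumes f: "holomorphic_on_ball f" and M: "\<And>x. x \<in> ball 0 1 \<Longrightarrow> cmod (f x) \<le> M"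
  shows bounded_symmetric_taylor_form: "bounded_symmetric_form k (taylor_form k f)"
    and taylor_form_diag: "taylor_form k f (replicate k x) = taylor_poly k f x"
proof -
  show "taylor_form k f (replicate k x) = taylor_poly k f x"
    using foldr_directional_diag[OF f, of 0 x k] by (simp add: taylor_form_def taylor_poly_def)
  have "clinear (\<lambda>v. taylor_form k f (us @ v # ws))" if "length us + length ws + 1 = k" for us ws
  proof -
    have "taylor_form k f (us @ v # ws) = directional v (foldr directional (us @ ws) f) 0 / fact k" for v
      using that foldr_directional_shift[OF f, of 0 us v ws] by (simp add: taylor_form_def)
    moreover have "clinear (\<lambda>v. directional v (foldr directional (us @ ws) f) 0)"
      using bounded_clinear_directional[OF holomorphic_on_ball_foldr[OF f]]
      by (simp add: bounded_clinear_def del: foldr_append)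
    ultimately show ?thesis
      by (simp add: clinear_def scaleC_complex_def add_divide_distrib)
  qed
  moreover have "cmod (taylor_form k f xs) \<le> M / (1 / Suc k) ^ k / fact k * (\<Prod>x\<leftarrow>xs. norm x)"
    if "length xs = k" for xs
    using foldr_directional_bound[OF f M, of "1 / Suc k" 0 xs] that
    by (simp add: taylor_form_def norm_divide divide_right_mono divide_simps)
  moreover have "taylor_form k f xs = taylor_form k f ys" if "mset xs = mset ys" for xs ys
    using foldr_directional_mset[OF f that, of 0] mset_eq_length[OF that] by (simp add: taylor_form_def)
  moreover have "taylor_form k f xs = 0" if "length xs \<noteq> k" for xs
    using that by (simp add: taylor_form_def)
  ultimately show "bounded_symmetric_form k (taylor_form k f)"
    unfolding bounded_symmetric_form_def by blast
qed

lemma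
  assumes f: "holomorphic_on_ball f" and M: "\<And>x. x \<in> ball 0 1 \<Longrightarrow> cmod (f x) \<le> M"
  shows taylor_poly_sums: "x \<in> ball 0 1 \<Longrightarrow> (\<lambda>k. taylor_poly k f x) sums f x"
    and taylor_poly_bound: "0 < r \<Longrightarrow> norm x \<le> r \<Longrightarrow> cmod (taylor_poly k f x) \<le> M * r ^ k"
proof -
  have "(\<lambda>k. taylor_poly k f x) sums f x" if x: "x \<in> ball 0 1"
  proof (cases "x = 0")
    case True
    have "(deriv ^^ k) (\<lambda>t. c) = (\<lambda>t. if k = 0 then c else 0)" for c :: complex and k
      by (induction k) auto
    then have "taylor_poly k f x = (if k = 0 then f 0 else 0)" for k
      by (simp add: taylor_poly_def True)
    then show ?thesis using sums_single[of 0 "\<lambda>_. f 0"] by (simp add: True)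
  next
    case False
    have "(\<lambda>t. f (0 + t *\<^sub>C x)) holomorphic_on ball 0 (1 / norm x)"
      using False by (intro holomorphic_on_line f) (simp add: norm_scaleC field_simps)
    moreover have "1 \<in> ball (0::complex) (1 / norm x)" using x False by (simp add: field_simps)
    ultimately show ?thesis
      using holomorphic_power_series by (fastforce simp: taylor_poly_def)
  qed
  then show "x \<in> ball 0 1 \<Longrightarrow> (\<lambda>k. taylor_poly k f x) sums f x" .
  show "cmod (taylor_poly k f x) \<le> M * r ^ k" if r: "0 < r" "norm x \<le> r"
  proof -
    have line: "t *\<^sub>C x \<in> ball 0 1" if "t \<in> ball 0 (1 / r)" for t
    proof -
      have "cmod t * norm x \<le> cmod t * r" using r by (intro mult_left_mono) auto
      also have "\<dots> < 1" using that r by (simp add: field_simps)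
      finally show ?thesis by (simp add: norm_scaleC)
    qed
    have "(\<lambda>t. f (0 + t *\<^sub>C x)) holomorphic_on ball 0 (1 / r)"
      using line by (intro holomorphic_on_line f) simp
    then have "cmod ((deriv ^^ k) (\<lambda>t. f (t *\<^sub>C x)) 0) * (1 / r) ^ k \<le> fact k * M"
      using line M r by (intro cauchy_estimate_open_disc) auto
    then show ?thesis using r by (simp add: taylor_poly_def norm_divide field_simps)
  qed
qed

section \<open>Expansion of a form along the diagonal\<close>

text \<open>
  The derivative of \<open>x \<mapsto> A (x, \<dots>, x)\<close> in the direction \<open>u\<close>: the sum over all positions at which
  one \<open>x\<close> is replaced by \<open>u\<close>.
\<close>

primrec diagonal_derivative :: "nat \<Rightarrow> ('a::complex_normed_vector list \<Rightarrow> complex) \<Rightarrow> 'a \<Rightarrow> 'a \<Rightarrow> complex"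
  where
    "diagonal_derivative 0 A x u = 0"
  | "diagonal_derivative (Suc n) A x u =
      A (u # replicate n x) + diagonal_derivative n (\<lambda>xs. A (x # xs)) x u"

lemma diagonal_derivative_symmetric:
  "symmetric_list_fun (Suc n) A \<Longrightarrow>
    diagonal_derivative (Suc n) A x u = of_nat (Suc n) * A (u # replicate n x)"
proof (induction n arbitrary: A)
  case (Suc n)
  have "A (x # u # replicate n x) = A (u # replicate (Suc n) x)"
    by (rule symmetric_list_funD[OF Suc.prems]) simp_all
  then show ?case
    using Suc.IH[OF symmetric_Cons[OF Suc.prems]] by (simp add: algebra_simps)
qed simp

lemma bounded_clinear_diagonal_derivative:
  "mform n M A \<Longrightarrow> bounded_clinear (diagonal_derivative n A x)"
proof (induction n arbitrary: M A)
  case 0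
  show ?case by (auto simp: bounded_clinear_iff scaleC_complex_def)
next
  case (Suc n)
  have 1: "bounded_clinear (diagonal_derivative n (\<lambda>xs. A (x # xs)) x)"
    by (rule Suc.IH[OF mform_Cons[OF Suc.prems]])
  have "cmod (A (u # replicate n x)) \<le> norm u * (M * norm x ^ n)" for u
    using mform_bound[OF Suc.prems, of "u # replicate n x"] by (simp add: prod_list_replicate_norm mult_ac)
  then have 2: "bounded_clinear (\<lambda>u. A (u # replicate n x))"
    using mform_head_clinear[OF Suc.prems, of "replicate n x"] by (auto simp: bounded_clinear_def)
  have "diagonal_derivative (Suc n) A x =
      (\<lambda>u. A (u # replicate n x) + diagonal_derivative n (\<lambda>xs. A (x # xs)) x u)"
    by (simp add: fun_eq_iff)
  then show ?case
    using 1 2 by (auto simp: bounded_clinear_iff scaleC_complex_def algebra_simps intro: bounded_linear_add)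
qed

text \<open>
  Split off the first argument, \<open>A(x + u, \<dots>) = A(x, \<dots>) + A(u, \<dots>)\<close>; the first term is expanded to
  second order and the second term, which already contains a factor \<open>u\<close>, to first order.
\<close>

lemma diagonal_expansion:
  assumes "norm x \<le> R" "norm u \<le> R" "1 \<le> R"
  shows "mform n M A \<Longrightarrow>
    cmod (A (replicate n (x + u)) - A (replicate n x)) \<le> M * (4 * R) ^ n * norm u \<and>
    cmod (A (replicate n (x + u)) - A (replicate n x) - diagonal_derivative n A x u)
      \<le> M * (4 * R) ^ n * (norm u)\<^sup>2"
proof (induction n arbitrary: M A)
  case 0
  then show ?case using mform_nonneg[OF 0] by simp
next
  case (Suc n)
  note M = mform_nonneg[OF Suc.prems]
  let ?c = "(4 * R) ^ n"
  note IHx = Suc.IH[OF mform_Cons[OF Suc.prems, of x]]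
    and IHu = Suc.IH[OF mform_Cons[OF Suc.prems, of u]]
  have split: "A (replicate (Suc n) (x + u)) =
      A (x # replicate n (x + u)) + A (u # replicate n (x + u))"
    using clinear_add[OF mform_head_clinear[OF Suc.prems, of "replicate n (x + u)"]] by simp
  have grow: "M * norm x * ?c * b + M * b * ?c \<le> M * (4 * R) ^ Suc n * b" if "0 \<le> b" for b
  proof -
    have "norm x + 1 \<le> 4 * R" using assms by simp
    then have "(M * ?c * b) * (norm x + 1) \<le> (M * ?c * b) * (4 * R)"
      using M assms that by (intro mult_left_mono) auto
    then show ?thesis by (simp add: algebra_simps)
  qed
  have xu: "norm (x + u) \<le> 4 * R" using assms norm_triangle_ineq[of x u] by linarith
  have Au: "cmod (A (u # replicate n (x + u))) \<le> M * norm u * ?c"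
  proof -
    have "cmod (A (u # replicate n (x + u))) \<le> M * norm u * norm (x + u) ^ n"
      by (rule mform_diag_bound[OF mform_Cons[OF Suc.prems]])
    also have "\<dots> \<le> M * norm u * ?c" using M xu by (intro mult_left_mono power_mono) auto
    finally show ?thesis .
  qed
  have "cmod (A (replicate (Suc n) (x + u)) - A (replicate (Suc n) x))
      \<le> cmod (A (x # replicate n (x + u)) - A (x # replicate n x)) + cmod (A (u # replicate n (x + u)))"
    unfolding split using norm_triangle_ineq[of "A (x # replicate n (x + u)) - A (x # replicate n x)" "A (u # replicate n (x + u))"]
    by (simp add: algebra_simps)
  also have "\<dots> \<le> M * norm x * ?c * norm u + M * norm u * ?c"
    using IHx Au by (intro add_mono) auto
  also have "\<dots> \<le> M * (4 * R) ^ Suc n * norm u" by (rule grow) simp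
  finally have 1: "cmod (A (replicate (Suc n) (x + u)) - A (replicate (Suc n) x)) \<le> M * (4 * R) ^ Suc n * norm u" .
  have "cmod (A (replicate (Suc n) (x + u)) - A (replicate (Suc n) x) - diagonal_derivative (Suc n) A x u)
      \<le> cmod (A (x # replicate n (x + u)) - A (x # replicate n x) - diagonal_derivative n (\<lambda>xs. A (x # xs)) x u)
        + cmod (A (u # replicate n (x + u)) - A (u # replicate n x))"
    unfolding split using norm_triangle_ineq[of "A (x # replicate n (x + u)) - A (x # replicate n x) - diagonal_derivative n (\<lambda>xs. A (x # xs)) x u"
        "A (u # replicate n (x + u)) - A (u # replicate n x)"]
    by (simp add: algebra_simps)
  also have "\<dots> \<le> M * norm x * ?c * (norm u)\<^sup>2 + M * (norm u)\<^sup>2 * ?c"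
  proof (intro add_mono)
    have "cmod (A (u # replicate n (x + u)) - A (u # replicate n x)) \<le> M * norm u * ?c * norm u"
      using IHu by blast
    then show "cmod (A (u # replicate n (x + u)) - A (u # replicate n x)) \<le> M * (norm u)\<^sup>2 * ?c"
      by (simp add: power2_eq_square mult_ac)
  qed (use IHx in blast)
  also have "\<dots> \<le> M * (4 * R) ^ Suc n * (norm u)\<^sup>2" by (rule grow) simp
  finally show ?case using 1 by blast
qed

lemma holomorphic_on_ball_diagonal:
  assumes A: "mform n M A"
  shows "holomorphic_on_ball (\<lambda>x. A (replicate n x))"
  unfolding holomorphic_on_ball_def
proof
  fix x :: 'a assume "x \<in> ball 0 1"
  then have x: "norm x \<le> 1" by simp
  have bc: "bounded_clinear (diagonal_derivative n A x)" by (rule bounded_clinear_diagonal_derivative[OF A])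
  moreover have "((\<lambda>x. A (replicate n x)) has_derivative diagonal_derivative n A x) (at x)"
    using diagonal_expansion[OF x _ _ A] bc
    by (intro has_derivative_of_quadratic_remainder[where \<epsilon> = 1 and C = "M * (4 * 1) ^ n"])
      (auto simp: bounded_clinear_iff)
  ultimately show "\<exists>D. bounded_clinear D \<and> ((\<lambda>x. A (replicate n x)) has_derivative D) (at x)" by blast
qed

text \<open>
  Polarization by differentiation: if \<open>A\<close> vanishes on the diagonal then so does its derivative
  \<open>n A(u, x, \<dots>, x)\<close>, which means that \<open>A(u, \<dots>)\<close> vanishes on the diagonal for every \<open>u\<close>.
\<close>

lemma symmetric_form_eq_0:
  "mform n M A \<Longrightarrow> symmetric_list_fun n A \<Longrightarrow> (\<And>x. A (replicate n x) = 0) \<Longrightarrow> length xs = n \<Longrightarrow> A xs = 0"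
proof (induction n arbitrary: A M xs)
  case (Suc n)
  have diag: "A (u # replicate n x) = 0" for u x
  proof -
    define R where "R = 1 + norm x + norm u"
    define K where "K = M * (4 * R) ^ Suc n * (norm u)\<^sup>2"
    define a where "a = cmod (A (u # replicate n x))"
    have "a \<le> t * K" if t: "0 < t" "t < 1" for t :: real
    proof -
      have nt: "norm (t *\<^sub>R u) = t * norm u" using t by simp
      also have "\<dots> \<le> norm u" using t by (simp add: mult_left_le_one_le)
      finally have "norm x \<le> R" "norm (t *\<^sub>R u) \<le> R" "1 \<le> R"
        using norm_ge_zero[of x] norm_ge_zero[of u] unfolding R_def by linarith+
      then have "cmod (A (replicate (Suc n) (x + t *\<^sub>R u)) - A (replicate (Suc n) x)
          - diagonal_derivative (Suc n) A x (t *\<^sub>R u)) \<le> M * (4 * R) ^ Suc n * (norm (t *\<^sub>R u))\<^sup>2"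
        using diagonal_expansion[OF _ _ _ Suc.prems(1)] by blast
      then have "cmod (of_nat (Suc n) * A (t *\<^sub>R u # replicate n x)) \<le> M * (4 * R) ^ Suc n * (norm (t *\<^sub>R u))\<^sup>2"
        by (simp only: Suc.prems(3) diagonal_derivative_symmetric[OF Suc.prems(2)]) simp
      moreover have "A (t *\<^sub>R u # replicate n x) = t *\<^sub>R A (u # replicate n x)"
        using clinear_scaleR[OF mform_head_clinear[OF Suc.prems(1)], of "replicate n x"] by simp
      ultimately have "real (Suc n) * (t * a) \<le> K * t * t"
        using t unfolding nt by (simp add: a_def K_def norm_mult power2_eq_square mult_ac del: of_nat_Suc)
      then have "t * (real (Suc n) * a) \<le> t * (K * t)" by (simp only: mult_ac)
      then have "real (Suc n) * a \<le> K * t" using t by (simp only: mult_le_cancel_left_pos)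
      moreover have "1 * a \<le> real (Suc n) * a" by (intro mult_right_mono) (auto simp: a_def)
      ultimately show ?thesis by (simp add: mult.commute)
    qed
    then have ev: "\<forall>\<^sub>F t in at_right 0. a \<le> t * K"
      by (auto simp: eventually_at_right_field intro: exI[of _ 1])
    have "a \<le> 0 * K"
      by (rule tendsto_lowerbound[OF tendsto_mult[OF tendsto_ident_at tendsto_const] ev]) simp
    then show ?thesis by (simp add: a_def)
  qed
  obtain u us where "xs = u # us" "length us = n" using Suc.prems(4) by (cases xs) auto
  then show ?case
    using Suc.IH[OF mform_Cons[OF Suc.prems(1)] symmetric_Cons[OF Suc.prems(2)] diag] by blast
qed simp

lemma mform_diff:
  assumes "mform n M A" "mform n N B"
  shows "mform n (M + N) (\<lambda>xs. A xs - B xs)"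
proof -
  have "cmod (A xs - B xs) \<le> (M + N) * (\<Prod>x\<leftarrow>xs. norm x)" if "length xs = n" for xs
    using mform_bound[OF assms(1) that] mform_bound[OF assms(2) that] norm_triangle_ineq4[of "A xs" "B xs"]
    by (simp add: distrib_right)
  moreover have "clinear (\<lambda>v. A (us @ v # ws) - B (us @ v # ws))" if "length us + length ws + 1 = n" for us ws
    using mform_clinear[OF assms(1) that] mform_clinear[OF assms(2) that]
    by (simp add: clinear_def scaleC_complex_def algebra_simps)
  ultimately show ?thesis
    using mform_nonneg[OF assms(1)] mform_nonneg[OF assms(2)] by (simp add: mform_def)
qed

lemma symmetric_form_of_eq:
  assumes A: "bounded_symmetric_form n A" and P: "\<And>x. P x = A (replicate n x)"
  shows "symmetric_form_of n P = A"
  unfolding symmetric_form_of_def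
proof (rule the_equality)
  show "bounded_symmetric_form n A \<and> (\<forall>x. P x = A (replicate n x))" using A P by blast
next
  fix B assume B: "bounded_symmetric_form n B \<and> (\<forall>x. P x = B (replicate n x))"
  obtain M where M: "mform n M A" "symmetric_list_fun n A" using bounded_symmetric_formD[OF A] .
  obtain N where N: "mform n N B" "symmetric_list_fun n B" using B bounded_symmetric_formD by blast
  have sym: "symmetric_list_fun n (\<lambda>xs. B xs - A xs)"
    using M(2) N(2) unfolding symmetric_list_fun_def by metis
  have "B xs = A xs" for xs
  proof (cases "length xs = n")
    case True
    have "B (replicate n x) - A (replicate n x) = 0" for x using B P by (metis right_minus_eq)
    from symmetric_form_eq_0[OF mform_diff[OF N(1) M(1)] sym this True] show ?thesis by simp
  next
    case False
    then show ?thesis using A B by (simp add: bounded_symmetric_form_def)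
  qed
  then show "B = A" by blast
qed

section \<open>Pointwise limits of holomorphic functions\<close>

text \<open>
  Tychonoff's theorem for a product of discs, with the cluster point turned into a limit along a finer
  filter.
\<close>

lemma pointwise_cluster:
  fixes m :: "'i \<Rightarrow> 'x \<Rightarrow> complex"
  assumes F: "F \<noteq> bot" and bound: "\<forall>\<^sub>F i in F. \<forall>x. cmod (m i x) \<le> B x"
  obtains F' q where "F' \<noteq> bot" "F' \<le> F" "\<And>x. ((\<lambda>i. m i x) \<longlongrightarrow> q x) F'"
proof -
  have "compactin (product_topology (\<lambda>_. euclidean) UNIV) (Pi\<^sub>E UNIV (\<lambda>x. cball (0::complex) (B x)))"
    by (subst compactin_PiE) auto
  then have "compact (Pi\<^sub>E UNIV (\<lambda>x. cball (0::complex) (B x)))"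
    by (simp add: euclidean_product_topology)
  moreover have "filtermap m F \<noteq> bot" using F by (simp add: filtermap_bot_iff)
  moreover have "\<forall>\<^sub>F f in filtermap m F. f \<in> Pi\<^sub>E UNIV (\<lambda>x. cball (0::complex) (B x))"
    using bound by (simp add: eventually_filtermap PiE_UNIV_domain Pi_iff)
  ultimately obtain q where q: "inf (nhds q) (filtermap m F) \<noteq> bot"
    unfolding compact_filter by blast
  define F' where "F' = inf F (filtercomap m (nhds q))"
  have "F' \<noteq> bot"
  proof
    assume "F' = bot"
    then obtain P Q where PQ: "eventually P F" "eventually Q (nhds q)" "\<And>i. P i \<Longrightarrow> Q (m i) \<Longrightarrow> False"
      unfolding F'_def trivial_limit_def eventually_inf eventually_filtercomap by metis
    have "eventually (\<lambda>f. \<not> Q f) (filtermap m F)"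
      unfolding eventually_filtermap using PQ(1) by (rule eventually_mono) (use PQ(3) in blast)
    with PQ(2) have "eventually (\<lambda>_. False) (inf (nhds q) (filtermap m F))"
      unfolding eventually_inf by blast
    with q show False by (simp add: trivial_limit_def)
  qed
  moreover have "F' \<le> F" by (simp add: F'_def)
  moreover have "((\<lambda>i. m i x) \<longlongrightarrow> q x) F'" for x
  proof -
    have "filterlim m (nhds q) F'"
      unfolding F'_def filterlim_iff_le_filtercomap by simp
    moreover have "((\<lambda>f :: 'x \<Rightarrow> complex. f x) \<longlongrightarrow> q x) (nhds q)"
    proof (rule topological_tendstoI)
      fix U :: "complex set" assume "open U" "q x \<in> U"
      moreover have "open ((\<lambda>f :: 'x \<Rightarrow> complex. f x) -` U)" if "open U" for U
        using open_vimage[OF that continuous_on_product_coordinates] .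
      ultimately show "\<forall>\<^sub>F f in nhds q. f x \<in> U"
        unfolding eventually_nhds by (intro exI[of _ "(\<lambda>f. f x) -` U"]) auto
    qed
    ultimately show ?thesis by (rule filterlim_compose[rotated])
  qed
  ultimately show ?thesis by (rule that)
qed

text \<open>
  Along a finer filter the derivatives at \<open>x\<close> converge pointwise to some \<open>D\<close>, and the second-order
  remainder estimate, which is uniform, passes to the limit.
\<close>

lemma holomorphic_pointwise_limit:
  fixes g :: "'i \<Rightarrow> 'a::complex_normed_vector \<Rightarrow> complex"
  assumes F: "F \<noteq> bot" and hol: "\<forall>\<^sub>F i in F. holomorphic_on_ball (g i)"
    and bound: "\<And>r. r < 1 \<Longrightarrow> \<exists>M. \<forall>\<^sub>F i in F. \<forall>x\<in>ball 0 r. cmod (g i x) \<le> M"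
    and lim: "\<And>x. x \<in> ball 0 1 \<Longrightarrow> ((\<lambda>i. g i x) \<longlongrightarrow> f x) F"
  shows "holomorphic_on_ball f"
  unfolding holomorphic_on_ball_def
proof
  fix x :: 'a assume x: "x \<in> ball 0 1"
  define \<delta> where "\<delta> = (1 - norm x) / 2"
  have \<delta>: "0 < \<delta>" using x by (simp add: \<delta>_def)
  have r: "norm x + \<delta> < 1" using x by (simp add: \<delta>_def field_simps)
  have sub: "ball x \<delta> \<subseteq> ball 0 (norm x + \<delta>)"
    using dist_triangle[of 0 _ x] by (auto simp: subset_iff) (smt (verit) dist_0_norm dist_commute dist_triangle)
  have sub1: "ball x \<delta> \<subseteq> ball 0 1" using sub r by (smt (verit) subset_ball subset_trans)
  obtain M where "\<forall>\<^sub>F i in F. \<forall>x\<in>ball 0 (norm x + \<delta>). cmod (g i x) \<le> M" using bound[OF r] by blast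
  with hol have good: "\<forall>\<^sub>F i in F. holomorphic_on_ball (g i) \<and> (\<forall>y\<in>ball x \<delta>. cmod (g i y) \<le> M)"
    by eventually_elim (use sub in blast)
  then have dir: "\<forall>\<^sub>F i in F. \<forall>h. cmod (directional h (g i) x) \<le> M / \<delta> * norm h"
    by eventually_elim (intro allI directional_bound sub1 \<delta>; blast)
  obtain F' D where F': "F' \<noteq> bot" "F' \<le> F" and D: "\<And>h. ((\<lambda>i. directional h (g i) x) \<longlongrightarrow> D h) F'"
    using pointwise_cluster[OF F dir] by blast
  note good' = filter_leD[OF F'(2) good]
  have lim': "((\<lambda>i. g i y) \<longlongrightarrow> f y) F'" if "y \<in> ball 0 1" for y
    using tendsto_mono[OF F'(2) lim[OF that]] .
  have bc: "bounded_clinear D"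
    unfolding bounded_clinear_def
  proof (intro conjI clinear_complexI exI allI)
    fix h h' :: 'a and c :: complex
    have "\<forall>\<^sub>F i in F'. directional h (g i) x + directional h' (g i) x = directional (h + h') (g i) x"
      using good' by eventually_elim (use bounded_clinear_directional[OF _ x] in \<open>simp add: bounded_clinear_def clinear_def\<close>)
    from tendsto_cong[THEN iffD1, OF this tendsto_add[OF D D]]
    show "D (h + h') = D h + D h'" using tendsto_unique[OF F'(1) D] by blast
    have "\<forall>\<^sub>F i in F'. c * directional h (g i) x = directional (c *\<^sub>C h) (g i) x"
      using good' by eventually_elim
        (use bounded_clinear_directional[OF _ x] in \<open>simp add: bounded_clinear_def clinear_def scaleC_complex_def\<close>)
    from tendsto_cong[THEN iffD1, OF this tendsto_mult[OF tendsto_const D]]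
    show "D (c *\<^sub>C h) = c * D h" using tendsto_unique[OF F'(1) D] by blast
    have "\<forall>\<^sub>F i in F'. cmod (directional h (g i) x) \<le> norm h * (M / \<delta>)"
      using good' by eventually_elim
        (subst mult.commute, intro directional_bound sub1 \<delta>; blast)
    then show "cmod (D h) \<le> norm h * (M / \<delta>)"
      by (rule tendsto_upperbound[OF tendsto_norm[OF D] _ F'(1)])
  qed
  moreover have "cmod (f (x + h) - f x - D h) \<le> 8 * M / \<delta>\<^sup>2 * (norm h)\<^sup>2" if h: "norm h \<le> \<delta> / 4" for h
  proof (rule tendsto_upperbound[OF tendsto_norm _ F'(1)])
    have "x + h \<in> ball x \<delta>" using h \<delta> by (simp add: dist_norm)
    then have "x + h \<in> ball 0 1" using sub1 by blast
    then show "((\<lambda>i. g i (x + h) - g i x - directional h (g i) x) \<longlongrightarrow> f (x + h) - f x - D h) F'"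
      by (intro tendsto_diff lim' D x)
    show "\<forall>\<^sub>F i in F'. cmod (g i (x + h) - g i x - directional h (g i) x) \<le> 8 * M / \<delta>\<^sup>2 * (norm h)\<^sup>2"
      using good' by eventually_elim (intro second_order_remainder sub1 \<delta> h; blast)
  qed
  ultimately show "\<exists>D. bounded_clinear D \<and> (f has_derivative D) (at x)"
    using \<delta> by (intro exI[of _ D] conjI has_derivative_of_quadratic_remainder[where \<epsilon> = "\<delta> / 4" and C = "8 * M / \<delta>\<^sup>2"])
      (auto simp: bounded_clinear_iff)
qed

section \<open>Approximation in the sense of Davie and Gamelin\<close>

text \<open>
  If the infimum \<open>e\<close> of \<open>E\<close> were positive, a step of length \<open>t\<close> with \<open>8 C t \<le> e\<close> from a point with
  \<open>E\<close> close to \<open>e\<close> would lead below \<open>e\<close>.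
\<close>

lemma descent_reaches_zero:
  fixes E :: "'p \<Rightarrow> real"
  assumes S: "S \<noteq> {}" and nonneg: "\<And>p. p \<in> S \<Longrightarrow> 0 \<le> E p" and t0: "0 < t0"
    and step: "\<And>p t. p \<in> S \<Longrightarrow> 0 < t \<Longrightarrow> t \<le> t0 \<Longrightarrow> \<exists>q\<in>S. E q \<le> (1 - t / 2) * E p + C * t\<^sup>2"
    and \<eta>: "0 < \<eta>"
  obtains p where "p \<in> S" "E p < \<eta>"
proof -
  define e where "e = (INF p\<in>S. E p)"
  have bdd: "bdd_below (E ` S)" using nonneg by (rule bdd_belowI2)
  have low: "e \<le> E p" if "p \<in> S" for p unfolding e_def by (rule cINF_lower[OF bdd that])
  have reach: "\<exists>p\<in>S. E p < m" if "e < m" for m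
    using that S bdd unfolding e_def by (simp add: cINF_less_iff)
  have "e \<le> 0"
  proof (rule ccontr)
    assume "\<not> e \<le> 0"
    then have e: "0 < e" by simp
    define t where "t = min (min t0 1) (e / (8 * (\<bar>C\<bar> + 1)))"
    have t: "0 < t" "t \<le> t0" "t \<le> 1" using t0 e by (auto simp: t_def intro!: divide_pos_pos)
    have "t * (8 * (\<bar>C\<bar> + 1)) \<le> e" by (simp add: t_def pos_le_divide_eq[symmetric])
    moreover have "t * (8 * C) \<le> t * (8 * (\<bar>C\<bar> + 1))" using t by (intro mult_left_mono) auto
    ultimately have Ct: "8 * (C * t) \<le> e" by (simp add: algebra_simps)
    have "e < e * (1 + t / 4)" using e t by simp
    then obtain p where p: "p \<in> S" "E p < e * (1 + t / 4)" using reach by blast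
    obtain q where q: "q \<in> S" "E q \<le> (1 - t / 2) * E p + C * t\<^sup>2" using step[OF p(1) t(1,2)] by blast
    have "e \<le> (1 - t / 2) * (e * (1 + t / 4)) + C * t\<^sup>2"
      using low[OF q(1)] q(2) mult_left_mono[of "E p" "e * (1 + t / 4)" "1 - t / 2"] p(2) t by linarith
    also have "\<dots> = e - t * (e / 4 - C * t) - e * t\<^sup>2 / 8"
      by (simp add: power2_eq_square field_simps)
    also have "\<dots> < e"
    proof -
      have "0 < t * (e / 4 - C * t)" using t Ct e by (intro mult_pos_pos) auto
      moreover have "0 \<le> e * t\<^sup>2 / 8" using e by simp
      ultimately show ?thesis by linarith
    qed
    finally show False by simp
  qed
  then show ?thesis using reach[of \<eta>] \<eta> that by force
qed

text \<open>
  The form \<open>A\<close>, extended to the bidual, at \<open>j\<close> arguments \<open>x\<close> followed by \<open>k - j\<close> arguments \<open>z\<close>. It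
  leads from the extension of \<open>A\<close> on the diagonal at \<open>z\<close>, for \<open>j = 0\<close>, to \<open>A\<close> on the diagonal at \<open>x\<close>,
  for \<open>j = k\<close>.
\<close>

definition mixed_value ::
    "nat \<Rightarrow> ('a::complex_normed_vector list \<Rightarrow> complex) \<Rightarrow> 'a cdual cdual \<Rightarrow> nat \<Rightarrow> 'a \<Rightarrow> complex"
  where "mixed_value k A z j x = AB_form (replicate (k - j) z) (\<lambda>ys. A (replicate j x @ ys))"

definition weight :: "nat \<Rightarrow> real"
  where "weight j = 1 / (2 ^ j * fact j)"

text \<open>
  Measures how far the mixed values at \<open>x\<close> are from the value at \<open>z\<close>. The weights satisfy
  \<open>(j + 1) * weight (j + 1) = weight j / 2\<close>, which makes the energy decrease in \<open>energy_step\<close>.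
\<close>

definition energy :: "nat \<Rightarrow> ('a::complex_normed_vector list \<Rightarrow> complex) \<Rightarrow> 'a cdual cdual \<Rightarrow> 'a \<Rightarrow> real"
  where "energy k A z x =
    (\<Sum>j<k. weight (Suc j) * cmod (mixed_value k A z (Suc j) x - AB_form (replicate k z) A))"

text \<open>
  From \<open>x\<close>, a step of length \<open>t\<close> towards any point \<open>x'\<close> of the unit ball that agrees with \<open>z\<close> on
  suitable finitely many functionals decreases \<open>E\<close> by the factor \<open>1 - t / 2\<close>, up to an error of second
  order. The functionals may depend on \<open>x\<close>; \<open>n\<close> and \<open>C\<close> are parameters so that one choice can serve all
  \<open>x\<close>.
\<close>

definition improvable ::
    "'a::complex_normed_vector cdual cdual \<Rightarrow> ('a \<Rightarrow> real) \<Rightarrow> real \<Rightarrow> real \<Rightarrow> 'a \<Rightarrow> bool"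
  where "improvable z E n C x \<longleftrightarrow> (\<exists>\<Phi>. finite \<Phi> \<and> (\<forall>x' t. norm x' \<le> 1 \<longrightarrow>
      (\<forall>\<phi>\<in>\<Phi>. cdual_apply \<phi> x' = cdual_apply z \<phi>) \<longrightarrow> 0 < t \<longrightarrow> n * t \<le> 1 \<longrightarrow>
      E (x + t *\<^sub>R (x' - x)) \<le> (1 - t / 2) * E x + C * t\<^sup>2))"

lemma weight_pos: "0 < weight j"
  by (simp add: weight_def)

lemma weight_antimono: "i \<le> j \<Longrightarrow> weight j \<le> weight i"
  unfolding weight_def by (intro divide_left_mono mult_mono power_increasing fact_mono) auto

lemma weight_Suc: "weight (Suc j) * real (Suc j) = weight j / 2"
  by (simp add: weight_def divide_simps del: of_nat_Suc)

lemma energy_nonneg: "0 \<le> energy k A z x"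
  unfolding energy_def by (intro sum_nonneg mult_nonneg_nonneg) (auto intro: less_imp_le weight_pos)

lemma energy_controls_diagonal:
  "weight k * cmod (A (replicate k x) - AB_form (replicate k z) A) \<le> energy k A z x"
proof (cases k)
  case (Suc n)
  have "weight (Suc n) * cmod (mixed_value k A z (Suc n) x - AB_form (replicate k z) A) \<le> energy k A z x"
    unfolding energy_def
    by (intro member_le_sum mult_nonneg_nonneg less_imp_le[OF weight_pos]) (use Suc in auto)
  then show ?thesis by (simp add: mixed_value_def Suc)
qed (simp add: energy_def)

text \<open>
  Let \<open>b j\<close> be the mixed values at \<open>x\<close>. The functionals are \<open>v \<mapsto> A(v, x, \<dots>, x, z, \<dots>, z)\<close> with
  \<open>j\<close> arguments \<open>x\<close>, and at \<open>z\<close> they take the value \<open>b j\<close>. If \<open>x'\<close> agrees with \<open>z\<close> on them, then the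
  derivative of \<open>b (j + 1)\<close> at \<open>x\<close> in the direction \<open>x' - x\<close> is \<open>(j + 1) (b j - b (j + 1))\<close>. So a
  step of length \<open>t\<close> replaces the distance \<open>e (j + 1)\<close> of \<open>b (j + 1)\<close> from \<open>b 0\<close> by at most
  \<open>(1 - (j + 1) t) e (j + 1) + (j + 1) t e j + O(t\<^sup>2)\<close>. With the weights of \<open>energy\<close> the terms
  \<open>(j + 1) t e j\<close> sum to at most half of what the factors \<open>1 - (j + 1) t\<close> gain.
\<close>

lemma energy_step:
  fixes A :: "'a::complex_normed_vector list \<Rightarrow> complex"
  assumes A: "mform k M A" and sym: "symmetric_list_fun k A"
  obtains C where "\<And>x. norm x \<le> 1 \<Longrightarrow> improvable z (energy k A z) (real k) C x"
proof -
  define B where "B j xs = AB_form (replicate (k - j) z) (\<lambda>ys. A (xs @ ys))" for j xs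
  define N where "N j = M * (\<Prod>z\<leftarrow>replicate (k - j) z. norm z)" for j
  have B: "mform j (N j) (B j)" if "j \<le> k" for j
    unfolding B_def N_def by (rule AB_form_partial_mform) (use A that in simp)
  have Bsym: "symmetric_list_fun j (B j)" if "j \<le> k" for j
    unfolding symmetric_list_fun_def B_def
    by (intro allI impI AB_form_cong symmetric_list_funD[OF sym]) (use that in simp_all)
  have mixed: "mixed_value k A z j x = B j (replicate j x)" for j x
    by (simp add: mixed_value_def B_def)
  define c where "c = AB_form (replicate k z) A"
  have mixed0: "mixed_value k A z 0 x = c" for x by (simp add: mixed_value_def c_def)
  define K where "K j = N (Suc j) * 8 ^ Suc j * 4" for j
  define C where "C = (\<Sum>j<k. weight (Suc j) * K j)"
  have "improvable z (energy k A z) (real k) C x" if x: "norm x \<le> 1" for x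
  proof -
    define \<phi> where "\<phi> j = Cdual (\<lambda>v. B (Suc j) (v # replicate j x))" for j
    have \<phi>_apply: "cdual_apply (\<phi> j) v = B (Suc j) (v # replicate j x)" if "j < k" for j v
    proof -
      have "cmod (B (Suc j) (v # replicate j x)) \<le> (N (Suc j) * norm x ^ j) * norm v" for v
        using mform_bound[OF B, of "Suc j" "v # replicate j x"] that
        by (simp add: prod_list_replicate_norm mult_ac)
      moreover have "clinear (\<lambda>v. B (Suc j) (v # replicate j x))"
        using that by (intro mform_head_clinear[OF B]) auto
      ultimately show ?thesis unfolding \<phi>_def by (intro cdual_apply_Cdual)
    qed
    have \<phi>_z: "cdual_apply z (\<phi> j) = mixed_value k A z j x" if j: "j < k" for j
    proof -
      \<comment> \<open>The outermost of the \<open>k - j\<close> limits evaluates \<open>z\<close> at the functional \<open>\<phi> j\<close>.\<close>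
      have "k - j = Suc (k - Suc j)" using j by simp
      then have "mixed_value k A z j x
          = AB_form (z # replicate (k - Suc j) z) (\<lambda>ys. A (replicate j x @ ys))"
        by (simp add: mixed_value_def)
      also have "\<dots> = cdual_apply z (Cdual (\<lambda>v. AB_form (replicate (k - Suc j) z) (\<lambda>ys. A (replicate j x @ v # ys))))"
      proof (rule AB_form_Cons)
        show "mform (Suc (length (replicate (k - Suc j) z))) (M * (\<Prod>u\<leftarrow>replicate j x. norm u))
            (\<lambda>ys. A (replicate j x @ ys))"
          by (rule mform_append) (use A j in simp)
      qed
      also have "(\<lambda>v. AB_form (replicate (k - Suc j) z) (\<lambda>ys. A (replicate j x @ v # ys)))
          = (\<lambda>v. B (Suc j) (v # replicate j x))"
        unfolding B_def
        by (intro ext AB_form_cong symmetric_list_funD[OF sym]) (use j in simp_all)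
      finally show ?thesis by (simp add: \<phi>_def)
    qed
    have "energy k A z (x + t *\<^sub>R (x' - x)) \<le> (1 - t / 2) * energy k A z x + C * t\<^sup>2"
      if x': "norm x' \<le> 1" and interp: "\<forall>\<psi>\<in>\<phi> ` {..<k}. cdual_apply \<psi> x' = cdual_apply z \<psi>"
        and t: "0 < t" "real k * t \<le> 1" for x' t
    proof -
      define e where "e j = cmod (mixed_value k A z j x - c)" for j
      have e0: "e 0 = 0" by (simp add: e_def mixed0)
      have en: "energy k A z x = (\<Sum>j<k. weight (Suc j) * e (Suc j))"
        by (simp add: energy_def e_def c_def)
      have each: "cmod (mixed_value k A z (Suc j) (x + t *\<^sub>R (x' - x)) - c)
          \<le> (1 - real (Suc j) * t) * e (Suc j) + real (Suc j) * t * e j + K j * t\<^sup>2" if j: "j < k" for j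
      proof -
        define u where "u = t *\<^sub>R (x' - x)"
        have "real 1 * t \<le> real k * t" using j t by (intro mult_right_mono) auto
        then have t1: "t \<le> 1" using t(2) unfolding of_nat_1 mult_1_left by (rule order_trans)
        have "norm (x' - x) \<le> 2" using norm_triangle_ineq4[of x' x] x x' by linarith
        then have nu: "norm u \<le> 2 * t" using t by (simp add: u_def mult_left_mono mult.commute)
        have "real (Suc j) * t \<le> real k * t" using j t by (intro mult_right_mono) auto
        then have jt: "real (Suc j) * t \<le> 1" using t by linarith
        let ?m = "mixed_value k A z"
        let ?D = "diagonal_derivative (Suc j) (B (Suc j)) x u"
        have "?D = of_nat (Suc j) * B (Suc j) (u # replicate j x)"
          using j by (intro diagonal_derivative_symmetric Bsym) auto
        also have "B (Suc j) (u # replicate j x) = cdual_apply (\<phi> j) u" using j by (simp add: \<phi>_apply)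
        also have "\<dots> = of_real t * (cdual_apply (\<phi> j) x' - cdual_apply (\<phi> j) x)"
          by (simp add: u_def cdual_apply_scaleR cdual_apply_diff scaleR_conv_of_real)
        also have "cdual_apply (\<phi> j) x' = ?m j x" using interp j \<phi>_z by simp
        also have "cdual_apply (\<phi> j) x = ?m (Suc j) x" using j by (simp add: \<phi>_apply mixed)
        finally have D: "?D = of_real (real (Suc j) * t) * (?m j x - ?m (Suc j) x)"
          by (simp add: mult.assoc)
        have "cmod (B (Suc j) (replicate (Suc j) (x + u)) - B (Suc j) (replicate (Suc j) x) - ?D)
            \<le> N (Suc j) * (4 * 2) ^ Suc j * (norm u)\<^sup>2"
          using diagonal_expansion[of x 2 u "Suc j" "N (Suc j)" "B (Suc j)"] B j x nu t1 by auto
        also have "\<dots> \<le> N (Suc j) * (4 * 2) ^ Suc j * (2 * t)\<^sup>2"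
          using nu mform_nonneg[OF B, of "Suc j"] j by (intro mult_left_mono power_mono) auto
        also have "\<dots> = K j * t\<^sup>2" by (simp add: K_def power_mult_distrib)
        finally have rem: "cmod (?m (Suc j) (x + u) - ?m (Suc j) x - ?D) \<le> K j * t\<^sup>2"
          by (simp only: mixed)
        define s where "s = real (Suc j) * t"
        have s: "0 \<le> s" "s \<le> 1" using jt t by (simp_all add: s_def)
        have split: "?m (Suc j) (x + u) - c = of_real (1 - s) * (?m (Suc j) x - c)
            + of_real s * (?m j x - c) + (?m (Suc j) (x + u) - ?m (Suc j) x - ?D)"
          unfolding D s_def[symmetric] by (simp add: algebra_simps)
        have "cmod (?m (Suc j) (x + u) - c) \<le> cmod (of_real (1 - s) * (?m (Suc j) x - c))
            + cmod (of_real s * (?m j x - c)) + cmod (?m (Suc j) (x + u) - ?m (Suc j) x - ?D)"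
          by (subst split) (intro order_trans[OF norm_triangle_ineq] add_right_mono norm_triangle_ineq)
        also have "\<dots> \<le> (1 - s) * e (Suc j) + s * e j + K j * t\<^sup>2"
          unfolding norm_mult norm_of_real e_def using s rem by simp
        finally show ?thesis by (simp only: u_def s_def)
      qed
      have "energy k A z (x + t *\<^sub>R (x' - x))
          \<le> (\<Sum>j<k. weight (Suc j) * ((1 - real (Suc j) * t) * e (Suc j) + real (Suc j) * t * e j + K j * t\<^sup>2))"
        unfolding energy_def c_def[symmetric]
        by (intro sum_mono mult_left_mono each less_imp_le[OF weight_pos]) simp
      also have "\<dots> \<le> (\<Sum>j<k. (1 - t) * (weight (Suc j) * e (Suc j)) + t / 2 * (weight j * e j)
          + weight (Suc j) * K j * t\<^sup>2)"
      proof (rule sum_mono)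
        fix j
        have "weight (Suc j) * (real (Suc j) * t * e j) = (weight (Suc j) * real (Suc j)) * t * e j"
          by (simp add: mult_ac)
        then have "weight (Suc j) * (real (Suc j) * t * e j) = t / 2 * (weight j * e j)"
          unfolding weight_Suc by (simp add: mult_ac)
        moreover have "weight (Suc j) * ((1 - real (Suc j) * t) * e (Suc j)) \<le> (1 - t) * (weight (Suc j) * e (Suc j))"
        proof -
          have "1 * t \<le> real (Suc j) * t" using t by (intro mult_right_mono) auto
          then have "(1 - real (Suc j) * t) * (weight (Suc j) * e (Suc j)) \<le> (1 - t) * (weight (Suc j) * e (Suc j))"
            using less_imp_le[OF weight_pos[of "Suc j"]] by (intro mult_right_mono) (auto simp: e_def)
          then show ?thesis by (simp add: mult_ac)
        qed
        ultimately show "weight (Suc j) * ((1 - real (Suc j) * t) * e (Suc j) + real (Suc j) * t * e j + K j * t\<^sup>2)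
            \<le> (1 - t) * (weight (Suc j) * e (Suc j)) + t / 2 * (weight j * e j) + weight (Suc j) * K j * t\<^sup>2"
          unfolding distrib_left mult.assoc[of "weight (Suc j)" "K j"] by linarith
      qed
      also have "\<dots> = (1 - t) * energy k A z x + t / 2 * (\<Sum>j<k. weight j * e j) + C * t\<^sup>2"
        by (simp add: en C_def sum.distrib sum_distrib_left sum_distrib_right)
      also have "(\<Sum>j<k. weight j * e j) \<le> energy k A z x"
      proof -
        have "(\<Sum>j<k. weight j * e j) \<le> (\<Sum>j<Suc k. weight j * e j)"
          using less_imp_le[OF weight_pos] by (simp add: e_def)
        also have "\<dots> = energy k A z x"
          unfolding sum.lessThan_Suc_shift by (simp add: e0 en)
        finally show ?thesis .
      qed
      finally show ?thesis using t by (simp add: algebra_simps)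
    qed
    then show ?thesis unfolding improvable_def by (intro exI[of _ "\<phi> ` {..<k}"]) auto
  qed
  then show ?thesis by (rule that)
qed

lemma improvable_sum:
  fixes z :: "'a::complex_normed_vector cdual cdual" and k :: "'i \<Rightarrow> nat"
  assumes I: "finite I" and imp: "\<And>i. i \<in> I \<Longrightarrow> improvable z (E i) (real (k i)) (C i) x"
  shows "improvable z (\<lambda>x. \<Sum>i\<in>I. E i x) (real (\<Sum>i\<in>I. k i)) (\<Sum>i\<in>I. C i) x"
proof -
  from imp obtain \<Phi> where \<Phi>: "\<And>i. i \<in> I \<Longrightarrow> finite (\<Phi> i)"
    "\<And>i x' t. i \<in> I \<Longrightarrow> norm x' \<le> 1 \<Longrightarrow> (\<forall>\<phi>\<in>\<Phi> i. cdual_apply \<phi> x' = cdual_apply z \<phi>) \<Longrightarrow> 0 < t \<Longrightarrow>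
      real (k i) * t \<le> 1 \<Longrightarrow> E i (x + t *\<^sub>R (x' - x)) \<le> (1 - t / 2) * E i x + C i * t\<^sup>2"
    unfolding improvable_def by metis
  have "(\<Sum>i\<in>I. E i (x + t *\<^sub>R (x' - x))) \<le> (1 - t / 2) * (\<Sum>i\<in>I. E i x) + (\<Sum>i\<in>I. C i) * t\<^sup>2"
    if x': "norm x' \<le> 1" "\<forall>\<phi>\<in>(\<Union>i\<in>I. \<Phi> i). cdual_apply \<phi> x' = cdual_apply z \<phi>"
      and t: "0 < t" "real (\<Sum>i\<in>I. k i) * t \<le> 1" for x' t
  proof -
    have "real (k i) * t \<le> 1" if "i \<in> I" for i
    proof -
      have "k i \<le> (\<Sum>i\<in>I. k i)" using I that by (intro member_le_sum) auto
      then have "real (k i) * t \<le> real (\<Sum>i\<in>I. k i) * t" using t by (intro mult_right_mono) linarith+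
      with t show ?thesis by linarith
    qed
    then have "(\<Sum>i\<in>I. E i (x + t *\<^sub>R (x' - x))) \<le> (\<Sum>i\<in>I. (1 - t / 2) * E i x + C i * t\<^sup>2)"
      using x' t by (intro sum_mono \<Phi>(2)) auto
    then show ?thesis by (simp add: sum.distrib sum_distrib_left sum_distrib_right)
  qed
  then show ?thesis
    using \<Phi>(1) I unfolding improvable_def by (intro exI[of _ "\<Union>i\<in>I. \<Phi> i"]) blast
qed

lemma goldstine_pair:
  fixes z w :: "'a::complex_normed_vector cdual cdual"
  assumes "norm z < r" "norm w < r" "norm (z - w) < d" "finite \<Phi>" "finite \<Psi>"
  obtains x y where "norm x < r" "norm y < r" "norm (x - y) < d"
    "\<And>\<phi>. \<phi> \<in> \<Phi> \<Longrightarrow> cdual_apply \<phi> x = cdual_apply z \<phi>" "\<And>\<phi>. \<phi> \<in> \<Psi> \<Longrightarrow> cdual_apply \<phi> y = cdual_apply w \<phi>"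
proof -
  define c :: "nat \<Rightarrow> bool \<Rightarrow> complex"
    where "c j b = (if j = 0 then of_bool b else if j = 1 then of_bool (\<not> b) else if b then 1 else - 1)" for j b
  have neg: "- 1 *\<^sub>C v = - v" for v :: "'b::complex_normed_vector"
    using scaleR_scaleC[of "- 1" v] by simp
  have zero: "0 *\<^sub>C v = 0" for v :: "'b::complex_normed_vector"
    by (rule complex_vector.scale_zero_left)
  have sum: "(\<Sum>b\<in>UNIV. c j b *\<^sub>C v b) = (if j = 0 then v True else if j = 1 then v False else v True - v False)"
    for v :: "bool \<Rightarrow> 'b::complex_normed_vector" and j
    by (auto simp: UNIV_bool c_def neg zero)
  obtain v :: "bool \<Rightarrow> 'a" where v:
    "\<And>j. j \<in> {0, 1, 2::nat} \<Longrightarrow> norm (\<Sum>b\<in>UNIV. c j b *\<^sub>C v b) < (if j = 2 then d else r)"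
    "\<And>b \<phi>. b \<in> UNIV \<Longrightarrow> \<phi> \<in> \<Phi> \<union> \<Psi> \<Longrightarrow> cdual_apply \<phi> (v b) = cdual_apply (if b then z else w) \<phi>"
  proof (rule goldstine_helly[of "{0, 1, 2::nat}" "UNIV :: bool set" "\<Phi> \<union> \<Psi>" c "\<lambda>b. if b then z else w" "\<lambda>j. if j = 2 then d else r"])
    fix j :: nat assume "j \<in> {0, 1, 2}"
    then show "norm (\<Sum>b\<in>UNIV. c j b *\<^sub>C (if b then z else w)) < (if j = 2 then d else r)"
      using assms unfolding sum by auto
  qed (use assms in auto)
  show ?thesis
    by (rule that[of "v True" "v False"])
      (use v(1)[of 0] v(1)[of 1] v(1)[of 2] v(2)[of True] v(2)[of False] in \<open>auto simp: sum\<close>)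
qed

text \<open>
  Descent for the total energy of the pair over the convex set of all pairs that satisfy the three
  norm bounds; \<open>goldstine_pair\<close> supplies the points to move to.
\<close>

theorem davie_gamelin:
  fixes A :: "'i \<Rightarrow> 'a::complex_normed_vector list \<Rightarrow> complex"
  assumes I: "finite I"
    and A: "\<And>i. i \<in> I \<Longrightarrow> mform (k i) (M i) (A i)" "\<And>i. i \<in> I \<Longrightarrow> symmetric_list_fun (k i) (A i)"
    and zw: "norm z < r" "norm w < r" "norm (z - w) < d" and r: "r \<le> 1" and \<epsilon>: "0 < \<epsilon>"
  obtains x y where "norm x < r" "norm y < r" "norm (x - y) < d"
    "\<And>i. i \<in> I \<Longrightarrow> cmod (A i (replicate (k i) x) - AB_form (replicate (k i) z) (A i)) < \<epsilon>"
    "\<And>i. i \<in> I \<Longrightarrow> cmod (A i (replicate (k i) y) - AB_form (replicate (k i) w) (A i)) < \<epsilon>"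
proof -
  define E where "E z x = (\<Sum>i\<in>I. energy (k i) (A i) z x)" for z x
  define n where "n = (\<Sum>i\<in>I. k i)"
  have step: "\<exists>C. \<forall>x. norm x \<le> 1 \<longrightarrow> improvable z (E z) n C x" for z
  proof -
    have "\<exists>C. \<forall>x. norm x \<le> 1 \<longrightarrow> improvable z (energy (k i) (A i) z) (k i) C x" if "i \<in> I" for i
      using energy_step[OF A(1)[OF that] A(2)[OF that], of z] by metis
    then obtain C where "\<And>i x. i \<in> I \<Longrightarrow> norm x \<le> 1 \<Longrightarrow> improvable z (energy (k i) (A i) z) (k i) (C i) x"
      by metis
    then show ?thesis
      unfolding E_def n_def by (intro exI[of _ "\<Sum>i\<in>I. C i"] allI impI improvable_sum I)
  qed
  obtain C C' where C: "\<forall>x. norm x \<le> 1 \<longrightarrow> improvable z (E z) n C x"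
    and C': "\<forall>x. norm x \<le> 1 \<longrightarrow> improvable w (E w) n C' x"
    using step by blast
  have E_nonneg: "0 \<le> E z x" for z x unfolding E_def by (intro sum_nonneg energy_nonneg)
  define S where "S = {(x :: 'a, y). norm x < r \<and> norm y < r \<and> norm (x - y) < d}"
  have convex_less: "norm (x + t *\<^sub>R (x' - x)) < \<rho>"
    if "norm x < \<rho>" "norm x' < \<rho>" "0 \<le> t" "t \<le> 1" for x x' :: 'a and t \<rho> :: real
  proof -
    have "x + t *\<^sub>R (x' - x) \<in> ball 0 \<rho>"
      using convexD_alt[OF convex_ball, of x 0 \<rho> x' t] that by (simp add: algebra_simps)
    then show ?thesis by simp
  qed
  obtain p where p: "p \<in> S" "E z (fst p) + E w (snd p) < \<epsilon> * weight n"
  proof (rule descent_reaches_zero[of S "\<lambda>p. E z (fst p) + E w (snd p)" "1 / (real n + 1)" "C + C'"])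
    show "S \<noteq> {}"
      using goldstine_pair[OF zw finite.emptyI finite.emptyI] by (auto simp: S_def) blast
    fix p t assume "p \<in> S" and t: "0 < t" "t \<le> 1 / (real n + 1)"
    then obtain x y where p: "p = (x, y)" "norm x < r" "norm y < r" "norm (x - y) < d"
      by (auto simp: S_def)
    have "t * (real n + 1) \<le> 1" using t(2) by (simp add: pos_le_divide_eq add_nonneg_pos)
    then have "t * real n + t \<le> 1" by (simp add: distrib_left)
    moreover have "0 \<le> t * real n" using t(1) by simp
    ultimately have "t * real n \<le> 1" "t \<le> 1" using t(1) by linarith+
    then have nt: "real n * t \<le> 1" "t \<le> 1" by (simp_all add: mult.commute)
    obtain \<Phi> where \<Phi>: "finite \<Phi>" "\<And>x' t. norm x' \<le> 1 \<Longrightarrow>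
        (\<forall>\<phi>\<in>\<Phi>. cdual_apply \<phi> x' = cdual_apply z \<phi>) \<Longrightarrow> 0 < t \<Longrightarrow> real n * t \<le> 1 \<Longrightarrow>
        E z (x + t *\<^sub>R (x' - x)) \<le> (1 - t / 2) * E z x + C * t\<^sup>2"
      using C[rule_format, of x] p r unfolding improvable_def by (meson less_imp_le order_trans)
    obtain \<Psi> where \<Psi>: "finite \<Psi>" "\<And>x' t. norm x' \<le> 1 \<Longrightarrow>
        (\<forall>\<phi>\<in>\<Psi>. cdual_apply \<phi> x' = cdual_apply w \<phi>) \<Longrightarrow> 0 < t \<Longrightarrow> real n * t \<le> 1 \<Longrightarrow>
        E w (y + t *\<^sub>R (x' - y)) \<le> (1 - t / 2) * E w y + C' * t\<^sup>2"
      using C'[rule_format, of y] p r unfolding improvable_def by (meson less_imp_le order_trans)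
    obtain x' y' where xy: "norm x' < r" "norm y' < r" "norm (x' - y') < d"
      "\<And>\<phi>. \<phi> \<in> \<Phi> \<Longrightarrow> cdual_apply \<phi> x' = cdual_apply z \<phi>"
      "\<And>\<phi>. \<phi> \<in> \<Psi> \<Longrightarrow> cdual_apply \<phi> y' = cdual_apply w \<phi>"
      using goldstine_pair[OF zw \<Phi>(1) \<Psi>(1)] by blast
    define q where "q = (x + t *\<^sub>R (x' - x), y + t *\<^sub>R (y' - y))"
    have diff: "(x + t *\<^sub>R (x' - x)) - (y + t *\<^sub>R (y' - y)) = (x - y) + t *\<^sub>R ((x' - y') - (x - y))"
      by (simp add: algebra_simps)
    have "norm (x + t *\<^sub>R (x' - x)) < r" "norm (y + t *\<^sub>R (y' - y)) < r"
      "norm ((x + t *\<^sub>R (x' - x)) - (y + t *\<^sub>R (y' - y))) < d"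
      unfolding diff by (intro convex_less p xy less_imp_le[OF t(1)] nt)+
    then have "q \<in> S" by (simp add: S_def q_def)
    moreover have "E z (fst q) + E w (snd q) \<le> (1 - t / 2) * (E z (fst p) + E w (snd p)) + (C + C') * t\<^sup>2"
      using \<Phi>(2)[of x' t] \<Psi>(2)[of y' t] xy r t nt by (simp add: q_def p(1) algebra_simps)
    ultimately show "\<exists>q\<in>S. E z (fst q) + E w (snd q) \<le> (1 - t / 2) * (E z (fst p) + E w (snd p)) + (C + C') * t\<^sup>2"
      by blast
  next
    show "0 < \<epsilon> * weight n" using \<epsilon> weight_pos by simp
  qed (use E_nonneg in \<open>auto intro: add_nonneg_nonneg\<close>)
  have diag: "cmod (A i (replicate (k i) x) - AB_form (replicate (k i) v) (A i)) < \<epsilon>"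
    if i: "i \<in> I" and small: "E v x < \<epsilon> * weight n" for i v x
  proof -
    have "weight n \<le> weight (k i)"
      unfolding n_def using I i by (intro weight_antimono member_le_sum) auto
    then have "weight n * cmod (A i (replicate (k i) x) - AB_form (replicate (k i) v) (A i))
        \<le> weight (k i) * cmod (A i (replicate (k i) x) - AB_form (replicate (k i) v) (A i))"
      by (rule mult_right_mono) simp
    also have "\<dots> \<le> energy (k i) (A i) v x" by (rule energy_controls_diagonal)
    also have "\<dots> \<le> E v x" unfolding E_def using I i by (intro member_le_sum energy_nonneg) auto
    also note small
    finally show ?thesis using weight_pos[of n] by (simp add: mult.commute)
  qed
  obtain x y where "p = (x, y)" by fastforce
  moreover from this have "E z x < \<epsilon> * weight n" "E w y < \<epsilon> * weight n"
    using p(2) E_nonneg[of z x] E_nonneg[of w y] by auto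
  ultimately show ?thesis using p(1) diag by (intro that[of x y]) (auto simp: S_def)
qed

section \<open>The Aron-Berner extension of a Lipschitz function\<close>

lemma hl0_apply_facts:
  shows hl0_holomorphic: "holomorphic_on_ball (hl0_apply f)"
    and hl0_lipschitz: "(norm f)-lipschitz_on (ball 0 1) (hl0_apply f)"
    and hl0_apply_zero: "hl0_apply f 0 = 0"
    and hl0_apply_off_ball: "x \<notin> ball 0 1 \<Longrightarrow> hl0_apply f x = 0"
proof -
  have f: "holomorphic_on_ball (hl0_apply f) \<and> (\<exists>C. C-lipschitz_on (ball 0 1) (hl0_apply f)) \<and>
      hl0_apply f 0 = 0 \<and> (\<forall>x. x \<notin> ball 0 1 \<longrightarrow> hl0_apply f x = 0)"
    using hl0_apply[of f] by simp
  then show "holomorphic_on_ball (hl0_apply f)" "hl0_apply f 0 = 0"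
    "x \<notin> ball 0 1 \<Longrightarrow> hl0_apply f x = 0" by blast+
  show "(norm f)-lipschitz_on (ball 0 1) (hl0_apply f)"
    using f lipschitz_on_lipschitz_const unfolding norm_hl0.rep_eq by blast
qed

lemma hl0_dist: "x \<in> ball 0 1 \<Longrightarrow> y \<in> ball 0 1 \<Longrightarrow> cmod (hl0_apply f x - hl0_apply f y) \<le> norm f * norm (x - y)"
  using lipschitz_onD[OF hl0_lipschitz] by (metis dist_norm)

lemma hl0_bound:
  assumes "x \<in> ball 0 1"
  shows "cmod (hl0_apply f x) \<le> norm f"
proof -
  have "cmod (hl0_apply f x) \<le> norm f * norm x"
    using hl0_dist[of x 0 f] assms by (simp add: hl0_apply_zero)
  also have "\<dots> \<le> norm f * 1" using assms by (intro mult_left_mono) auto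
  finally show ?thesis by simp
qed

lemma HL0_of_lipschitz:
  assumes "holomorphic_on_ball g" "C-lipschitz_on (ball 0 1) g" "g 0 = 0" "\<And>x. x \<notin> ball 0 1 \<Longrightarrow> g x = 0"
  shows hl0_apply_HL0: "hl0_apply (HL0 g) = g" and norm_HL0_le: "norm (HL0 g) \<le> C"
proof -
  show eq: "hl0_apply (HL0 g) = g" using assms by (intro HL0_inverse) auto
  show "norm (HL0 g) \<le> C" unfolding norm_hl0.rep_eq eq by (rule lipschitz_const_le[OF assms(2)])
qed

text \<open>
  At points of the space every limit is an evaluation.
\<close>

lemma AB_form_embed: "mform (length xs) M A \<Longrightarrow> AB_form (map bidual_embed xs) A = A xs"
proof (induction xs arbitrary: M A)
  case (Cons x xs)
  have A: "mform (Suc (length (map bidual_embed xs))) M A" using Cons.prems by simp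
  have "AB_form (map bidual_embed (x # xs)) A = AB_form (map bidual_embed xs) (\<lambda>xs. A (x # xs))"
    using AB_form_Cons[OF A] by (simp add: bidual_embed_apply Cdual_inverse del: AB_form.simps)
  also have "\<dots> = A (x # xs)"
    using mform_Cons[of "length xs" M A x] Cons.prems by (intro Cons.IH) simp
  finally show ?case .
qed simp

lemma norm_diff_partial_sum_le:
  fixes a :: "nat \<Rightarrow> complex"
  assumes a: "a sums s" and le: "\<And>k. cmod (a k) \<le> M * r ^ k" and r: "0 < r" "r < 1"
  shows "cmod (s - (\<Sum>k<N. a k)) \<le> M * r ^ N / (1 - r)"
proof -
  have geo: "(\<lambda>k. M * r ^ N * r ^ k) sums (M * r ^ N * (1 / (1 - r)))"
    using r by (intro sums_mult geometric_sums) auto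
  have "(\<lambda>k. a (k + N)) sums (s - (\<Sum>k<N. a k))"
    using a by (rule sums_split_initial_segment)
  then have "s - (\<Sum>k<N. a k) = (\<Sum>k. a (k + N))" by (simp add: sums_iff)
  also have "cmod \<dots> \<le> (\<Sum>k. M * r ^ N * r ^ k)"
    using le[of "_ + N"] geo
    by (intro norm_suminf_le) (auto simp: power_add mult_ac dest: sums_summable)
  also have "\<dots> = M * r ^ N / (1 - r)" using geo by (simp add: sums_iff)
  finally show ?thesis .
qed

context
  fixes f :: "'a::complex_normed_vector \<Rightarrow> complex" and M :: real
  assumes hol: "holomorphic_on_ball f" and M: "\<And>x. x \<in> ball 0 1 \<Longrightarrow> cmod (f x) \<le> M"
begin

lemma taylor_diag: "taylor_form k f (replicate k x) = taylor_poly k f x"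
  by (rule taylor_form_diag[OF hol M])

lemma AB_poly_taylor_poly: "AB_poly k (taylor_poly k f) z = AB_form (replicate k z) (taylor_form k f)"
  unfolding AB_poly_def
  by (subst symmetric_form_of_eq[OF bounded_symmetric_taylor_form[OF hol M]]) (simp_all add: taylor_diag)

lemma taylor_form_mform:
  obtains N where "mform k N (taylor_form k f)" "symmetric_list_fun k (taylor_form k f)"
  using bounded_symmetric_formD[OF bounded_symmetric_taylor_form[OF hol M]] .

lemma AB_poly_approximation:
  fixes z w :: "'a cdual cdual"
  assumes zw: "norm z < r" "norm w < r" "norm (z - w) < d" and r: "r \<le> 1" and \<epsilon>: "0 < \<epsilon>"
  obtains x y where "norm x < r" "norm y < r" "norm (x - y) < d"
    "\<And>k. k < (n::nat) \<Longrightarrow> cmod (taylor_poly k f x - AB_poly k (taylor_poly k f) z) < \<epsilon>"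
    "\<And>k. k < n \<Longrightarrow> cmod (taylor_poly k f y - AB_poly k (taylor_poly k f) w) < \<epsilon>"
proof -
  have "\<forall>k. \<exists>N. mform k N (taylor_form k f) \<and> symmetric_list_fun k (taylor_form k f)"
    using taylor_form_mform by blast
  then obtain N where N: "\<And>k. mform k (N k) (taylor_form k f)" "\<And>k. symmetric_list_fun k (taylor_form k f)"
    by metis
  obtain x y where "norm x < r" "norm y < r" "norm (x - y) < d"
    "\<And>k. k \<in> {..<n} \<Longrightarrow> cmod (taylor_form k f (replicate k x) - AB_form (replicate k z) (taylor_form k f)) < \<epsilon>"
    "\<And>k. k \<in> {..<n} \<Longrightarrow> cmod (taylor_form k f (replicate k y) - AB_form (replicate k w) (taylor_form k f)) < \<epsilon>"
    using davie_gamelin[of "{..<n}" "\<lambda>k. k" N "\<lambda>k. taylor_form k f", OF finite_lessThan N zw r \<epsilon>] by blast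
  then show ?thesis
    by (intro that[of x y]) (simp_all add: AB_poly_taylor_poly taylor_diag)
qed

text \<open>
  Passing to the bidual does not increase the norm of a Taylor polynomial, by approximation from the
  space.
\<close>

lemma AB_poly_bound:
  assumes "norm z < r" "r \<le> 1"
  shows "cmod (AB_poly k (taylor_poly k f) z) \<le> M * r ^ k"
proof (rule field_le_epsilon)
  fix \<epsilon> :: real assume \<epsilon>: "0 < \<epsilon>"
  obtain x where x: "norm x < r" "cmod (taylor_poly k f x - AB_poly k (taylor_poly k f) z) < \<epsilon>"
    using AB_poly_approximation[where z = z and w = z and r = r and d = 1 and n = "Suc k" and \<epsilon> = \<epsilon>] assms \<epsilon>
    by (metis diff_self lessI norm_zero zero_less_one)
  have "0 < r" using assms(1) norm_ge_zero by (rule le_less_trans[rotated])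
  then have "cmod (taylor_poly k f x) \<le> M * r ^ k"
    using x(1) by (intro taylor_poly_bound[OF hol M]) auto
  with x(2) show "cmod (AB_poly k (taylor_poly k f) z) \<le> M * r ^ k + \<epsilon>"
    using norm_triangle_sub[of "AB_poly k (taylor_poly k f) z" "taylor_poly k f x"]
    by (simp add: norm_minus_commute)
qed

lemma AB_fun_sums:
  assumes z: "z \<in> ball 0 1"
  shows "(\<lambda>k. AB_poly k (taylor_poly k f) z) sums AB_fun f z"
proof -
  obtain r where r: "norm z < r" "r < 1" using z dense[of "norm z" 1] by auto
  have "0 < r" using r(1) norm_ge_zero by (rule le_less_trans[rotated])
  then have "summable (\<lambda>k. M * r ^ k)" using r by (intro summable_mult summable_geometric) auto
  then have "summable (\<lambda>k. AB_poly k (taylor_poly k f) z)"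
    by (rule summable_comparison_test') (use AB_poly_bound[of z r] r in auto)
  then show ?thesis using z by (simp add: AB_fun_def summable_sums)
qed

lemma AB_fun_embed:
  assumes x: "x \<in> ball 0 1"
  shows "AB_fun f (bidual_embed x) = f x"
proof -
  have "AB_poly k (taylor_poly k f) (bidual_embed x) = taylor_poly k f x" for k
  proof -
    obtain N where "mform k N (taylor_form k f)" using taylor_form_mform .
    then show ?thesis
      using AB_form_embed[of "replicate k x" N "taylor_form k f"]
      by (simp add: AB_poly_taylor_poly taylor_diag)
  qed
  moreover have "bidual_embed x \<in> ball 0 1" using x norm_bidual_embed_le[of x] by simp
  ultimately have "(\<lambda>k. taylor_poly k f x) sums AB_fun f (bidual_embed x)"
    using AB_fun_sums by fastforce
  then show ?thesis using taylor_poly_sums[OF hol M x] by (rule sums_unique2)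
qed

lemma holomorphic_on_ball_AB_fun: "holomorphic_on_ball (AB_fun f)"
proof (rule holomorphic_pointwise_limit)
  show "\<forall>\<^sub>F N in sequentially. holomorphic_on_ball (\<lambda>z. \<Sum>k<N. AB_poly k (taylor_poly k f) z)"
  proof (intro always_eventually allI)
    fix N show "holomorphic_on_ball (\<lambda>z. \<Sum>k<N. AB_poly k (taylor_poly k f) z)"
    proof (induction N)
      case 0
      show ?case using hl0_holomorphic[of "0 :: 'a cdual cdual hl0"] by (simp add: zero_hl0.rep_eq)
    next
      case (Suc N)
      obtain L where "mform N L (taylor_form N f)" using taylor_form_mform .
      then have "holomorphic_on_ball (\<lambda>z. AB_poly N (taylor_poly N f) z)"
        unfolding AB_poly_taylor_poly by (intro holomorphic_on_ball_diagonal[of N L] AB_form_mform)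
      from holomorphic_on_ball_add[OF Suc.IH this] show ?case by simp
    qed
  qed
  fix r :: real assume r: "r < 1"
  show "\<exists>B. \<forall>\<^sub>F N in sequentially. \<forall>z\<in>ball 0 r. cmod (\<Sum>k<N. AB_poly k (taylor_poly k f) z) \<le> B"
  proof (intro exI always_eventually allI ballI)
    fix N and z :: "'a cdual cdual" assume z: "z \<in> ball 0 r"
    then have r0: "0 < r" using norm_ge_zero[of z] by (simp only: mem_ball_0) 
    have M0: "0 \<le> M" using order_trans[OF norm_ge_zero M[of 0]] by simp
    have "cmod (\<Sum>k<N. AB_poly k (taylor_poly k f) z) \<le> (\<Sum>k<N. M * r ^ k)"
      using z r by (intro order_trans[OF norm_sum] sum_mono AB_poly_bound) auto
    also have "\<dots> \<le> (\<Sum>k. M * r ^ k)"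
      using r0 r M0 by (intro sum_le_suminf summable_mult summable_geometric) auto
    finally show "cmod (\<Sum>k<N. AB_poly k (taylor_poly k f) z) \<le> (\<Sum>k. M * r ^ k)" .
  qed
next
  fix z :: "'a cdual cdual" assume "z \<in> ball 0 1"
  then show "(\<lambda>N. \<Sum>k<N. AB_poly k (taylor_poly k f) z) \<longlonglongrightarrow> AB_fun f z"
    using AB_fun_sums by (simp add: sums_def)
qed simp

text \<open>
  Choose \<open>N\<close> such that all tails from \<open>N\<close> on of the Taylor series are uniformly small on the ball of
  radius \<open>r\<close>, and approximate \<open>z\<close>, \<open>w\<close> by \<open>x\<close>, \<open>y\<close> with respect to the first \<open>N\<close> Taylor polynomials.
\<close>

lemma lipschitz_on_AB_fun:
  assumes lip: "L-lipschitz_on (ball 0 1) f"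
  shows "L-lipschitz_on (ball 0 1) (AB_fun f)"
proof (rule lipschitz_onI)
  show L: "0 \<le> L" using lip by (rule lipschitz_on_nonneg)
  fix z w :: "'a cdual cdual" assume z: "z \<in> ball 0 1" and w: "w \<in> ball 0 1"
  obtain r where r: "max (norm z) (norm w) < r" "r < 1" using z w dense[of "max (norm z) (norm w)" 1] by auto
  have r0: "0 < r" using le_less_trans[OF norm_ge_zero[of z]] r(1) by simp
  show "dist (AB_fun f z) (AB_fun f w) \<le> L * dist z w"
  proof (rule field_le_epsilon)
    fix e :: real assume e: "0 < e"
    \<comment> \<open>Three errors at each of \<open>z\<close> and \<open>w\<close>, and \<open>L \<epsilon>\<close> from the distance of \<open>x\<close> and \<open>y\<close>.\<close>
    define \<epsilon> where "\<epsilon> = e / (L + 6)"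
    have \<epsilon>: "0 < \<epsilon>" "\<epsilon> * (L + 6) = e" using e L by (simp_all add: \<epsilon>_def add_nonneg_pos)
    have "(\<lambda>N. M * r ^ N / (1 - r)) \<longlonglongrightarrow> M * 0 / (1 - r)"
      using r r0 by (intro tendsto_intros LIMSEQ_realpow_zero) auto
    then have "\<forall>\<^sub>F N in sequentially. M * r ^ N / (1 - r) < \<epsilon>"
      using \<epsilon> by (intro order_tendstoD) auto
    then obtain N where N: "M * r ^ N / (1 - r) < \<epsilon>" by (auto simp: eventually_sequentially)
    define \<eta> where "\<eta> = \<epsilon> / (real N + 1)"
    have \<eta>: "0 < \<eta>" "real N * \<eta> \<le> \<epsilon>" using \<epsilon> by (auto simp: \<eta>_def field_simps)
    obtain x y where x: "norm x < r" and y: "norm y < r" and xy: "norm (x - y) < norm (z - w) + \<epsilon>"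
      and ax: "\<And>k. k < N \<Longrightarrow> cmod (taylor_poly k f x - AB_poly k (taylor_poly k f) z) < \<eta>"
      and ay: "\<And>k. k < N \<Longrightarrow> cmod (taylor_poly k f y - AB_poly k (taylor_poly k f) w) < \<eta>"
      using AB_poly_approximation[of z r w "norm (z - w) + \<epsilon>" \<eta> N] r \<epsilon>(1) \<eta>(1) by auto
    have close: "cmod (AB_fun f v - f u) \<le> 3 * \<epsilon>"
      if v: "norm v < r" and u: "norm u < r"
        and a: "\<And>k. k < N \<Longrightarrow> cmod (taylor_poly k f u - AB_poly k (taylor_poly k f) v) < \<eta>" for v u
    proof -
      define S where "S = (\<Sum>k<N. taylor_poly k f u)"
      define T where "T = (\<Sum>k<N. AB_poly k (taylor_poly k f) v)"
      have 1: "cmod (f u - S) \<le> M * r ^ N / (1 - r)"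
        unfolding S_def using u r r0
        by (intro norm_diff_partial_sum_le taylor_poly_sums[OF hol M] taylor_poly_bound[OF hol M]) auto
      have 2: "cmod (AB_fun f v - T) \<le> M * r ^ N / (1 - r)"
        unfolding T_def using v r r0
        by (intro norm_diff_partial_sum_le AB_fun_sums AB_poly_bound) auto
      have "cmod (S - T) \<le> (\<Sum>k<N. \<eta>)"
        unfolding S_def T_def sum_subtractf[symmetric]
        by (intro order_trans[OF norm_sum] sum_mono less_imp_le a) auto
      then have 3: "cmod (S - T) \<le> \<epsilon>" using \<eta>(2) by simp
      have "AB_fun f v - f u = (AB_fun f v - T) - (f u - S) - (S - T)" by simp
      then have "cmod (AB_fun f v - f u) \<le> cmod (AB_fun f v - T) + cmod (f u - S) + cmod (S - T)"
        by (metis norm_triangle_ineq4 norm_triangle_le_diff order_trans add_right_mono)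
      with 1 2 3 N show ?thesis by linarith
    qed
    have "dist (f x) (f y) \<le> L * dist x y"
      using x y r by (intro lipschitz_onD[OF lip]) auto
    also have "\<dots> \<le> L * (norm (z - w) + \<epsilon>)" using xy L by (intro mult_left_mono) (auto simp: dist_norm)
    finally have "cmod (f x - f y) \<le> L * norm (z - w) + L * \<epsilon>" by (simp add: dist_norm distrib_left)
    moreover have "cmod (AB_fun f z - f x) \<le> 3 * \<epsilon>" using r x ax by (intro close) auto
    moreover have "cmod (AB_fun f w - f y) \<le> 3 * \<epsilon>" using r y ay by (intro close) auto
    moreover have "cmod (AB_fun f z - AB_fun f w)
        \<le> cmod (AB_fun f z - f x) + cmod (f x - f y) + cmod (AB_fun f w - f y)"
      using norm_triangle_ineq[of "AB_fun f z - f x" "f x - f y"]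
        norm_triangle_ineq4[of "AB_fun f z - f x + (f x - f y)" "AB_fun f w - f y"] by simp
    ultimately show "dist (AB_fun f z) (AB_fun f w) \<le> L * dist z w + e"
      using \<epsilon>(2) by (simp add: dist_norm algebra_simps)
  qed
qed

end

lemma
  fixes f :: "'a::complex_normed_vector hl0"
  shows hl0_apply_AB_ext: "hl0_apply (AB_ext f) = AB_fun (hl0_apply f)"
    and norm_AB_ext_le: "norm (AB_ext f) \<le> norm f"
proof -
  note hol = hl0_holomorphic[of f] and bound = hl0_bound[of _ f]
  have "AB_fun (hl0_apply f) (bidual_embed 0) = hl0_apply f 0"
    by (rule AB_fun_embed[OF hol bound]) auto
  then have "AB_fun (hl0_apply f) 0 = 0" by (simp add: bidual_embed_zero hl0_apply_zero)
  moreover have "AB_fun (hl0_apply f) z = 0" if "z \<notin> ball 0 1" for z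
    using that by (simp add: AB_fun_def)
  ultimately show "hl0_apply (AB_ext f) = AB_fun (hl0_apply f)" "norm (AB_ext f) \<le> norm f"
    unfolding AB_ext_def
    using HL0_of_lipschitz[OF holomorphic_on_ball_AB_fun[OF hol bound] lipschitz_on_AB_fun[OF hol bound hl0_lipschitz]]
    by blast+
qed

lemma AB_ext_embed: "x \<in> ball 0 1 \<Longrightarrow> hl0_apply (AB_ext f) (bidual_embed x) = hl0_apply f x"
  unfolding hl0_apply_AB_ext by (rule AB_fun_embed[OF hl0_holomorphic hl0_bound])

text \<open>
  The embedding into the bidual does not increase distances.
\<close>

lemma norm_le_of_extension:
  assumes "\<And>x. x \<in> ball 0 1 \<Longrightarrow> hl0_apply g (bidual_embed x) = hl0_apply f x"
  shows "norm f \<le> norm g"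
  unfolding norm_hl0.rep_eq[of f]
proof (intro lipschitz_const_le lipschitz_onI)
  fix x y :: 'a assume xy: "x \<in> ball 0 1" "y \<in> ball 0 1"
  have "bidual_embed x \<in> ball 0 1" "bidual_embed y \<in> ball 0 1"
    using xy norm_bidual_embed_le[of x] norm_bidual_embed_le[of y] by auto
  then have "cmod (hl0_apply f x - hl0_apply f y) \<le> norm g * norm (bidual_embed x - bidual_embed y)"
    using hl0_dist[of "bidual_embed x" "bidual_embed y" g] assms xy by simp
  also have "\<dots> \<le> norm g * norm (x - y)"
    unfolding bidual_embed_diff[symmetric] by (intro mult_left_mono norm_bidual_embed_le) simp
  finally show "dist (hl0_apply f x) (hl0_apply f y) \<le> norm g * dist x y" by (simp add: dist_norm)
qed simp

lemma norm_AB_ext: "norm (AB_ext f) = norm f"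
  using norm_AB_ext_le norm_le_of_extension[OF AB_ext_embed] by (rule order_antisym)

section \<open>The weak-star topology on the unit ball\<close>

text \<open>
  The pointwise neighbourhoods of \<open>f\<close> within the closed unit ball. A net in that ball converges
  pointwise to \<open>f\<close> iff it converges along this filter.
\<close>

definition pointwise_nhds :: "'a::complex_normed_vector hl0 \<Rightarrow> 'a hl0 filter"
  where "pointwise_nhds f = inf (principal (cball 0 1))
    (INF x\<in>ball 0 1. filtercomap (\<lambda>h. hl0_apply h x) (nhds (hl0_apply f x)))"

lemma filterlim_pointwise_nhds:
  "filterlim g (pointwise_nhds f) F \<longleftrightarrow> (\<forall>\<^sub>F i in F. g i \<in> cball 0 1) \<and>
    (\<forall>x\<in>ball 0 1. ((\<lambda>i. hl0_apply (g i) x) \<longlongrightarrow> hl0_apply f x) F)"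
  unfolding pointwise_nhds_def
  by (simp add: filterlim_inf filterlim_principal filterlim_INF filterlim_filtercomap_iff comp_def)

lemma pointwise_nhds_tendsto:
  assumes "x \<in> ball 0 1"
  shows "((\<lambda>h. hl0_apply h x) \<longlongrightarrow> hl0_apply f x) (pointwise_nhds f)"
  using filterlim_pointwise_nhds[of "\<lambda>h. h" f "pointwise_nhds f"] assms filterlim_ident by blast

lemma pointwise_nhds_cball: "\<forall>\<^sub>F h in pointwise_nhds f. h \<in> cball 0 1"
  using filterlim_pointwise_nhds[of "\<lambda>h. h" f "pointwise_nhds f"] filterlim_ident by blast

lemma hl0_cball_dist:
  "h \<in> cball 0 1 \<Longrightarrow> x \<in> ball 0 1 \<Longrightarrow> y \<in> ball 0 1 \<Longrightarrow> cmod (hl0_apply h x - hl0_apply h y) \<le> dist x y"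
proof -
  assume h: "h \<in> cball 0 1" and xy: "x \<in> ball 0 1" "y \<in> ball 0 1"
  have "cmod (hl0_apply h x - hl0_apply h y) \<le> norm h * norm (x - y)" by (rule hl0_dist[OF xy])
  also have "\<dots> \<le> 1 * norm (x - y)" using h by (intro mult_right_mono) auto
  finally show ?thesis by (simp add: dist_norm)
qed

text \<open>
  Functions of norm at most \<open>1\<close> that are close to \<open>f\<close> on a finite \<open>\<epsilon> / 3\<close>-net of the compact set
  \<open>K\<close> are within \<open>\<epsilon>\<close> of \<open>f\<close> on \<open>K\<close>.
\<close>

lemma eventually_compact_open:
  assumes f: "f \<in> cball 0 1" and N: "openin compact_open_topology N" "f \<in> N"
  shows "\<forall>\<^sub>F h in pointwise_nhds f. h \<in> N"
proof -
  have "generate_topology_on {{f. hl0_apply f ` K \<subseteq> U} | K U. compact K \<and> K \<subseteq> ball 0 1 \<and> open U} N"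
    using N(1) by (simp add: compact_open_topology_def openin_topology_generated_by_iff)
  then show ?thesis using N(2)
  proof (induction rule: generate_topology_on.induct)
    case (Int a b)
    then show ?case by (auto simp: eventually_conj_iff)
  next
    case (UN \<K>)
    then obtain k where "k \<in> \<K>" "f \<in> k" by blast
    with UN.IH have "\<forall>\<^sub>F h in pointwise_nhds f. h \<in> k" by blast
    then show ?case by (rule eventually_mono) (use \<open>k \<in> \<K>\<close> in blast)
  next
    case (Basis s)
    then obtain K U where s: "s = {f. hl0_apply f ` K \<subseteq> U}" and K: "compact K" "K \<subseteq> ball 0 1" and U: "open U"
      by blast
    have fK: "hl0_apply f ` K \<subseteq> U" using Basis(2) s by simp
    have "continuous_on K (hl0_apply f)"
      using lipschitz_on_continuous_on[OF hl0_lipschitz] K(2) by (rule continuous_on_subset)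
    then have "compact (hl0_apply f ` K)" using K(1) by (rule compact_continuous_image)
    then obtain \<epsilon> where \<epsilon>: "0 < \<epsilon>" "(\<Union>y\<in>hl0_apply f ` K. ball y \<epsilon>) \<subseteq> U"
      using compact_subset_open_imp_ball_epsilon_subset[OF _ U fK] by blast
    have "K \<subseteq> (\<Union>x\<in>K. ball x (\<epsilon> / 3))" using \<epsilon>(1) by auto
    then obtain X where X: "X \<subseteq> K" "finite X" "K \<subseteq> (\<Union>x\<in>X. ball x (\<epsilon> / 3))"
      using compactE_image[OF K(1), of K "\<lambda>x. ball x (\<epsilon> / 3)"] by blast
    have "\<forall>\<^sub>F h in pointwise_nhds f. \<forall>x\<in>X. dist (hl0_apply h x) (hl0_apply f x) < \<epsilon> / 3"
      using X K(2) \<epsilon>(1) by (intro eventually_ball_finite ballI tendstoD[OF pointwise_nhds_tendsto]) auto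
    with pointwise_nhds_cball show ?case
    proof eventually_elim
      case (elim h)
      have "hl0_apply h y \<in> U" if y: "y \<in> K" for y
      proof -
        obtain x where x: "x \<in> X" "dist x y < \<epsilon> / 3" using X(3) y by auto
        have xy: "x \<in> ball 0 1" "y \<in> ball 0 1" using x y X(1) K(2) by blast+
        have "cmod (hl0_apply h x - hl0_apply h y) < \<epsilon> / 3" "cmod (hl0_apply f x - hl0_apply f y) < \<epsilon> / 3"
          using hl0_cball_dist[OF elim(1) xy] hl0_cball_dist[OF f xy] x(2) by linarith+
        moreover have "cmod (hl0_apply h x - hl0_apply f x) < \<epsilon> / 3"
          using elim(2) x(1) by (simp add: dist_norm)
        moreover have split: "hl0_apply f y - hl0_apply h y = (hl0_apply h x - hl0_apply h y)
            - (hl0_apply f x - hl0_apply f y) - (hl0_apply h x - hl0_apply f x)" by simp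
        have "cmod (hl0_apply f y - hl0_apply h y) \<le> cmod (hl0_apply h x - hl0_apply h y)
            + cmod (hl0_apply f x - hl0_apply f y) + cmod (hl0_apply h x - hl0_apply f x)"
          unfolding split by (intro order_trans[OF norm_triangle_ineq4] add_right_mono norm_triangle_ineq4)
        ultimately have "hl0_apply h y \<in> ball (hl0_apply f y) \<epsilon>" by (simp add: dist_norm)
        then show ?thesis using \<epsilon>(2) y by blast
      qed
      then show ?case by (auto simp: s)
    qed
  qed auto
qed

lemma topspace_compact_open [simp]: "topspace compact_open_topology = UNIV"
proof -
  have "openin compact_open_topology {f. hl0_apply f ` {} \<subseteq> UNIV}"
    unfolding compact_open_topology_def by (rule topology_generated_by_Basis) blast
  then show ?thesis using openin_subset by fastforce
qed

text \<open>
  The members of \<open>G0\<close> are continuous on the unit ball for the compact-open topology, hence for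
  pointwise convergence.
\<close>

lemma eventually_weak_star:
  assumes f: "f \<in> cball 0 1" and V: "openin (subtopology hl0_weak_star (cball 0 1)) V" "f \<in> V"
  shows "\<forall>\<^sub>F h in pointwise_nhds f. h \<in> V"
proof -
  obtain W where W: "openin hl0_weak_star W" "V = W \<inter> cball 0 1"
    using V(1) by (auto simp: openin_subtopology)
  have fW: "f \<in> W" using V W by auto
  obtain \<Psi> U where \<Psi>: "finite \<Psi>" "\<Psi> \<subseteq> cdual_apply ` G0" "\<And>\<psi>. \<psi> \<in> \<Psi> \<Longrightarrow> open (U \<psi>)"
    "\<And>\<psi>. \<psi> \<in> \<Psi> \<Longrightarrow> \<psi> f \<in> U \<psi>" "\<And>h. (\<And>\<psi>. \<psi> \<in> \<Psi> \<Longrightarrow> \<psi> h \<in> U \<psi>) \<Longrightarrow> h \<in> W"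
    by (rule openin_initial_topologyE[OF W(1)[unfolded hl0_weak_star_def] fW]) blast
  have "\<forall>\<^sub>F h in pointwise_nhds f. \<psi> h \<in> U \<psi>" if \<psi>: "\<psi> \<in> \<Psi>" for \<psi>
  proof -
    have "continuous_map (subtopology compact_open_topology (cball 0 1)) euclidean \<psi>"
      using \<psi> \<Psi>(2) by (auto simp: G0_def)
    then have "openin (subtopology compact_open_topology (cball 0 1))
        {h \<in> topspace (subtopology compact_open_topology (cball 0 1)). \<psi> h \<in> U \<psi>}"
      by (rule openin_continuous_map_preimage) (use \<Psi>(3)[OF \<psi>] in simp)
    then obtain N where N: "openin compact_open_topology N" "{h \<in> cball 0 1. \<psi> h \<in> U \<psi>} = N \<inter> cball 0 1"
      by (auto simp: openin_subtopology)
    have "f \<in> N" using N(2) f \<Psi>(4)[OF \<psi>] by blast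
    from eventually_compact_open[OF f N(1) this] pointwise_nhds_cball
    show ?thesis by eventually_elim (use N(2) in blast)
  qed
  then have "\<forall>\<^sub>F h in pointwise_nhds f. \<forall>\<psi>\<in>\<Psi>. \<psi> h \<in> U \<psi>"
    using \<Psi>(1) by (intro eventually_ball_finite) auto
  with pointwise_nhds_cball show ?thesis
    by eventually_elim (use \<Psi>(5) W(2) in blast)
qed

text \<open>
  Evaluation at a point of the ball belongs to \<open>G0\<close>.
\<close>

lemma openin_weak_star_evaluation:
  assumes x: "x \<in> ball 0 1" and U: "open U"
  shows "openin hl0_weak_star {f. hl0_apply f x \<in> U}"
proof -
  define \<delta> where "\<delta> = Cdual (\<lambda>f :: 'a hl0. hl0_apply f x)"
  have \<delta>: "cdual_apply \<delta> f = hl0_apply f x" for f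
    unfolding \<delta>_def using hl0_bound[OF x]
    by (intro cdual_apply_Cdual[where C = 1] clinear_complexI)
      (simp_all add: plus_hl0.rep_eq scaleC_hl0.rep_eq)
  have "openin compact_open_topology {f. hl0_apply f x \<in> V}" if "open V" for V
    unfolding compact_open_topology_def
    by (intro topology_generated_by_Basis CollectI exI[of _ "{x}"] exI[of _ V]) (use x that in auto)
  then have "continuous_map compact_open_topology euclidean (cdual_apply \<delta>)"
    by (simp add: continuous_map_def \<delta>)
  then have "\<delta> \<in> G0" unfolding G0_def by (simp add: continuous_map_from_subtopology)
  then have "openin hl0_weak_star {f. cdual_apply \<delta> f \<in> U}"
    unfolding hl0_weak_star_def using U by (intro openin_initial_topology_preimage) auto
  then show ?thesis by (simp add: \<delta>)
qed

text \<open>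
  The previous lemmas identify the weak-star neighbourhoods with the pointwise ones on both unit
  balls.
\<close>

lemma topcontinuous_at_iff_pointwise:
  fixes f :: "'a::complex_normed_vector hl0" and T :: "'a hl0 \<Rightarrow> 'b::complex_normed_vector hl0"
  assumes f: "f \<in> cball 0 1" and T: "\<And>h. h \<in> cball 0 1 \<Longrightarrow> T h \<in> cball 0 1"
  shows "topcontinuous_at (subtopology hl0_weak_star (cball 0 1)) (subtopology hl0_weak_star (cball 0 1)) T f \<longleftrightarrow>
    (\<forall>F. F \<noteq> bot \<longrightarrow> (\<forall>\<^sub>F h in F. h \<in> cball 0 1) \<longrightarrow>
      (\<forall>x\<in>ball 0 1. ((\<lambda>h. hl0_apply h x) \<longlongrightarrow> hl0_apply f x) F) \<longrightarrow>
      (\<forall>z\<in>ball 0 1. ((\<lambda>h. hl0_apply (T h) z) \<longlongrightarrow> hl0_apply (T f) z) F))"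
    (is "?L \<longleftrightarrow> ?R")
proof
  let ?X = "subtopology hl0_weak_star (cball 0 1) :: 'a hl0 topology"
  let ?Y = "subtopology hl0_weak_star (cball 0 1) :: 'b hl0 topology"
  have top: "topspace ?X = cball 0 1" "topspace ?Y = cball 0 1" by (simp_all add: hl0_weak_star_def)
  show ?R if L: ?L
  proof (intro allI impI ballI topological_tendstoI)
    fix F :: "'a hl0 filter" and z :: 'b and U :: "complex set"
    assume F: "\<forall>\<^sub>F h in F. h \<in> cball 0 1" "\<forall>x\<in>ball 0 1. ((\<lambda>h. hl0_apply h x) \<longlongrightarrow> hl0_apply f x) F"
      and z: "z \<in> ball 0 1" and U: "open U" "hl0_apply (T f) z \<in> U"
    have "openin ?Y ({g. hl0_apply g z \<in> U} \<inter> cball 0 1)"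
      by (rule openin_subtopology_Int[OF openin_weak_star_evaluation[OF z U(1)]])
    moreover have "T f \<in> {g. hl0_apply g z \<in> U} \<inter> cball 0 1" using T f U(2) by auto
    ultimately obtain V where V: "openin ?X V" "f \<in> V" "\<forall>h\<in>V. T h \<in> {g. hl0_apply g z \<in> U} \<inter> cball 0 1"
      using L unfolding topcontinuous_at_def by blast
    have "filterlim (\<lambda>h. h) (pointwise_nhds f) F" using F by (simp add: filterlim_pointwise_nhds)
    then have "\<forall>\<^sub>F h in F. h \<in> V" using eventually_weak_star[OF f V(1,2)] by (simp add: filterlim_iff)
    then show "\<forall>\<^sub>F h in F. hl0_apply (T h) z \<in> U" by (rule eventually_mono) (use V(3) in auto)
  qed
  show ?L if R: ?R
    unfolding topcontinuous_at_def top
  proof (intro conjI allI impI Pi_I f T)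
    fix V assume V: "openin ?Y V \<and> T f \<in> V"
    let ?F = "nhdsin ?X f"
    have cball: "\<forall>\<^sub>F h in ?F. h \<in> cball 0 1"
      using f top openin_topspace[of ?X] by (auto simp: eventually_nhdsin)
    have "((\<lambda>h. hl0_apply h x) \<longlongrightarrow> hl0_apply f x) ?F" if x: "x \<in> ball 0 1" for x
    proof (rule topological_tendstoI)
      fix U :: "complex set" assume U: "open U" "hl0_apply f x \<in> U"
      have "openin ?X ({h. hl0_apply h x \<in> U} \<inter> cball 0 1)"
        by (rule openin_subtopology_Int[OF openin_weak_star_evaluation[OF x U(1)]])
      then show "\<forall>\<^sub>F h in ?F. hl0_apply h x \<in> U"
        using f U(2) top by (auto simp: eventually_nhdsin)
    qed
    moreover have "?F \<noteq> bot" using f top by (auto simp: trivial_limit_def eventually_nhdsin)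
    ultimately have "\<forall>z\<in>ball 0 1. ((\<lambda>h. hl0_apply (T h) z) \<longlongrightarrow> hl0_apply (T f) z) ?F"
      using R cball by blast
    moreover have "\<forall>\<^sub>F h in ?F. T h \<in> cball 0 1" using cball by (rule eventually_mono) (rule T)
    ultimately have "filterlim T (pointwise_nhds (T f)) ?F" by (simp add: filterlim_pointwise_nhds)
    moreover have "\<forall>\<^sub>F g in pointwise_nhds (T f). g \<in> V"
      using V by (intro eventually_weak_star T f) auto
    ultimately have "\<forall>\<^sub>F h in ?F. T h \<in> V" by (rule eventually_compose_filterlim[rotated])
    then show "\<exists>U. openin ?X U \<and> f \<in> U \<and> (\<forall>h\<in>U. T h \<in> V)"
      using f unfolding eventually_nhdsin top by blast
  qed
qed

section \<open>Finite-rank operators on the bidual\<close>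

text \<open>
  Coordinates in a finite-dimensional subspace of a dual space extend to bounded functionals. When a
  vector \<open>b\<close> is added, its remainder \<open>r\<close> after the old coordinates is separated from \<open>0\<close> by
  evaluation at some \<open>\<theta>\<close>, and correcting this evaluation by the old coordinates gives the new one.
\<close>

lemma finite_dim_projection:
  fixes B :: "'e::complex_normed_vector cdual set"
  assumes "finite B"
  shows "\<exists>n (\<mu> :: nat \<Rightarrow> 'e cdual cdual) (e :: nat \<Rightarrow> 'e cdual).
    \<forall>v\<in>complex_vector.span B. (\<Sum>k<n. cdual_apply (\<mu> k) v *\<^sub>C e k) = v"
  using assms
proof (induction B rule: finite_induct)
  case empty
  show ?case by (intro exI[of _ 0]) simp
next
  case (insert b B)
  then obtain n and \<mu> :: "nat \<Rightarrow> 'e cdual cdual" and e :: "nat \<Rightarrow> 'e cdual" where IH: "\<forall>v\<in>complex_vector.span B. (\<Sum>k<n. cdual_apply (\<mu> k) v *\<^sub>C e k) = v"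
    by (elim exE) (rule that)
  define P where "P v = (\<Sum>k<n. cdual_apply (\<mu> k) v *\<^sub>C e k)" for v
  have P_add: "P (v + w) = P v + P w" and P_scale: "P (c *\<^sub>C v) = c *\<^sub>C P v" for v w c
    by (simp_all add: P_def cdual_apply_add cdual_apply_scaleC scaleC_add_left sum.distrib
        complex_vector.scale_sum_right scaleC_scaleC)
  define r where "r = b - P b"
  have rest: "\<exists>a. v - P v = a *\<^sub>C r \<and> v = P v + a *\<^sub>C r" if v: "v \<in> complex_vector.span (insert b B)" for v
  proof -
    obtain a where a: "v - a *\<^sub>C b \<in> complex_vector.span B"
      using v by (auto simp: complex_vector.span_breakdown_eq)
    define w where "w = v - a *\<^sub>C b"
    have "P w = w" using IH a by (simp add: P_def w_def)
    moreover have v: "v = w + a *\<^sub>C b" by (simp add: w_def)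
    ultimately have "P v = w + a *\<^sub>C P b" by (simp add: P_add P_scale)
    then have "v - P v = a *\<^sub>C r" by (simp add: v r_def complex_vector.scale_right_diff_distrib)
    then show ?thesis by (intro exI[of _ a]) (simp add: algebra_simps)
  qed
  show ?case
  proof (cases "r = 0")
    case True
    then have "P v = v" if "v \<in> complex_vector.span (insert b B)" for v
      using rest[OF that] by simp
    then show ?thesis unfolding P_def by (intro exI ballI)
  next
    case False
    then obtain \<theta> where \<theta>: "cdual_apply r \<theta> \<noteq> 0"
      using cdual_eqI[of r 0] by (auto simp: cdual_zero_apply)
    define \<nu> where "\<nu> = inverse (cdual_apply r \<theta>) *\<^sub>C (bidual_embed \<theta> - (\<Sum>k<n. cdual_apply (e k) \<theta> *\<^sub>C \<mu> k))"
    have \<nu>: "cdual_apply \<nu> v = cdual_apply (v - P v) \<theta> / cdual_apply r \<theta>" for v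
    proof -
      have "(\<Sum>k<n. cdual_apply (e k) \<theta> * cdual_apply (\<mu> k) v) = (\<Sum>k<n. cdual_apply (\<mu> k) v * cdual_apply (e k) \<theta>)"
        by (intro sum.cong refl mult.commute)
      then show ?thesis
        by (simp add: \<nu>_def P_def cdual_scaleC_apply cdual_diff_apply bidual_embed_apply cdual_sum_apply
            divide_inverse)
    qed
    show ?thesis
    proof (intro exI[of _ "Suc n"] exI[of _ "\<lambda>k. if k < n then \<mu> k else \<nu>"]
        exI[of _ "\<lambda>k. if k < n then e k else r"] ballI)
      fix v assume "v \<in> complex_vector.span (insert b B)"
      then obtain a where a: "v - P v = a *\<^sub>C r" "v = P v + a *\<^sub>C r" using rest by blast
      have "cdual_apply \<nu> v = a" using \<theta> by (simp add: \<nu> a(1) cdual_scaleC_apply)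
      then have "P v + cdual_apply \<nu> v *\<^sub>C r = v" using a(2) by simp
      then show "(\<Sum>k<Suc n. cdual_apply (if k < n then \<mu> k else \<nu>) v *\<^sub>C (if k < n then e k else r)) = v"
        by (simp add: P_def)
    qed
  qed
qed

text \<open>
  Each \<open>a\<close> has a norming \<open>\<theta>\<close> that also serves a neighbourhood of \<open>a\<close>, and bounded coefficient
  vectors form a compact set.
\<close>

lemma finite_norming_set:
  fixes e :: "nat \<Rightarrow> 'e::complex_normed_vector cdual"
  assumes \<epsilon>: "0 < \<epsilon>"
  obtains \<Theta> where "finite \<Theta>" "\<And>\<theta>. \<theta> \<in> \<Theta> \<Longrightarrow> norm \<theta> \<le> 1"
    "\<And>a. (\<And>k. k < n \<Longrightarrow> cmod (a k) \<le> R) \<Longrightarrow>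
      \<exists>\<theta>\<in>\<Theta>. norm (\<Sum>k<n. a k *\<^sub>C e k) < cmod (\<Sum>k<n. a k * cdual_apply (e k) \<theta>) + \<epsilon>"
proof -
  define S where "S k = (if k < n then cball (0::complex) R else {0})" for k
  define U where "U \<theta> = {a :: nat \<Rightarrow> complex.
    norm (\<Sum>k<n. a k *\<^sub>C e k) < cmod (\<Sum>k<n. a k * cdual_apply (e k) \<theta>) + \<epsilon>}" for \<theta>
  have "compactin (product_topology (\<lambda>_. euclidean) UNIV) (Pi\<^sub>E UNIV S)"
    by (subst compactin_PiE) (auto simp: S_def)
  then have compact: "compact (Pi\<^sub>E UNIV S)" by (simp add: euclidean_product_topology)
  have "open (U \<theta>)" for \<theta>
    unfolding U_def
    by (intro open_Collect_less continuous_intros continuous_on_product_coordinates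
        bounded_linear.continuous_on[OF bounded_linear_scaleC_left])
  moreover have "Pi\<^sub>E UNIV S \<subseteq> (\<Union>\<theta>\<in>{\<theta>. norm \<theta> \<le> 1}. U \<theta>)"
  proof
    fix a :: "nat \<Rightarrow> complex"
    define v where "v = (\<Sum>k<n. a k *\<^sub>C e k)"
    obtain \<theta> where \<theta>: "norm \<theta> \<le> 1" "norm v - \<epsilon> < Re (cdual_apply v \<theta>)"
      using norm_cdual_less_obtain[of "norm v - \<epsilon>" v] \<epsilon> by auto
    have "norm v < cmod (cdual_apply v \<theta>) + \<epsilon>"
      using \<theta>(2) complex_Re_le_cmod[of "cdual_apply v \<theta>"] by linarith
    then have "a \<in> U \<theta>" by (simp add: U_def v_def cdual_sum_apply cdual_scaleC_apply)
    with \<theta>(1) show "a \<in> (\<Union>\<theta>\<in>{\<theta>. norm \<theta> \<le> 1}. U \<theta>)" by blast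
  qed
  ultimately obtain \<Theta> where \<Theta>: "\<Theta> \<subseteq> {\<theta>. norm \<theta> \<le> 1}" "finite \<Theta>" "Pi\<^sub>E UNIV S \<subseteq> (\<Union>\<theta>\<in>\<Theta>. U \<theta>)"
    using compactE_image[OF compact, of "{\<theta>. norm \<theta> \<le> 1}" U] by blast
  show ?thesis
  proof (rule that[OF \<Theta>(2)])
    fix a :: "nat \<Rightarrow> complex" assume a: "\<And>k. k < n \<Longrightarrow> cmod (a k) \<le> R"
    define a' where "a' k = (if k < n then a k else 0)" for k
    have "a' \<in> Pi\<^sub>E UNIV S" using a by (auto simp: a'_def S_def)
    then obtain \<theta> where "\<theta> \<in> \<Theta>" "a' \<in> U \<theta>" using \<Theta>(3) by blast
    then show "\<exists>\<theta>\<in>\<Theta>. norm (\<Sum>k<n. a k *\<^sub>C e k) < cmod (\<Sum>k<n. a k * cdual_apply (e k) \<theta>) + \<epsilon>"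
      by (intro bexI[of _ \<theta>]) (simp_all add: U_def a'_def)
  qed (use \<Theta>(1) in auto)
qed

text \<open>
  Write \<open>T z = \<Sum>k. \<psi> k (z) e k\<close> with \<open>\<psi> k\<close> in the bidual of \<open>'e\<close>. Replacing \<open>\<psi> k\<close> by an element
  \<open>\<phi> k\<close> of \<open>'e\<close> makes the operator weak-star continuous. By \<open>goldstine_helly\<close> the \<open>\<phi> k\<close> can be chosen
  to agree with \<open>\<psi> k\<close> on \<open>Z\<close>; that the norm is at most \<open>1 + \<epsilon>\<close> is ensured by finitely many
  conditions \<open>norm (\<Sum>k. e k (\<theta>) \<phi> k) < 1 + \<epsilon> / 2\<close> with \<open>\<theta>\<close> in a finite norming set. Division by
  \<open>1 + \<epsilon>\<close> costs the error in the second conclusion.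
\<close>

theorem weak_star_continuous_approximation:
  fixes T :: "'e::complex_normed_vector cdual \<Rightarrow> 'e cdual"
  assumes T: "bounded_clinear T" "\<And>z. norm (T z) \<le> norm z" "finite_rank T"
    and Z: "finite Z" and \<epsilon>: "0 < \<epsilon>"
  obtains n and \<phi> :: "nat \<Rightarrow> 'e" and e :: "nat \<Rightarrow> 'e cdual"
  where "\<And>z. norm (\<Sum>k<n. cdual_apply z (\<phi> k) *\<^sub>C e k) \<le> norm z"
    "\<And>z. z \<in> Z \<Longrightarrow> norm ((\<Sum>k<n. cdual_apply z (\<phi> k) *\<^sub>C e k) - T z) \<le> \<epsilon> * norm z"
proof -
  obtain B where B: "finite B" "range T \<subseteq> complex_vector.span B"
    using T(3) by (auto simp: finite_rank_def)
  obtain n and \<mu> :: "nat \<Rightarrow> 'e cdual cdual" and e :: "nat \<Rightarrow> 'e cdual"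
    where \<mu>: "\<forall>v\<in>complex_vector.span B. (\<Sum>k<n. cdual_apply (\<mu> k) v *\<^sub>C e k) = v"
    using finite_dim_projection[OF B(1)] by (elim exE) (rule that)
  have T_add: "T (x + y) = T x + T y" and T_scale: "T (c *\<^sub>C x) = c *\<^sub>C T x" for x y c
    using T(1) by (simp_all add: bounded_clinear_def clinear_def)
  define \<psi> where "\<psi> k = Cdual (\<lambda>z. cdual_apply (\<mu> k) (T z))" for k
  have \<psi>: "cdual_apply (\<psi> k) z = cdual_apply (\<mu> k) (T z)" for k z
    unfolding \<psi>_def
  proof (rule cdual_apply_Cdual)
    show "clinear (\<lambda>z. cdual_apply (\<mu> k) (T z))"
      by (intro clinear_complexI) (simp_all add: T_add T_scale cdual_apply_add cdual_apply_scaleC)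
    show "cmod (cdual_apply (\<mu> k) (T z)) \<le> norm (\<mu> k) * norm z" for z
      by (intro order_trans[OF cdual_apply_bound] mult_left_mono T(2)) simp
  qed
  have T_eq: "T z = (\<Sum>k<n. cdual_apply (\<psi> k) z *\<^sub>C e k)" for z
    unfolding \<psi> using \<mu> B(2) by (metis rangeI subsetD)
  define R where "R = (\<Sum>k<n. norm (\<psi> k)) + 1"
  have R: "norm (\<psi> k) < R" if "k < n" for k
    unfolding R_def using that member_le_sum[of k "{..<n}" "\<lambda>k. norm (\<psi> k)"] by simp
  define \<eta> where "\<eta> = \<epsilon> / 2"
  have \<eta>: "0 < \<eta>" using \<epsilon> by (simp add: \<eta>_def)
  obtain \<Theta> where \<Theta>: "finite \<Theta>" "\<And>\<theta>. \<theta> \<in> \<Theta> \<Longrightarrow> norm \<theta> \<le> 1"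
    "\<And>a. (\<And>k. k < n \<Longrightarrow> cmod (a k) \<le> R) \<Longrightarrow>
      \<exists>\<theta>\<in>\<Theta>. norm (\<Sum>k<n. a k *\<^sub>C e k) < cmod (\<Sum>k<n. a k * cdual_apply (e k) \<theta>) + \<eta>"
    using finite_norming_set[OF \<eta>, where n = n and R = R and e = e] by blast
  \<comment> \<open>The rows \<open>Inl \<theta>\<close> bound the operator norm; the rows \<open>Inr i\<close> bound \<open>\<phi> i\<close>, which keeps the coefficients in the range for which \<open>\<Theta>\<close> is norming.\<close>
  define c where "c j k = (case j of Inl \<theta> \<Rightarrow> cdual_apply (e k) \<theta> | Inr i \<Rightarrow> of_bool (i = k))"
    for j :: "'e + nat" and k
  have single: "(\<Sum>k<n. c (Inr i) k *\<^sub>C v k) = v i" if "i < n" for i and v :: "nat \<Rightarrow> 'b::complex_normed_vector"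
  proof -
    have "(\<Sum>k<n. c (Inr i) k *\<^sub>C v k) = (\<Sum>k<n. if k = i then v k else 0)"
      by (intro sum.cong refl) (auto simp: c_def)
    then show ?thesis using that by simp
  qed
  obtain \<phi> :: "nat \<Rightarrow> 'e" where
    \<phi>: "\<And>j. j \<in> Inl ` \<Theta> \<union> Inr ` {..<n} \<Longrightarrow> norm (\<Sum>k<n. c j k *\<^sub>C \<phi> k) < (case j of Inl _ \<Rightarrow> 1 + \<eta> | Inr _ \<Rightarrow> R)"
    and agree: "\<And>k z. k \<in> {..<n} \<Longrightarrow> z \<in> Z \<Longrightarrow> cdual_apply z (\<phi> k) = cdual_apply (\<psi> k) z"
  proof (rule goldstine_helly[of "Inl ` \<Theta> \<union> Inr ` {..<n}" "{..<n}" Z c \<psi> "\<lambda>j. case j of Inl _ \<Rightarrow> 1 + \<eta> | Inr _ \<Rightarrow> R"])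
    fix j assume j: "j \<in> Inl ` \<Theta> \<union> Inr ` {..<n}"
    show "norm (\<Sum>k<n. c j k *\<^sub>C \<psi> k) < (case j of Inl _ \<Rightarrow> 1 + \<eta> | Inr _ \<Rightarrow> R)"
    proof (cases j)
      case (Inl \<theta>)
      then have \<theta>: "norm \<theta> \<le> 1" using j \<Theta>(2) by auto
      have "norm (\<Sum>k<n. c j k *\<^sub>C \<psi> k) \<le> 1"
      proof (rule norm_cdual_le)
        fix z
        have "cdual_apply (\<Sum>k<n. c j k *\<^sub>C \<psi> k) z = cdual_apply (T z) \<theta>"
          by (simp add: T_eq c_def Inl cdual_sum_apply cdual_scaleC_apply mult.commute)
        also have "cmod \<dots> \<le> norm (T z) * norm \<theta>" by (rule cdual_apply_bound)
        also have "\<dots> \<le> norm z * 1" using T(2) \<theta> by (intro mult_mono) auto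
        finally show "cmod (cdual_apply (\<Sum>k<n. c j k *\<^sub>C \<psi> k) z) \<le> 1 * norm z" by simp
      qed simp
      then show ?thesis using \<eta> by (simp add: Inl)
    next
      case (Inr i)
      then have "i < n" using j by auto
      then show ?thesis using R by (simp add: Inr single)
    qed
  qed (use \<Theta>(1) Z in auto)
  define S where "S z = (\<Sum>k<n. cdual_apply z (\<phi> k) *\<^sub>C e k)" for z
  have S_scale: "S (t *\<^sub>R z) = t *\<^sub>R S z" for t z
    by (simp add: S_def scaleR_scaleC cdual_scaleC_apply complex_vector.scale_sum_right scaleC_scaleC)
  have S_unit: "norm (S z) \<le> 1 + 2 * \<eta>" if z: "norm z \<le> 1" for z
  proof -
    have "cmod (cdual_apply z (\<phi> k)) \<le> R" if "k < n" for k
    proof -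
      have "norm (\<phi> k) < R" using \<phi>[of "Inr k"] that by (simp add: single)
      then have "norm z * norm (\<phi> k) \<le> 1 * R" using z by (intro mult_mono) auto
      then show ?thesis using cdual_apply_bound[of z "\<phi> k"] by linarith
    qed
    then obtain \<theta> where \<theta>: "\<theta> \<in> \<Theta>"
      "norm (S z) < cmod (\<Sum>k<n. cdual_apply z (\<phi> k) * cdual_apply (e k) \<theta>) + \<eta>"
      unfolding S_def using \<Theta>(3)[of "\<lambda>k. cdual_apply z (\<phi> k)"] by blast
    have "(\<Sum>k<n. cdual_apply z (\<phi> k) * cdual_apply (e k) \<theta>) = cdual_apply z (\<Sum>k<n. c (Inl \<theta>) k *\<^sub>C \<phi> k)"
      by (simp add: c_def cdual_apply_sum cdual_apply_scaleC mult.commute)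
    also have "cmod \<dots> \<le> norm z * norm (\<Sum>k<n. c (Inl \<theta>) k *\<^sub>C \<phi> k)" by (rule cdual_apply_bound)
    also have "\<dots> \<le> 1 * (1 + \<eta>)" using z \<phi>[of "Inl \<theta>"] \<theta>(1) by (intro mult_mono) auto
    finally have "cmod (\<Sum>k<n. cdual_apply z (\<phi> k) * cdual_apply (e k) \<theta>) + \<eta> \<le> 1 + 2 * \<eta>" by simp
    with \<theta>(2) show ?thesis by (meson less_imp_le less_le_trans)
  qed
  have S_bound: "norm (S z) \<le> (1 + 2 * \<eta>) * norm z" for z
  proof (cases "z = 0")
    case True
    then show ?thesis by (simp add: S_def cdual_zero_apply)
  next
    case False
    have "norm (S (inverse (norm z) *\<^sub>R z)) \<le> 1 + 2 * \<eta>" using False by (intro S_unit) simp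
    then show ?thesis using False by (simp add: S_scale field_simps)
  qed
  define s where "s = 1 / (1 + \<epsilon>)"
  have s: "0 < s" "s * (1 + 2 * \<eta>) = 1" "1 - s \<le> \<epsilon>" "s \<le> 1"
    using \<epsilon> by (auto simp: s_def \<eta>_def field_simps)
  have sS: "(\<Sum>k<n. cdual_apply z (\<phi> k) *\<^sub>C of_real s *\<^sub>C e k) = s *\<^sub>R S z" for z
    by (simp add: S_def scaleR_scaleC complex_vector.scale_sum_right scaleC_scaleC mult.commute)
  show ?thesis
  proof (rule that[where n = n and \<phi> = \<phi> and e = "\<lambda>k. of_real s *\<^sub>C e k"]; unfold sS)
    fix z
    have "s * norm (S z) \<le> s * ((1 + 2 * \<eta>) * norm z)" using s(1) S_bound by (intro mult_left_mono) auto
    then show "norm (s *\<^sub>R S z) \<le> norm z" using s(1,2) by (simp add: mult.assoc[symmetric])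
  next
    fix z assume "z \<in> Z"
    then have "S z = T z" by (simp add: S_def T_eq agree)
    moreover have "s *\<^sub>R T z - T z = (s - 1) *\<^sub>R T z" by (simp add: scaleR_diff_left)
    ultimately have "norm (s *\<^sub>R S z - T z) = (1 - s) * norm (T z)" using s(4) by simp
    also have "\<dots> \<le> \<epsilon> * norm z" using T(2) s(3,4) \<epsilon> by (intro mult_mono) auto
    finally show "norm (s *\<^sub>R S z - T z) \<le> \<epsilon> * norm z" .
  qed
qed

section \<open>Extensions that factor through a finite-dimensional space\<close>

lemma clinear_sum:
  assumes "clinear (f :: 'a::complex_normed_vector \<Rightarrow> complex)"
  shows "f (\<Sum>k\<in>K. c k *\<^sub>C e k) = (\<Sum>k\<in>K. c k * f (e k))"
  by (induction K rule: infinite_finite_induct)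
    (simp_all add: clinear_add[OF assms] clinear_scale[OF assms] clinear_zero[OF assms])

text \<open>
  In the variable \<open>x\<close> the form is a finite combination of the functionals \<open>\<phi> k\<close>, for which the limit
  along \<open>weak_star_approx z\<close> is the value of \<open>z\<close>.
\<close>

lemma AB_form_finite_rank:
  fixes \<phi> :: "nat \<Rightarrow> 'a::complex_normed_vector cdual"
  assumes S: "\<And>z. S z = (\<Sum>k<n. cdual_apply z (\<phi> k) *\<^sub>C e k)"
  shows "mform (length zs) M B \<Longrightarrow>
    AB_form zs (\<lambda>xs. B (map (\<lambda>x. S (bidual_embed x)) xs)) = B (map S zs)"
proof (induction zs arbitrary: M B)
  case (Cons z zs)
  have cl: "clinear (\<lambda>v. B (v # map S zs))"
    using Cons.prems by (intro mform_head_clinear[where n = "length zs"]) simp_all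
  have "AB_form zs (\<lambda>xs. B (map (\<lambda>x. S (bidual_embed x)) (x # xs))) = B (S (bidual_embed x) # map S zs)" for x
  proof -
    have "mform (length zs) (M * norm (S (bidual_embed x))) (\<lambda>xs. B (S (bidual_embed x) # xs))"
      by (rule mform_Cons) (use Cons.prems in simp)
    from Cons.IH[OF this] show ?thesis by simp
  qed
  moreover have "((\<lambda>x. B (S (bidual_embed x) # map S zs)) \<longlongrightarrow> B (S z # map S zs)) (weak_star_approx z)"
    unfolding S[of "bidual_embed _"] S[of z] clinear_sum[OF cl] bidual_embed_apply
    by (intro tendsto_sum tendsto_mult weak_star_approx_tendsto tendsto_const)
  ultimately show ?case by (simp add: tendsto_Lim weak_star_approx_neq_bot)
qed simp

text \<open>
  The function \<open>h x = g (S x)\<close> has the Taylor forms of \<open>g\<close> composed with \<open>S\<close>, and the previous lemma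
  identifies their extensions; so the extension of \<open>h\<close> is \<open>g \<circ> S\<close>.
\<close>

lemma AB_ext_finite_rank:
  fixes \<phi> :: "nat \<Rightarrow> 'a::complex_normed_vector cdual" and g :: "'a cdual cdual hl0"
  assumes S: "\<And>z. S z = (\<Sum>k<n. cdual_apply z (\<phi> k) *\<^sub>C e k)" and S_le: "\<And>z. norm (S z) \<le> norm z"
  obtains h :: "'a hl0" where "norm h \<le> norm g" "\<And>z. z \<in> ball 0 1 \<Longrightarrow> hl0_apply (AB_ext h) z = hl0_apply g (S z)"
proof -
  define J where "J x = S (bidual_embed x)" for x
  have S_add: "S (z + w) = S z + S w" and S_scale: "S (c *\<^sub>C z) = c *\<^sub>C S z" for z w c
    by (simp_all add: S cdual_add_apply cdual_scaleC_apply scaleC_add_left sum.distrib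
        complex_vector.scale_sum_right scaleC_scaleC)
  have J_add: "J (x + y) = J x + J y" and J_scale: "J (c *\<^sub>C x) = c *\<^sub>C J x" for x y c
    by (simp_all add: J_def bidual_embed_add bidual_embed_scaleC S_add S_scale)
  have J_le: "norm (J x) \<le> norm x" for x
    unfolding J_def using S_le norm_bidual_embed_le by (rule order_trans)
  have J: "bounded_linear J"
    by (rule bounded_linear_intro[where K = 1]) (simp_all add: J_add J_scale scaleR_scaleC J_le)
  have J_ball: "J x \<in> ball 0 1" if "x \<in> ball 0 1" for x
    using J_le[of x] that by simp
  have S_ball: "S z \<in> ball 0 1" if "z \<in> ball 0 1" for z
    using S_le[of z] that by simp
  \<comment> \<open>Outside the ball \<open>g (J x)\<close> need not vanish, since \<open>J\<close> may shrink \<open>x\<close>.\<close>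
  define h0 where "h0 x = (if x \<in> ball 0 1 then hl0_apply g (J x) else 0)" for x
  have hol: "holomorphic_on_ball h0"
    unfolding holomorphic_on_ball_def
  proof
    fix x :: 'a assume x: "x \<in> ball 0 1"
    obtain D where D: "bounded_clinear D" "(hl0_apply g has_derivative D) (at (J x))"
      using hl0_holomorphic[of g] J_ball[OF x] unfolding holomorphic_on_ball_def by blast
    have "((\<lambda>x. hl0_apply g (J x)) has_derivative (\<lambda>v. D (J v))) (at x)"
      by (rule has_derivative_compose[OF bounded_linear_imp_has_derivative[OF J] D(2)])
    then have "(h0 has_derivative (\<lambda>v. D (J v))) (at x)"
      by (rule has_derivative_transform_within_open[OF _ open_ball x]) (simp add: h0_def)
    moreover have "bounded_clinear (\<lambda>v. D (J v))"
      using D(1) bounded_linear_compose[OF _ J, of D] by (simp add: bounded_clinear_iff J_scale)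
    ultimately show "\<exists>D. bounded_clinear D \<and> (h0 has_derivative D) (at x)" by blast
  qed
  have lip: "(norm g)-lipschitz_on (ball 0 1) h0"
  proof (rule lipschitz_onI)
    fix x y :: 'a assume xy: "x \<in> ball 0 1" "y \<in> ball 0 1"
    have "J x - J y = J (x - y)" using J by (simp add: linear_diff bounded_linear.linear)
    then have "norm (J x - J y) \<le> norm (x - y)" using J_le by simp
    then have "norm g * norm (J x - J y) \<le> norm g * norm (x - y)" by (rule mult_left_mono) simp
    with hl0_dist[OF J_ball[OF xy(1)] J_ball[OF xy(2)], of g]
    show "dist (h0 x) (h0 y) \<le> norm g * dist x y" using xy by (simp add: h0_def dist_norm)
  qed simp
  have "J 0 = 0" using J by (simp add: linear_0 bounded_linear.linear)
  then have zero: "h0 0 = 0" by (simp add: h0_def hl0_apply_zero)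
  have off: "h0 x = 0" if "x \<notin> ball 0 1" for x using that by (simp add: h0_def)
  define h where "h = HL0 h0"
  have h: "hl0_apply h = h0" "norm h \<le> norm g"
    unfolding h_def using HL0_of_lipschitz[OF hol lip zero] off by blast+
  have h0_bound: "cmod (h0 x) \<le> norm g" if "x \<in> ball 0 1" for x
    using hl0_bound[OF J_ball[OF that]] that by (simp add: h0_def)
  note g_hol = hl0_holomorphic[of g] and g_bound = hl0_bound[of _ g]
  have "hl0_apply (AB_ext h) z = hl0_apply g (S z)" if z: "z \<in> ball 0 1" for z
  proof -
    have "AB_poly k (taylor_poly k h0) z = taylor_poly k (hl0_apply g) (S z)" for k
    proof -
      let ?B = "taylor_form k (hl0_apply g)"
      define A where "A xs = ?B (map J xs)" for xs
      have B: "bounded_symmetric_form k ?B" by (rule bounded_symmetric_taylor_form[OF g_hol g_bound])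
      obtain M where M: "mform k M ?B" "symmetric_list_fun k ?B" using bounded_symmetric_formD[OF B] .
      have "clinear (\<lambda>x. A (us @ x # ws))" if "length us + length ws + 1 = k" for us ws
      proof -
        have cl: "clinear (\<lambda>v. ?B (map J us @ v # map J ws))" using that by (intro mform_clinear[OF M(1)]) simp
        show ?thesis
          unfolding A_def
          by (intro clinear_complexI) (simp_all add: J_add J_scale clinear_add[OF cl] clinear_scale[OF cl])
      qed
      moreover have "cmod (A xs) \<le> M * (\<Prod>x\<leftarrow>xs. norm x)" if "length xs = k" for xs
      proof -
        have "(\<Prod>v\<leftarrow>map J xs. norm v) \<le> (\<Prod>x\<leftarrow>xs. norm x)"
        proof (induction xs)
          case (Cons x xs)
          from mult_mono[OF J_le this norm_ge_zero prod_list_norm_nonneg] show ?case by simp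
        qed simp
        then have "M * (\<Prod>v\<leftarrow>map J xs. norm v) \<le> M * (\<Prod>x\<leftarrow>xs. norm x)"
          using mform_nonneg[OF M(1)] by (rule mult_left_mono)
        with mform_bound[OF M(1), of "map J xs"] that show ?thesis by (simp add: A_def)
      qed
      moreover have "A xs = A ys" if "length xs = k" "mset xs = mset ys" for xs ys
        unfolding A_def by (rule symmetric_list_funD[OF M(2)]) (use that in simp_all)
      moreover have "A xs = 0" if "length xs \<noteq> k" for xs using that by (simp add: A_def taylor_form_def)
      ultimately have A: "bounded_symmetric_form k A"
        unfolding bounded_symmetric_form_def by blast
      have diag: "taylor_poly k h0 x = A (replicate k x)" for x
      proof -
        have "open ((\<lambda>t. t *\<^sub>C x) -` ball 0 1)"
          using open_vimage[OF open_ball continuous_on_scaleC_line[of UNIV 0 x]] by simp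
        then have "\<forall>\<^sub>F t in nhds 0. t \<in> (\<lambda>t. t *\<^sub>C x) -` ball 0 1"
          by (intro eventually_nhds_in_open) auto
        then have "\<forall>\<^sub>F t in nhds 0. h0 (t *\<^sub>C x) = hl0_apply g (t *\<^sub>C J x)"
          by eventually_elim (simp add: h0_def J_scale)
        then have "taylor_poly k h0 x = taylor_poly k (hl0_apply g) (J x)"
          unfolding taylor_poly_def by (simp add: higher_deriv_cong_ev)
        also have "\<dots> = A (replicate k x)"
          using taylor_form_diag[OF g_hol g_bound] by (simp add: A_def)
        finally show ?thesis .
      qed
      have "AB_poly k (taylor_poly k h0) z = AB_form (replicate k z) A"
        unfolding AB_poly_def by (subst symmetric_form_of_eq[OF A diag]) simp
      also have "\<dots> = ?B (map S (replicate k z))"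
        unfolding A_def J_def by (rule AB_form_finite_rank[OF S]) (use M(1) in simp)
      also have "\<dots> = taylor_poly k (hl0_apply g) (S z)"
        using taylor_form_diag[OF g_hol g_bound] by simp
      finally show ?thesis .
    qed
    then have "(\<lambda>k. taylor_poly k (hl0_apply g) (S z)) sums AB_fun h0 z"
      using AB_fun_sums[OF hol h0_bound z] by simp
    moreover have "(\<lambda>k. taylor_poly k (hl0_apply g) (S z)) sums hl0_apply g (S z)"
      by (rule taylor_poly_sums[OF g_hol g_bound S_ball[OF z]])
    ultimately show ?thesis unfolding hl0_apply_AB_ext h(1) by (rule sums_unique2)
  qed
  with h(2) show ?thesis by (rule that)
qed

theorem AB_ext_pointwise_dense:
  fixes g :: "'a::complex_normed_vector cdual cdual hl0"
  assumes map: "metric_approximation_property TYPE('a cdual cdual)"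
    and g: "norm g \<le> 1" and Z: "finite Z" "Z \<subseteq> ball 0 1" and \<epsilon>: "0 < \<epsilon>"
  obtains h :: "'a hl0" where "h \<in> cball 0 1" "\<And>z. z \<in> Z \<Longrightarrow> cmod (hl0_apply (AB_ext h) z - hl0_apply g z) < \<epsilon>"
proof -
  obtain F :: "('a cdual cdual \<Rightarrow> 'a cdual cdual) filter" where F: "F \<noteq> bot"
    "\<forall>\<^sub>F T in F. bounded_clinear T \<and> finite_rank T \<and> onorm T \<le> 1" "\<And>x. ((\<lambda>T. T x) \<longlongrightarrow> x) F"
    using map unfolding metric_approximation_property_def by blast
  have "\<forall>\<^sub>F T in F. \<forall>z\<in>Z. dist (T z) z < \<epsilon> / 2"
    using Z(1) F(3) \<epsilon> by (intro eventually_ball_finite ballI tendstoD) auto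
  with F(2) have "\<forall>\<^sub>F T in F. (bounded_clinear T \<and> finite_rank T \<and> onorm T \<le> 1) \<and> (\<forall>z\<in>Z. dist (T z) z < \<epsilon> / 2)"
    by (rule eventually_conj)
  then obtain T where T: "bounded_clinear T" "finite_rank T" "onorm T \<le> 1" "\<forall>z\<in>Z. dist (T z) z < \<epsilon> / 2"
    using eventually_happens'[OF F(1)] by blast
  have T_le: "norm (T z) \<le> norm z" for z
  proof -
    have "norm (T z) \<le> onorm T * norm z" using T(1) by (intro onorm) (simp add: bounded_clinear_iff)
    also have "\<dots> \<le> 1 * norm z" using T(3) by (rule mult_right_mono) simp
    finally show ?thesis by simp
  qed
  have e2: "0 < \<epsilon> / 2" using \<epsilon> by simp
  obtain n and \<phi> :: "nat \<Rightarrow> 'a cdual" and e :: "nat \<Rightarrow> 'a cdual cdual" where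
    S: "\<And>z. norm (\<Sum>k<n. cdual_apply z (\<phi> k) *\<^sub>C e k) \<le> norm z"
    "\<And>z. z \<in> Z \<Longrightarrow> norm ((\<Sum>k<n. cdual_apply z (\<phi> k) *\<^sub>C e k) - T z) \<le> \<epsilon> / 2 * norm z"
    by (rule weak_star_continuous_approximation[OF T(1) T_le T(2) Z(1) e2]) (rule that)
  define S' where "S' z = (\<Sum>k<n. cdual_apply z (\<phi> k) *\<^sub>C e k)" for z
  obtain h :: "'a hl0" where h: "norm h \<le> norm g"
    "\<And>z. z \<in> ball 0 1 \<Longrightarrow> hl0_apply (AB_ext h) z = hl0_apply g (S' z)"
    using AB_ext_finite_rank[OF S'_def, where g = g] S(1) unfolding S'_def[symmetric] by blast
  show ?thesis
  proof (rule that)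
    show "h \<in> cball 0 1" using h(1) g by simp
    fix z assume z: "z \<in> Z"
    then have zb: "z \<in> ball 0 1" using Z(2) by blast
    then have Sb: "S' z \<in> ball 0 1" using S(1)[of z] by (simp add: S'_def)
    have "cmod (hl0_apply g (S' z) - hl0_apply g z) \<le> dist (S' z) z"
      using g by (intro hl0_cball_dist Sb zb) simp
    also have "\<dots> \<le> dist (S' z) (T z) + dist (T z) z" by (rule dist_triangle)
    also have "dist (S' z) (T z) \<le> \<epsilon> / 2 * norm z" using S(2)[OF z] by (simp add: S'_def dist_norm)
    also have "\<epsilon> / 2 * norm z \<le> \<epsilon> / 2 * 1" using zb \<epsilon> by (intro mult_left_mono) auto
    finally show "cmod (hl0_apply (AB_ext h) z - hl0_apply g z) < \<epsilon>"
      unfolding h(2)[OF zb] using T(4) z by fastforce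
  qed
qed

section \<open>Uniqueness of extensions and continuity\<close>

text \<open>
  Density provides a net \<open>h\<close> in the unit ball, indexed by the finite sets of points together with the
  accuracies \<open>1 / (n + 1)\<close>, whose extensions converge pointwise to \<open>g\<close>. On the space this says that
  \<open>h\<close> converges to \<open>f\<close>, so the extensions also converge to \<open>AB_ext f\<close>.
\<close>

lemma continuous_imp_unique_extension:
  fixes f :: "'a::complex_normed_vector hl0" and g :: "'a cdual cdual hl0"
  assumes map: "metric_approximation_property TYPE('a cdual cdual)"
    and cont: "\<And>F. F \<noteq> bot \<Longrightarrow> \<forall>\<^sub>F h in F. h \<in> cball 0 1 \<Longrightarrow>
      (\<And>x. x \<in> ball 0 1 \<Longrightarrow> ((\<lambda>h. hl0_apply h x) \<longlongrightarrow> hl0_apply f x) F) \<Longrightarrow>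
      \<forall>z\<in>ball 0 1. ((\<lambda>h. hl0_apply (AB_ext h) z) \<longlongrightarrow> hl0_apply (AB_ext f) z) F"
    and g: "\<And>x. x \<in> ball 0 1 \<Longrightarrow> hl0_apply g (bidual_embed x) = hl0_apply f x" "norm g \<le> 1"
  shows "g = AB_ext f"
proof -
  define I where "I = finite_subsets_at_top (ball (0 :: 'a cdual cdual) 1) \<times>\<^sub>F sequentially"
  have "\<exists>h. h \<in> cball 0 1 \<and> (\<forall>z\<in>Z. cmod (hl0_apply (AB_ext h) z - hl0_apply g z) < 1 / real (Suc n))"
    if "finite Z" "Z \<subseteq> ball 0 1" for Z n
    using AB_ext_pointwise_dense[OF map g(2) that, of "1 / real (Suc n)"] by (metis of_nat_0_less_iff zero_less_Suc zero_less_divide_1_iff)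
  then obtain h where h: "\<And>Z n. finite Z \<Longrightarrow> Z \<subseteq> ball 0 1 \<Longrightarrow> h Z n \<in> cball 0 1"
    "\<And>Z n z. finite Z \<Longrightarrow> Z \<subseteq> ball 0 1 \<Longrightarrow> z \<in> Z \<Longrightarrow>
      cmod (hl0_apply (AB_ext (h Z n)) z - hl0_apply g z) < 1 / real (Suc n)"
    by metis
  have nontriv: "I \<noteq> bot" by (simp add: I_def prod_filter_eq_bot)
  have conv: "((\<lambda>i. hl0_apply (AB_ext (case_prod h i)) z) \<longlongrightarrow> hl0_apply g z) I" if z: "z \<in> ball 0 1" for z
  proof (rule tendstoI)
    fix \<epsilon> :: real assume \<epsilon>: "0 < \<epsilon>"
    have "\<forall>\<^sub>F Z in finite_subsets_at_top (ball 0 1). finite Z \<and> z \<in> Z \<and> Z \<subseteq> ball 0 1"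
      unfolding eventually_finite_subsets_at_top using z by (intro exI[of _ "{z}"]) auto
    moreover have "(\<lambda>n. 1 / real (Suc n)) \<longlonglongrightarrow> 0" by (rule LIMSEQ_Suc[OF lim_1_over_n])
    then have "\<forall>\<^sub>F n in sequentially. 1 / real (Suc n) < \<epsilon>" using \<epsilon> by (rule order_tendstoD)
    ultimately have "\<forall>\<^sub>F i in I. (finite (fst i) \<and> z \<in> fst i \<and> fst i \<subseteq> ball 0 1) \<and> 1 / real (Suc (snd i)) < \<epsilon>"
      unfolding I_def by (rule eventually_prodI)
    then show "\<forall>\<^sub>F i in I. dist (hl0_apply (AB_ext (case_prod h i)) z) (hl0_apply g z) < \<epsilon>"
      by eventually_elim (auto simp: dist_norm split_beta simp del: of_nat_Suc intro: less_trans[OF h(2)])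
  qed
  define F where "F = filtermap (case_prod h) I"
  have F: "F \<noteq> bot" using nontriv by (simp add: F_def filtermap_bot_iff)
  have FI: "filterlim u G F \<longleftrightarrow> filterlim (\<lambda>i. u (case_prod h i)) G I" for u :: "'a hl0 \<Rightarrow> complex" and G
    unfolding F_def by (simp add: filterlim_filtermap)
  have "\<forall>\<^sub>F Z in finite_subsets_at_top (ball (0 :: 'a cdual cdual) 1). finite Z \<and> Z \<subseteq> ball 0 1"
    by (intro eventually_finite_subsets_at_top_weakI) auto
  then have "\<forall>\<^sub>F i in I. (finite (fst i) \<and> fst i \<subseteq> ball 0 1) \<and> True"
    unfolding I_def by (rule eventually_prodI) simp
  then have "\<forall>\<^sub>F i in I. case_prod h i \<in> cball 0 1"
    by eventually_elim (use h(1) in \<open>simp add: split_beta\<close>)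
  then have ball: "\<forall>\<^sub>F h in F. h \<in> cball 0 1" by (simp add: F_def eventually_filtermap)
  have "((\<lambda>h. hl0_apply h x) \<longlongrightarrow> hl0_apply f x) F" if x: "x \<in> ball 0 1" for x
  proof -
    have "bidual_embed x \<in> ball 0 1" using x norm_bidual_embed_le[of x] by simp
    from conv[OF this] show ?thesis unfolding FI by (simp add: AB_ext_embed[OF x] g(1)[OF x])
  qed
  from cont[OF F ball this] have lim: "((\<lambda>h. hl0_apply (AB_ext h) z) \<longlongrightarrow> hl0_apply (AB_ext f) z) F"
    if "z \<in> ball 0 1" for z using that by blast
  show ?thesis
  proof (rule hl0_eqI)
    fix z :: "'a cdual cdual" assume z: "z \<in> ball 0 1"
    show "hl0_apply g z = hl0_apply (AB_ext f) z"
      by (rule tendsto_unique[OF nontriv conv[OF z] lim[OF z, unfolded FI]])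
  qed
qed

text \<open>
  If the extensions stayed away from \<open>AB_ext f z\<close> along a finer filter, a pointwise cluster point of
  them along that filter would be another extension of \<open>f\<close> of norm at most \<open>1\<close>.
\<close>

lemma unique_extension_imp_continuous:
  fixes f :: "'a::complex_normed_vector hl0"
  assumes uniq: "\<And>g. (\<And>x. x \<in> ball 0 1 \<Longrightarrow> hl0_apply g (bidual_embed x) = hl0_apply f x) \<Longrightarrow> norm g \<le> 1 \<Longrightarrow> g = AB_ext f"
    and F: "F \<noteq> bot" "\<forall>\<^sub>F h in F. h \<in> cball 0 1"
    and lim: "\<And>x. x \<in> ball 0 1 \<Longrightarrow> ((\<lambda>h. hl0_apply h x) \<longlongrightarrow> hl0_apply f x) F"
  shows "((\<lambda>h. hl0_apply (AB_ext h) z) \<longlongrightarrow> hl0_apply (AB_ext f) z) F"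
proof (rule ccontr)
  define m where "m h = hl0_apply (AB_ext h)" for h :: "'a hl0"
  assume "\<not> ((\<lambda>h. hl0_apply (AB_ext h) z) \<longlongrightarrow> hl0_apply (AB_ext f) z) F"
  then obtain \<epsilon> where \<epsilon>: "0 < \<epsilon>" "\<not> (\<forall>\<^sub>F h in F. dist (m h z) (m f z) < \<epsilon>)"
    unfolding tendsto_iff m_def by blast
  define F1 where "F1 = inf F (principal {h. \<epsilon> \<le> dist (m h z) (m f z)})"
  have F1: "F1 \<noteq> bot"
  proof
    assume "F1 = bot"
    then have "\<forall>\<^sub>F h in F. h \<in> {h. \<epsilon> \<le> dist (m h z) (m f z)} \<longrightarrow> False"
      unfolding F1_def trivial_limit_def by (simp add: eventually_inf_principal)
    then show False using \<epsilon>(2) by (simp add: not_le)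
  qed
  have F1_le: "F1 \<le> F" by (simp add: F1_def)
  have m_ball: "cmod (m h w - m h v) \<le> norm (w - v)" if "h \<in> cball 0 1" "w \<in> ball 0 1" "v \<in> ball 0 1" for h w v
    using hl0_cball_dist[OF _ that(2,3), of "AB_ext h"] that(1) norm_AB_ext_le[of h]
    by (simp add: m_def dist_norm)
  have m_zero: "m h 0 = 0" and m_off: "w \<notin> ball 0 1 \<Longrightarrow> m h w = 0" for h w
    by (simp_all add: m_def hl0_apply_zero hl0_apply_off_ball)
  have m_bound: "cmod (m h w) \<le> 1" if "h \<in> cball 0 1" for h w
  proof (cases "w \<in> ball 0 1")
    case True
    then show ?thesis using m_ball[OF that True, of 0] by (simp add: m_zero)
  qed (simp add: m_off)
  have "\<forall>\<^sub>F h in F1. \<forall>w. cmod (m h w) \<le> 1"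
    using filter_leD[OF F1_le F(2)] by (rule eventually_mono) (blast intro: m_bound)
  then obtain F' q where F': "F' \<noteq> bot" "F' \<le> F1" and q: "\<And>w. ((\<lambda>h. m h w) \<longlongrightarrow> q w) F'"
    using pointwise_cluster[OF F1, of m "\<lambda>_. 1"] by blast
  have cball: "\<forall>\<^sub>F h in F'. h \<in> cball 0 1"
    using F'(2) F1_le F(2) by (meson filter_leD order_trans)
  have hol: "holomorphic_on_ball q"
  proof (rule holomorphic_pointwise_limit[OF F'(1)])
    show "\<forall>\<^sub>F h in F'. holomorphic_on_ball (m h)" by (simp add: m_def hl0_holomorphic)
    show "\<exists>M. \<forall>\<^sub>F h in F'. \<forall>w\<in>ball 0 r. cmod (m h w) \<le> M" for r
      using cball by (intro exI[of _ 1]) (auto elim!: eventually_mono intro: m_bound)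
  qed (rule q)
  have lip: "1-lipschitz_on (ball 0 1) q"
  proof (rule lipschitz_onI)
    fix w v :: "'a cdual cdual" assume "w \<in> ball 0 1" "v \<in> ball 0 1"
    then have "\<forall>\<^sub>F h in F'. cmod (m h w - m h v) \<le> norm (w - v)"
      using cball by (auto elim!: eventually_mono intro: m_ball)
    then have "cmod (q w - q v) \<le> norm (w - v)"
      by (rule tendsto_upperbound[OF tendsto_norm[OF tendsto_diff[OF q q]] _ F'(1)])
    then show "dist (q w) (q v) \<le> 1 * dist w v" by (simp add: dist_norm)
  qed simp
  have zero: "q 0 = 0"
    using tendsto_unique[OF F'(1) q[of 0]] by (simp add: m_zero)
  have off: "q w = 0" if "w \<notin> ball 0 1" for w
    using tendsto_unique[OF F'(1) q[of w]] that by (simp add: m_off)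
  have g: "hl0_apply (HL0 q) = q" "norm (HL0 q) \<le> 1"
    using HL0_of_lipschitz[OF hol lip zero] off by blast+
  have "HL0 q = AB_ext f"
  proof (rule uniq)
    fix x :: 'a assume x: "x \<in> ball 0 1"
    have "((\<lambda>h. m h (bidual_embed x)) \<longlongrightarrow> hl0_apply f x) F'"
      using tendsto_mono[OF order_trans[OF F'(2) F1_le] lim[OF x]] by (simp add: m_def AB_ext_embed[OF x])
    then have "q (bidual_embed x) = hl0_apply f x" by (rule tendsto_unique[OF F'(1) q])
    then show "hl0_apply (HL0 q) (bidual_embed x) = hl0_apply f x" by (simp only: g(1))
  qed (rule g(2))
  then have "q z = m f z" using g(1) by (simp add: m_def)
  then have "\<forall>\<^sub>F h in F'. dist (m h z) (m f z) < \<epsilon>" using tendstoD[OF q[of z] \<epsilon>(1)] by simp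
  moreover have "\<forall>\<^sub>F h in F'. \<epsilon> \<le> dist (m h z) (m f z)"
    by (rule filter_leD[OF F'(2)]) (simp add: F1_def eventually_inf_principal)
  ultimately have "\<forall>\<^sub>F h in F'. False" by eventually_elim simp
  then show False using F'(1) by (simp add: trivial_limit_def)
qed

theorem theorem5p7:
  fixes f :: "'a::{complex_normed_vector, banach} hl0"
  assumes "symmetrically_regular TYPE('a)"
    and "metric_approximation_property TYPE('a cdual cdual)"
    and "norm f = 1"
  shows
    "((\<exists>!g :: 'a cdual cdual hl0.
         (\<forall>x\<in>ball 0 1. hl0_apply g (bidual_embed x) = hl0_apply f x) \<and> norm g = norm f)
      \<longleftrightarrow>
      topcontinuous_at (subtopology hl0_weak_star (cball 0 1))
        (subtopology hl0_weak_star (cball 0 1)) AB_ext f)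
     \<and>
     (topcontinuous_at (subtopology hl0_weak_star (cball 0 1))
        (subtopology hl0_weak_star (cball 0 1)) AB_ext f
      \<longleftrightarrow>
      (\<forall>F :: 'a hl0 filter. F \<noteq> bot \<longrightarrow> (\<forall>\<^sub>F h in F. h \<in> cball 0 1) \<longrightarrow>
         (\<forall>x\<in>ball 0 1. ((\<lambda>h. hl0_apply h x) \<longlongrightarrow> hl0_apply f x) F) \<longrightarrow>
         (\<forall>z\<in>ball 0 1. ((\<lambda>h. hl0_apply (AB_ext h) z) \<longlongrightarrow> hl0_apply (AB_ext f) z) F)))"
    (is "(?unique \<longleftrightarrow> ?cont) \<and> (?cont \<longleftrightarrow> ?pointwise)")
proof -
  have "?cont \<longleftrightarrow> ?pointwise"
  proof (rule topcontinuous_at_iff_pointwise)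
    show "AB_ext h \<in> cball 0 1" if "h \<in> cball 0 1" for h :: "'a hl0"
      using that norm_AB_ext_le[of h] by simp
  qed (simp add: assms(3))
  moreover have "?unique \<longleftrightarrow> ?pointwise"
  proof
    assume unique: ?unique
    have "g = AB_ext f"
      if "\<And>x. x \<in> ball 0 1 \<Longrightarrow> hl0_apply g (bidual_embed x) = hl0_apply f x" "norm g \<le> 1" for g
    proof -
      have "norm g = norm f" using norm_le_of_extension[OF that(1)] that(2) assms(3) by simp
      with unique that(1) show ?thesis using AB_ext_embed norm_AB_ext by blast
    qed
    then show ?pointwise
      by (intro allI impI ballI unique_extension_imp_continuous) auto
  next
    assume pointwise: ?pointwise
    show ?unique
    proof (rule ex1I[of _ "AB_ext f"])
      show "(\<forall>x\<in>ball 0 1. hl0_apply (AB_ext f) (bidual_embed x) = hl0_apply f x) \<and> norm (AB_ext f) = norm f"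
        using AB_ext_embed norm_AB_ext by blast
    next
      fix g :: "'a cdual cdual hl0"
      assume "(\<forall>x\<in>ball 0 1. hl0_apply g (bidual_embed x) = hl0_apply f x) \<and> norm g = norm f"
      then show "g = AB_ext f"
        using pointwise assms(3) by (intro continuous_imp_unique_extension[OF assms(2)]) auto
    qed
  qed
  ultimately show ?thesis by blast
qed

end
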